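(* Let $\mathcal{H}$ be a hypergraph and $k$ an integer with $1\le k\le \nu(\mathcal{H})$. Then for any generalized $k$-admissible matching $M$ of $\mathcal{H}$, $$\mathrm{reg}\left(I(\mathcal{H})^{[k]}\right)\ \ge\ |V(M)|-|M|+k.$$ Consequently, $$\mathrm{reg}\left(I(\mathcal{H})^{[k]}\right)\ \ge\ \max\{\,|V(M)|-|M| : M \text{ is a generalized } k\text{-admissible matching of } \mathcal{H}\,\}+k.$$
   Context: A (simple) hypergraph $\mathcal{H}$ is a pair $(V(\mathcal{H}),E(\mathcal{H}))$ where $V(\mathcal{H})$ is a finite set and $E(\mathcal{H})$ is a collection of nonempty subsets of $V(\mathcal{H})$ (edges), none of which contains another. For $W\subseteq V(\mathcal{H})$, the induced sub-hypergraph $\mathcal{H}[W]$ has vertex set $W$ and edge set $\{\mathcal{E}\in E(\mathcal{H}) : \mathcal{E}\subseteq W\}$. A matching of $\mathcal{H}$ is a set $M$ of pairwise disjoint edges; $V(M)$ is the union of the edges in $M$; $\nu(\mathcal{H})$ is the maximum size of a matching. Identify $V(\mathcal{H})=\{x_1,\dots,x_n\}$ with the variables of $R=\mathbb{K}[x_1,\dots,x_n]$, $\mathbb{K}$ a field. The edge ideal is $I(\mathcal{H})=\langle \prod_{x\in\mathcal{E}}x : \mathcal{E}\in E(\mathcal{H})\rangle$. For $k\ge1$, the $k$-th square-free power $I(\mathcal{H})^{[k]}$ is the ideal generated by the square-free monomials in $I(\mathcal{H})^k$; equivalently, it is generated by the products $u_1\cdots u_k$ of the monomials corresponding to the edges of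 a matching of size $k$. For a graded ideal $I$, $\mathrm{reg}(I)=\max\{j-i : \beta_{i,j}(I)\ne0\}$, where $\beta_{i,j}(I)$ are the graded Betti numbers of $I$ (as a module); $\mathrm{reg}(0)=0$. For $1\le k\le\nu(\mathcal{H})$, a matching $M$ of $\mathcal{H}$ is a generalized $k$-admissible matching if there is a partition $M=M_1\sqcup\cdots\sqcup M_r$ into nonempty parts such that: (1) every edge of $\mathcal{H}[V(M)]$ is an edge of $\mathcal{H}[V(M_i)]$ for some $i\in\{1,\dots,r\}$; (2) $k\le |M|\le r+k-1$; (3) for every $i$ and every matching $M_i'$ of $\mathcal{H}[V(M_i)]$ with $|M_i'|=|M_i|$, one has $V(M_i')=V(M_i)$. *)

theory Defs
  imports
    "HOL-Library.Poly_Mapping"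
    "HOL-Library.Disjoint_Sets"
    "HOL-Algebra.Ideal_Product"
    "Jordan_Normal_Form.Matrix"
begin

section \<open>Hypergraphs\<close>

record 'a hypergraph =
  hverts :: "'a set"
  hedges :: "'a set set"

definition simple_hypergraph :: "'a hypergraph \<Rightarrow> bool" where
  "simple_hypergraph H \<longleftrightarrow>
     finite (hverts H) \<and>
     (\<forall>e\<in>hedges H. e \<noteq> {} \<and> e \<subseteq> hverts H) \<and>
     (\<forall>e\<in>hedges H. \<forall>f\<in>hedges H. e \<subseteq> f \<longrightarrow> e = f)"

definition induced :: "'a hypergraph \<Rightarrow> 'a set \<Rightarrow> 'a hypergraph" where
  "induced H W = \<lparr>hverts = W, hedges = {e \<in> hedges H. e \<subseteq> W}\<rparr>"

text \<open>The vertex set \<open>V(M)\<close> of a matching is \<open>\<Union>M\<close>.\<close>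

definition matching :: "'a hypergraph \<Rightarrow> 'a set set \<Rightarrow> bool" where
  "matching H M \<longleftrightarrow> M \<subseteq> hedges H \<and> disjoint M"

definition matching_number :: "'a hypergraph \<Rightarrow> nat" where
  "matching_number H = Max (card ` {M. matching H M})"

definition gen_admissible_matching :: "'a hypergraph \<Rightarrow> nat \<Rightarrow> 'a set set \<Rightarrow> bool" where
  "gen_admissible_matching H k M \<longleftrightarrow>
     1 \<le> k \<and> k \<le> matching_number H \<and> matching H M \<and>
     (\<exists>P. partition_on M P \<and>
        (\<forall>e\<in>hedges (induced H (\<Union>M)). \<exists>N\<in>P. e \<in> hedges (induced H (\<Union>N))) \<and>
        k \<le> card M \<and> card M \<le> card P + k - 1 \<and>
        (\<forall>N\<in>P. \<forall>N'. matching (induced H (\<Union>N)) N' \<and> card N' = card N \<longrightarrow> \<Union>N' = \<Union>N))"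

section \<open>Polynomial rings and square-free powers of edge ideals\<close>

text \<open>A monomial is its exponent vector; a polynomial maps monomials to coefficients, and
  multiplication on \<open>\<Rightarrow>\<^sub>0\<close> is convolution.\<close>

type_synonym ('a, 'k) mpoly = "('a \<Rightarrow>\<^sub>0 nat) \<Rightarrow>\<^sub>0 'k"

definition mpoly_ring :: "'a set \<Rightarrow> ('a, 'k::field) mpoly ring" where
  "mpoly_ring V =
     \<lparr>carrier = {p. \<forall>m\<in>Poly_Mapping.keys p. Poly_Mapping.keys m \<subseteq> V},
      monoid.mult = (*), one = 1, zero = 0, add = (+)\<rparr>"

lemma cring_mpoly_ring: "cring (mpoly_ring V :: ('a, 'k::field) mpoly ring)"
proof -
  let ?C = "{p :: ('a, 'k) mpoly. \<forall>m\<in>Poly_Mapping.keys p. Poly_Mapping.keys m \<subseteq> V}"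
  have add: "p + q \<in> ?C" if "p \<in> ?C" "q \<in> ?C" for p q
    using that Poly_Mapping.keys_add[of p q] by blast
  have mult: "p * q \<in> ?C" if p: "p \<in> ?C" and q: "q \<in> ?C" for p q
  proof (intro CollectI ballI)
    fix m assume "m \<in> Poly_Mapping.keys (p * q)"
    then obtain a b where "a \<in> Poly_Mapping.keys p" "b \<in> Poly_Mapping.keys q" "m = a + b"
      using keys_mult[of p q] by blast
    with p q Poly_Mapping.keys_add[of a b] show "Poly_Mapping.keys m \<subseteq> V" by blast
  qed
  have uminus: "- p \<in> ?C" if "p \<in> ?C" for p
    using that by simp
  have const: "0 \<in> ?C" "1 \<in> ?C" by simp_all
  show ?thesis
  proof (rule cringI)
    show "abelian_group (mpoly_ring V :: ('a, 'k) mpoly ring)"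
    proof (rule abelian_groupI, unfold mpoly_ring_def ring.simps partial_object.simps)
      fix p assume "p \<in> ?C"
      then show "\<exists>q\<in>?C. q + p = 0"
        using uminus by (intro bexI[of _ "- p"]) auto
    qed (simp_all only: add const ac_simps add_0 add_0_right)
    show "Group.comm_monoid (mpoly_ring V :: ('a, 'k) mpoly ring)"
      by (rule Group.comm_monoidI, unfold mpoly_ring_def monoid.simps partial_object.simps)
         (simp_all only: mult const ac_simps mult_1 mult_1_right)
  qed (simp add: mpoly_ring_def distrib_right)
qed

definition edge_monomial :: "'a set \<Rightarrow> ('a, 'k::field) mpoly" where
  "edge_monomial e = (\<Prod>x\<in>e. Poly_Mapping.single (Poly_Mapping.single x 1) 1)"

definition edge_ideal :: "'a hypergraph \<Rightarrow> ('a, 'k::field) mpoly set" where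
  "edge_ideal H = Idl\<^bsub>mpoly_ring (hverts H)\<^esub> (edge_monomial ` hedges H)"

definition squarefree_monomials :: "('a, 'k::field) mpoly set" where
  "squarefree_monomials =
     {Poly_Mapping.single m 1 | m. \<forall>x. Poly_Mapping.lookup m x \<le> 1}"

definition squarefree_power ::
    "'a set \<Rightarrow> ('a, 'k::field) mpoly set \<Rightarrow> nat \<Rightarrow> ('a, 'k) mpoly set" where
  "squarefree_power V I k =
     Idl\<^bsub>mpoly_ring V\<^esub> (squarefree_monomials \<inter> (I [^]\<^bsub>ideals_set (mpoly_ring V)\<^esub> k))"

section \<open>Graded Betti numbers and regularity\<close>

definition monomial_degree :: "('a \<Rightarrow>\<^sub>0 nat) \<Rightarrow> nat" where
  "monomial_degree m = (\<Sum>x\<in>Poly_Mapping.keys m. Poly_Mapping.lookup m x)"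

definition homogeneous :: "int \<Rightarrow> ('a, 'k::field) mpoly \<Rightarrow> bool" where
  "homogeneous d p \<longleftrightarrow> (\<forall>m\<in>Poly_Mapping.keys p. int (monomial_degree m) = d)"

definition free_module :: "'a set \<Rightarrow> nat \<Rightarrow> ('a, 'k::field) mpoly vec set" where
  "free_module V n = {v \<in> carrier_vec n. \<forall>i<n. v $ i \<in> carrier (mpoly_ring V)}"

text \<open>\<open>graded_map V s t A\<close>: the matrix \<open>A\<close> is a degree-0 homomorphism from
  \<open>\<Oplus>\<^sub>b R(-t!b)\<close> to \<open>\<Oplus>\<^sub>a R(-s!a)\<close>, where \<open>R\<close> is the polynomial ring in the
  variables \<open>V\<close>. The basis element \<open>b\<close> has degree \<open>t!b\<close>, so the entry \<open>(a, b)\<close> is homogeneous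
  of degree \<open>t!b - s!a\<close> (hence zero if this number is negative).\<close>

definition graded_map ::
    "'a set \<Rightarrow> nat list \<Rightarrow> nat list \<Rightarrow> ('a, 'k::field) mpoly mat \<Rightarrow> bool" where
  "graded_map V s t A \<longleftrightarrow>
     A \<in> carrier_mat (length s) (length t) \<and>
     (\<forall>a<length s. \<forall>b<length t.
        A $$ (a, b) \<in> carrier (mpoly_ring V) \<and>
        homogeneous (int (t ! b) - int (s ! a)) (A $$ (a, b)))"

text \<open>
  \<open>(s, A)\<close> encodes a minimal graded free resolution
  \<open>0 \<rightarrow> F\<^sub>p \<rightarrow> \<dots> \<rightarrow> F\<^sub>1 \<rightarrow> F\<^sub>0 \<rightarrow> I \<rightarrow> 0\<close> of the ideal \<open>I\<close> as a module (not of the quotient by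
  \<open>I\<close>): \<open>s i\<close> lists the degrees of the basis elements of \<open>F\<^sub>i\<close>, \<open>A 0\<close> is the one-row matrix of
  the augmentation \<open>F\<^sub>0 \<rightarrow> I \<subseteq> R\<close>, and \<open>A (i + 1)\<close> is the matrix of \<open>F\<^bsub>i+1\<^esub> \<rightarrow> F\<^sub>i\<close>.
  Minimality means that the entries of \<open>A (i + 1)\<close> have zero constant term, i.e. lie in the
  ideal generated by the variables. Since a homogeneous ideal lives in non-negative degrees,
  natural numbers suffice for the degrees of basis elements.\<close>

definition minimal_graded_free_resolution ::
    "'a set \<Rightarrow> ('a, 'k::field) mpoly set \<Rightarrow>
     (nat \<Rightarrow> nat list) \<Rightarrow> (nat \<Rightarrow> ('a, 'k) mpoly mat) \<Rightarrow> bool" where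
  "minimal_graded_free_resolution V I s A \<longleftrightarrow>
     graded_map V [0] (s 0) (A 0) \<and>
     (\<forall>i. graded_map V (s i) (s (Suc i)) (A (Suc i))) \<and>
     (\<lambda>v. (A 0 *\<^sub>v v) $ 0) ` free_module V (length (s 0)) = I \<and>
     (\<forall>i. {v \<in> free_module V (length (s i)). A i *\<^sub>v v = 0\<^sub>v (dim_row (A i))} =
          (\<lambda>w. A (Suc i) *\<^sub>v w) ` free_module V (length (s (Suc i)))) \<and>
     (\<forall>i. \<forall>a<length (s i). \<forall>b<length (s (Suc i)).
          Poly_Mapping.lookup (A (Suc i) $$ (a, b)) 0 = 0) \<and>
     (\<exists>p. \<forall>i>p. s i = [])"

text \<open>Minimal graded free resolutions of a homogeneous ideal are unique up to isomorphism, so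
  the number of basis elements of \<open>F\<^sub>i\<close> of degree \<open>j\<close> does not depend on the one chosen.\<close>

definition graded_betti :: "'a set \<Rightarrow> ('a, 'k::field) mpoly set \<Rightarrow> nat \<Rightarrow> nat \<Rightarrow> nat" where
  "graded_betti V I i j =
     count_list ((SOME s. \<exists>A. minimal_graded_free_resolution V I s A) i) j"

definition regularity :: "'a set \<Rightarrow> ('a, 'k::field) mpoly set \<Rightarrow> int" where
  "regularity V I =
     (if I = {0} then 0 else Max {int j - int i | i j. graded_betti V I i j \<noteq> 0})"

end

theory Submission
  imports Defs
begin

text \<open>
  Merging parts of the partition, one may assume that \<open>M\<close> has exactly \<open>r = |M| - k + 1\<close> parts.
  Write \<open>W = V(M)\<close> and let \<open>W\<^sub>i\<close> be the vertex set of the \<open>i\<close>-th part. By condition (3) a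
  \<open>k\<close>-matching inside \<open>W\<close> must contain some \<open>W\<^sub>i\<close>, while deleting from \<open>M\<close> the edges through
  \<open>r - 1\<close> vertices \<open>x\<^sub>i \<in> W\<^sub>i\<close> leaves a \<open>k\<close>-matching. Hence the Koszul boundary of
  \<open>x\<^bsup>W - X\<^esup> e\<^bsub>X\<^esub>\<close>, \<open>X = {x\<^sub>1, \<dots>, x\<^sub>r}\<close>, is a cycle with coefficients in \<open>I(H)\<^bsup>[k]\<^esup>\<close>; it is not the
  boundary of a chain with coefficients in that ideal, because the functional that sums the
  coefficients over the transversals of \<open>W\<^sub>2, \<dots>, W\<^sub>r\<close> vanishes on all those boundaries. So
  \<open>Tor\<^bsub>r-1\<^esub>(I(H)\<^bsup>[k]\<^esup>, K)\<close> is nonzero in degree \<open>|W|\<close>, and a staircase argument forces every graded free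
  resolution to have a generator of homological degree \<open>r - 1\<close> and internal degree \<open>|W|\<close>. That a
  minimal resolution exists at all follows from the Taylor resolution by Gaussian elimination.
\<close>

section \<open>Polynomials and their homogeneous components\<close>

text \<open>\<open>graded_betti\<close> reads off an arbitrarily chosen resolution, so the generator
  must be exhibited in every one; the Koszul complex on the variables serves as a test object
  independent of that choice. It is the Taylor complex of the singletons, so the exactness of
  \<open>tay\<close> is used twice: for the existence of a resolution and on the Koszul side. The
  number of classes comes from counting. Let p = |M| - k and take p + 1 classes. A matching inside W
  that misses a vertex of each class has at least p + 1 edges fewer than M, hence fewer than k,
  whereas deleting the p edges through p chosen vertices leaves exactly k. The bound is internal
  degree minus homological degree, |W| - p = |V(M)| - |M| + k. The functional reads only the
  square-free multidegree W, through the coefficients at \<open>ind (W - S)\<close>. On the cycle it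
  meets a single nonzero term, the facet of X that omits the vertex of the first class (class 0 in
  the code), and takes the value 1 over every field.\<close>

abbreviation PR :: "'a set \<Rightarrow> ('a, 'k::field) mpoly set" where
  "PR V \<equiv> carrier (mpoly_ring V)"

definition ind :: "'a set \<Rightarrow> 'a \<Rightarrow>\<^sub>0 nat" where
  "ind U = (\<Sum>x\<in>U. Poly_Mapping.single x 1)"

lemma mem_PR: "p \<in> PR V \<longleftrightarrow> (\<forall>m\<in>Poly_Mapping.keys p. Poly_Mapping.keys m \<subseteq> V)"
  by (simp add: mpoly_ring_def)

lemma PR_zero [simp]: "0 \<in> PR V" and PR_one [simp]: "1 \<in> PR V"
  by (simp_all add: mem_PR)

lemma PR_add: "p \<in> PR V \<Longrightarrow> q \<in> PR V \<Longrightarrow> p + q \<in> PR V"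
  using Poly_Mapping.keys_add[of p q] by (auto simp: mem_PR)

lemma PR_uminus: "p \<in> PR V \<Longrightarrow> - p \<in> PR V"
  by (simp add: mem_PR)

lemma PR_diff: "p \<in> PR V \<Longrightarrow> q \<in> PR V \<Longrightarrow> p - q \<in> PR V"
  using PR_add[OF _ PR_uminus] by fastforce

lemma PR_mult: "p \<in> PR V \<Longrightarrow> q \<in> PR V \<Longrightarrow> p * q \<in> PR V"
  using monoid.m_closed[OF ring.is_monoid[OF cring.axioms(1)[OF cring_mpoly_ring]], of p V q]
  by (simp add: mpoly_ring_def)

lemma PR_sum: "(\<And>x. x \<in> A \<Longrightarrow> f x \<in> PR V) \<Longrightarrow> sum f A \<in> PR V"
  by (induction A rule: infinite_finite_induct) (auto intro: PR_add)

lemma lookup_ind: "finite U \<Longrightarrow> Poly_Mapping.lookup (ind U) x = (if x \<in> U then 1 else 0)"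
  by (simp add: ind_def lookup_sum lookup_single when_def)

lemma keys_ind [simp]: "finite U \<Longrightarrow> Poly_Mapping.keys (ind U) = U"
  by (auto simp: in_keys_iff lookup_ind split: if_splits)

lemma ind_union_disjoint:
  "finite U \<Longrightarrow> finite U' \<Longrightarrow> U \<inter> U' = {} \<Longrightarrow> ind (U \<union> U') = ind U + ind U'"
  by (simp add: ind_def sum.union_disjoint)

text \<open>The union is the support of the lcm, so \<open>ind (U' - U)\<close> is the exponent of
  the lcm divided by the monomial of \<open>U\<close>. Such quotients are the entries of the Taylor
  differential.\<close>

lemma ind_Un_Diff: "finite U \<Longrightarrow> finite U' \<Longrightarrow> ind (U \<union> U') = ind U + ind (U' - U)"
  using ind_union_disjoint[of U "U' - U"] by auto

lemma ind_empty [simp]: "ind {} = 0"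
  by (simp add: ind_def)

text \<open>Subtraction of exponents is truncated; the support condition is divisibility by a
  square-free monomial, under which it is a true quotient.\<close>

lemma ind_add_diff: "finite U \<Longrightarrow> U \<subseteq> Poly_Mapping.keys m \<Longrightarrow> ind U + (m - ind U) = m"
proof (rule poly_mapping_eqI)
  fix x assume U: "finite U" "U \<subseteq> Poly_Mapping.keys m"
  have "x \<in> U \<Longrightarrow> Poly_Mapping.lookup m x > 0" using U by (simp add: in_keys_iff subset_iff)
  then show "Poly_Mapping.lookup (ind U + (m - ind U)) x = Poly_Mapping.lookup m x"
    using U by (auto simp: lookup_add lookup_minus lookup_ind)
qed

lemma keys_add_nat:
  fixes m n :: "'a \<Rightarrow>\<^sub>0 nat"
  shows "Poly_Mapping.keys (m + n) = Poly_Mapping.keys m \<union> Poly_Mapping.keys n"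
  by (auto simp: in_keys_iff lookup_add)

lemma edge_monomial_eq: "finite U \<Longrightarrow> edge_monomial U = Poly_Mapping.single (ind U) 1"
  by (induction U rule: finite_induct)
     (simp_all add: edge_monomial_def ind_def mult_single)

lemma edge_monomial_empty [simp]: "edge_monomial {} = 1"
  by (simp add: edge_monomial_def)

lemma edge_monomial_PR: "finite U \<Longrightarrow> U \<subseteq> V \<Longrightarrow> edge_monomial U \<in> PR V"
  by (simp add: edge_monomial_eq mem_PR)

lemma edge_monomial_mult:
  "finite U \<Longrightarrow> finite U' \<Longrightarrow> U \<inter> U' = {} \<Longrightarrow>
     edge_monomial U * edge_monomial U' = edge_monomial (U \<union> U')"
  by (simp add: edge_monomial_def prod.union_disjoint)

lemma poly_mapping_expand:
  "p = (\<Sum>m\<in>Poly_Mapping.keys p. Poly_Mapping.single m (Poly_Mapping.lookup p m))"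
  by (rule poly_mapping_eqI) (simp add: lookup_sum lookup_single when_def in_keys_iff)

lemma lookup_single_times:
  fixes p :: "('a, 'k::field) mpoly"
  shows "Poly_Mapping.lookup (Poly_Mapping.single a 1 * p) (a + m) = Poly_Mapping.lookup p m"
proof -
  have "Poly_Mapping.single a 1 * p =
      (\<Sum>n\<in>Poly_Mapping.keys p. Poly_Mapping.single (a + n) (Poly_Mapping.lookup p n))"
    by (subst (1) poly_mapping_expand[of p]) (simp add: sum_distrib_left mult_single)
  then show ?thesis
    by (simp add: lookup_sum lookup_single when_def in_keys_iff)
qed

text \<open>Divisibility by a square-free monomial depends only on the support of \<open>m\<close>;
  this is what turns coefficient computations into combinatorics of supports.\<close>

lemma lookup_edge_monomial_times:
  assumes "finite U"
  shows "Poly_Mapping.lookup (edge_monomial U * p) m =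
    (if U \<subseteq> Poly_Mapping.keys m then Poly_Mapping.lookup p (m - ind U) else 0)"
proof (cases "U \<subseteq> Poly_Mapping.keys m")
  case True
  then show ?thesis
    using lookup_single_times[of "ind U" p "m - ind U"] assms
    by (simp add: edge_monomial_eq ind_add_diff)
next
  case False
  have "m \<notin> Poly_Mapping.keys (edge_monomial U * p)"
  proof
    assume "m \<in> Poly_Mapping.keys (edge_monomial U * p)"
    then obtain n where "m = ind U + n"
      using keys_mult[of "edge_monomial U" p] assms by (auto simp: edge_monomial_eq)
    then have "U \<subseteq> Poly_Mapping.keys m" using assms by (simp add: keys_add_nat)
    with False show False ..
  qed
  with False show ?thesis by (simp add: in_keys_iff)
qed

lemma lookup_Abs_mpoly:
  "finite K \<Longrightarrow> (\<And>m. f m \<noteq> 0 \<Longrightarrow> m \<in> K) \<Longrightarrow> Poly_Mapping.lookup (Abs_poly_mapping f) = f"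
  by (rule lookup_Abs_poly_mapping) (auto elim: rev_finite_subset)

section \<open>Degrees and homogeneous components\<close>

lemma monomial_degree_superset:
  "finite A \<Longrightarrow> Poly_Mapping.keys m \<subseteq> A \<Longrightarrow> monomial_degree m = (\<Sum>x\<in>A. Poly_Mapping.lookup m x)"
  unfolding monomial_degree_def by (rule sum.mono_neutral_left) (auto simp: in_keys_iff)

lemma monomial_degree_add: "monomial_degree (m + n) = monomial_degree m + monomial_degree n"
proof -
  let ?A = "Poly_Mapping.keys m \<union> Poly_Mapping.keys n"
  show ?thesis
    by (simp add: monomial_degree_superset[of ?A] keys_add_nat lookup_add sum.distrib)
qed

lemma monomial_degree_ind: "finite U \<Longrightarrow> monomial_degree (ind U) = card U"
  by (simp add: monomial_degree_def lookup_ind)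

lemma monomial_degree_0_iff: "monomial_degree m = 0 \<longleftrightarrow> m = 0"
  by (auto simp: monomial_degree_def in_keys_iff intro!: poly_mapping_eqI)

lemma homogeneous_add: "homogeneous d p \<Longrightarrow> homogeneous d q \<Longrightarrow> homogeneous d (p + q)"
  using Poly_Mapping.keys_add[of p q] by (auto simp: homogeneous_def)

lemma homogeneous_0 [simp]: "homogeneous d 0"
  by (simp add: homogeneous_def)

lemma homogeneous_uminus: "homogeneous d p \<Longrightarrow> homogeneous d (- p)"
  by (simp add: homogeneous_def)

lemma homogeneous_diff: "homogeneous d p \<Longrightarrow> homogeneous d q \<Longrightarrow> homogeneous d (p - q)"
  using homogeneous_add[OF _ homogeneous_uminus] by fastforce

lemma homogeneous_sum: "(\<And>x. x \<in> A \<Longrightarrow> homogeneous d (f x)) \<Longrightarrow> homogeneous d (sum f A)"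
  by (induction A rule: infinite_finite_induct) (auto intro: homogeneous_add)

lemma homogeneous_mult:
  "homogeneous d p \<Longrightarrow> homogeneous e q \<Longrightarrow> homogeneous (d + e) (p * q)"
  using keys_mult[of p q] by (fastforce simp: homogeneous_def monomial_degree_add)

lemma homogeneous_mult':
  "homogeneous d p \<Longrightarrow> homogeneous e q \<Longrightarrow> f = d + e \<Longrightarrow> homogeneous f (p * q)"
  by (simp add: homogeneous_mult)

lemma homogeneous_edge_monomial: "finite U \<Longrightarrow> homogeneous (int (card U)) (edge_monomial U)"
  by (simp add: edge_monomial_eq homogeneous_def monomial_degree_ind)

definition hcomp :: "int \<Rightarrow> ('a, 'k::field) mpoly \<Rightarrow> ('a, 'k) mpoly" where
  "hcomp d p = Poly_Mapping.mapp (\<lambda>m c. if int (monomial_degree m) = d then c else 0) p"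

lemma lookup_hcomp:
  "Poly_Mapping.lookup (hcomp d p) m =
     (if int (monomial_degree m) = d then Poly_Mapping.lookup p m else 0)"
  by (simp add: hcomp_def lookup_mapp when_def in_keys_iff)

lemma hcomp_add: "hcomp d (p + q) = hcomp d p + hcomp d q"
  by (rule poly_mapping_eqI) (simp add: lookup_hcomp lookup_add)

lemma hcomp_sum: "hcomp d (sum f A) = (\<Sum>x\<in>A. hcomp d (f x))"
  by (rule poly_mapping_eqI) (simp add: lookup_hcomp lookup_sum)

lemma homogeneous_hcomp: "homogeneous d (hcomp d p)"
  by (auto simp: homogeneous_def in_keys_iff lookup_hcomp split: if_splits)

lemma hcomp_homogeneous: "homogeneous d p \<Longrightarrow> hcomp d p = p"
  by (rule poly_mapping_eqI) (auto simp: lookup_hcomp homogeneous_def in_keys_iff)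

lemma PR_hcomp: "p \<in> PR V \<Longrightarrow> hcomp d p \<in> PR V"
  by (auto simp: mem_PR in_keys_iff lookup_hcomp split: if_splits)

text \<open>Split off the component of \<open>w\<close> in degree \<open>d - e\<close>: the rest
  \<open>u\<close> has no term of that degree, and every term of \<open>A\<close> has degree
  \<open>e\<close>, so no product of their terms lands in degree \<open>d\<close>.\<close>

lemma hcomp_mult:
  assumes "homogeneous e A"
  shows "hcomp d (A * w) = A * hcomp (d - e) w"
proof -
  define u where "u = w - hcomp (d - e) w"
  have "hcomp d (A * u) = 0"
  proof (rule poly_mapping_eqI, rule ccontr)
    fix m assume "Poly_Mapping.lookup (hcomp d (A * u)) m \<noteq> Poly_Mapping.lookup 0 m"
    then have deg: "int (monomial_degree m) = d" and "m \<in> Poly_Mapping.keys (A * u)"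
      by (auto simp: lookup_hcomp in_keys_iff split: if_splits)
    then obtain a b where ab: "a \<in> Poly_Mapping.keys A" "b \<in> Poly_Mapping.keys u" "m = a + b"
      using keys_mult[of A u] by blast
    then have "int (monomial_degree b) = d - e"
      using deg assms by (auto simp: homogeneous_def monomial_degree_add)
    with ab(2) show False by (simp add: u_def in_keys_iff lookup_minus lookup_hcomp)
  qed
  moreover have "hcomp d (A * hcomp (d - e) w) = A * hcomp (d - e) w"
    by (intro hcomp_homogeneous homogeneous_mult'[OF assms homogeneous_hcomp]) simp
  moreover have "A * w = A * u + A * hcomp (d - e) w"
    by (simp add: u_def algebra_simps)
  ultimately show ?thesis by (simp add: hcomp_add)
qed

section \<open>The Taylor complex\<close>

text \<open>The basis of the Taylor complex in position \<open>i\<close>; the empty cell in position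
  0 generates the ring.\<close>

definition cells :: "'i set \<Rightarrow> nat \<Rightarrow> 'i set set" where
  "cells X i = {S. S \<subseteq> X \<and> card S = i}"

text \<open>The simplicial boundary sign: the exponent is the position of \<open>s\<close> in
  \<open>insert s T\<close> when vertices are ordered by \<rho>.\<close>

definition sg :: "('i \<Rightarrow> nat) \<Rightarrow> 'i \<Rightarrow> 'i set \<Rightarrow> 'r::comm_ring_1" where
  "sg \<rho> s T = (-1) ^ card {t \<in> T. \<rho> t < \<rho> s}"

text \<open>Matrix entry of the Taylor differential from the basis element of \<open>S\<close> to
  that of \<open>T\<close>. The difference of supports is the quotient lcm(S) / lcm(T). With
  singletons for \<open>U\<close> this is the Koszul complex.\<close>

definition tay :: "('i \<Rightarrow> nat) \<Rightarrow> ('i \<Rightarrow> 'a set) \<Rightarrow> 'i set \<Rightarrow> 'i set \<Rightarrow> ('a, 'k::field) mpoly" where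
  "tay \<rho> U T S =
     (if \<exists>s. s \<notin> T \<and> S = insert s T
      then sg \<rho> (the_elem (S - T)) T * edge_monomial (U (the_elem (S - T)) - \<Union>(U ` T))
      else 0)"

lemma tay_insert:
  "s \<notin> T \<Longrightarrow> tay \<rho> U T (insert s T) = sg \<rho> s T * edge_monomial (U s - \<Union>(U ` T))"
proof -
  assume "s \<notin> T"
  then have "insert s T - T = {s}" by blast
  with \<open>s \<notin> T\<close> show ?thesis by (auto simp: tay_def)
qed

lemma tay_eq_0: "(\<And>s. s \<notin> T \<Longrightarrow> S \<noteq> insert s T) \<Longrightarrow> tay \<rho> U T S = 0"
  by (auto simp: tay_def)

lemma finite_cells: "finite X \<Longrightarrow> finite (cells X i)"
  by (simp add: cells_def)

lemma insert_mem_cells: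
  "finite X \<Longrightarrow> T \<in> cells X i \<Longrightarrow> s \<in> X - T \<Longrightarrow> insert s T \<in> cells X (Suc i)"
  by (auto simp: cells_def card_insert_if finite_subset)

lemma cells_remove:
  "finite X \<Longrightarrow> S \<in> cells X (Suc i) \<Longrightarrow> s \<in> S \<Longrightarrow> S - {s} \<in> cells X i"
  by (auto simp: cells_def)

lemma sum_tay:
  assumes X: "finite X" and T: "T \<in> cells X i"
  shows "(\<Sum>S\<in>cells X (Suc i). tay \<rho> U T S * v S) =
    (\<Sum>s\<in>X - T. sg \<rho> s T * edge_monomial (U s - \<Union>(U ` T)) * v (insert s T))"
proof -
  have "(\<Sum>S\<in>cells X (Suc i). tay \<rho> U T S * v S) =
      (\<Sum>S\<in>(\<lambda>s. insert s T) ` (X - T). tay \<rho> U T S * v S)"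
  proof (rule sum.mono_neutral_right)
    show "\<forall>S\<in>cells X (Suc i) - (\<lambda>s. insert s T) ` (X - T). tay \<rho> U T S * v S = 0"
    proof
      fix S assume "S \<in> cells X (Suc i) - (\<lambda>s. insert s T) ` (X - T)"
      then show "tay \<rho> U T S * v S = 0" by (subst tay_eq_0) (auto simp: cells_def)
    qed
  qed (use insert_mem_cells[OF X T] finite_cells[OF X] in auto)
  also have "\<dots> = (\<Sum>s\<in>X - T. tay \<rho> U T (insert s T) * v (insert s T))"
    by (rule sum.reindex_cong[of "\<lambda>s. insert s T"]) (auto simp: inj_on_def)
  finally show ?thesis by (simp add: tay_insert)
qed

lemma sg_min: "(\<And>t. t \<in> T \<Longrightarrow> \<rho> s \<le> \<rho> t) \<Longrightarrow> sg \<rho> s T = 1"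
proof -
  assume "\<And>t. t \<in> T \<Longrightarrow> \<rho> s \<le> \<rho> t"
  then have "{t \<in> T. \<rho> t < \<rho> s} = {}" by fastforce
  then show ?thesis by (simp only: sg_def card.empty power_0)
qed

lemma sg_insert_smaller:
  assumes "finite T" "a \<notin> T" "\<rho> a < \<rho> s"
  shows "sg \<rho> s (insert a T) = - sg \<rho> s T"
proof -
  have "{t \<in> insert a T. \<rho> t < \<rho> s} = insert a {t \<in> T. \<rho> t < \<rho> s}" using assms by auto
  with assms show ?thesis by (simp add: sg_def)
qed

lemma sg_insert_larger: "\<not> \<rho> a < \<rho> s \<Longrightarrow> sg \<rho> s (insert a T) = sg \<rho> s T"
  unfolding sg_def by (rule arg_cong[of _ _ "\<lambda>A. (-1) ^ card A"]) auto

lemma lookup_sg_times: "Poly_Mapping.lookup (sg \<rho> s T * p) m = sg \<rho> s T * Poly_Mapping.lookup p m"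
  for p :: "('a, 'k::field) mpoly"
  by (cases "even (card {t \<in> T. \<rho> t < \<rho> s})") (simp_all add: sg_def)

text \<open>A simplex is a cone over its first vertex \<open>x0\<close>, and adjoining
  \<open>x0\<close> inverts the boundary on cycles. If \<open>x0\<close> is not in \<open>T\<close>,
  only \<open>s = x0\<close> contributes, with sign 1. Otherwise each sign is opposite to the one
  over \<open>T - {x0}\<close>, and the cycle condition there leaves \<open>f T\<close>.\<close>

lemma cone:
  fixes f :: "'i set \<Rightarrow> 'r::comm_ring_1"
  assumes X: "finite X" "inj_on \<rho> X" and x0: "x0 \<in> X" "\<And>x. x \<in> X \<Longrightarrow> \<rho> x0 \<le> \<rho> x" and T: "T \<subseteq> X"
    and cyc: "x0 \<in> T \<Longrightarrow>
      (\<Sum>s\<in>X - (T - {x0}). sg \<rho> s (T - {x0}) * f (insert s (T - {x0}))) = 0"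
  shows "(\<Sum>s\<in>X - T. sg \<rho> s T * (if x0 \<in> insert s T then f (insert s T - {x0}) else 0)) = f T"
proof (cases "x0 \<in> T")
  case False
  have "(\<Sum>s\<in>X - T. sg \<rho> s T * (if x0 \<in> insert s T then f (insert s T - {x0}) else 0)) =
      (\<Sum>s\<in>{x0}. sg \<rho> s T * (if x0 \<in> insert s T then f (insert s T - {x0}) else 0))"
    by (rule sum.mono_neutral_right) (use X x0 False in auto)
  also have "\<dots> = f T" using False x0 T by (simp add: sg_min subset_iff)
  finally show ?thesis .
next
  case True
  define T' where "T' = T - {x0}"
  have T': "T = insert x0 T'" "x0 \<notin> T'" "finite T'"
    using True X T by (auto simp: T'_def finite_subset)
  have "X - T' = insert x0 (X - T)" using T' x0 by auto
  moreover have "sg \<rho> x0 T' = (1 :: 'r)" by (rule sg_min) (use T T' x0 in auto)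
  moreover have "insert x0 T' = T" "finite (X - T)" "x0 \<notin> X - T" using T' X True by simp_all
  ultimately have "(\<Sum>s\<in>X - T'. sg \<rho> s T' * f (insert s T')) =
      f T + (\<Sum>s\<in>X - T. sg \<rho> s T' * f (insert s T'))"
    by (simp only: sum.insert mult_1 not_False_eq_True)
  moreover have "(\<Sum>s\<in>X - T. sg \<rho> s T * (if x0 \<in> insert s T then f (insert s T - {x0}) else 0)) =
      (\<Sum>s\<in>X - T. - (sg \<rho> s T' * f (insert s T')))"
  proof (rule sum.cong)
    fix s assume s: "s \<in> X - T"
    then have "\<rho> x0 < \<rho> s"
      using x0 X(2) True by (metis DiffD1 DiffD2 inj_on_def le_neq_implies_less)
    then have "sg \<rho> s T = - (sg \<rho> s T' :: 'r)" using T' sg_insert_smaller by metis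
    moreover have "insert s T - {x0} = insert s T'" using s True T' by auto
    ultimately show "sg \<rho> s T * (if x0 \<in> insert s T then f (insert s T - {x0}) else 0) =
        - (sg \<rho> s T' * f (insert s T'))" using True by simp
  qed simp
  moreover have "(\<Sum>s\<in>X - T'. sg \<rho> s T' * f (insert s T')) = 0"
    unfolding T'_def using cyc True .
  ultimately show ?thesis by (simp only: sum_negf) (metis add_eq_0_iff2)
qed

text \<open>The complex splits by multidegree. In multidegree \<open>u\<close> the basis element of
  \<open>T\<close> carries the coefficient at \<open>u\<close> divided by its lcm, and what remains
  is the boundary of the full simplex on the indices whose monomial divides
  \<open>u\<close>.\<close>

lemma lookup_tay:
  fixes v :: "'i set \<Rightarrow> ('a, 'k::field) mpoly"
  assumes X: "finite X" "\<And>x. x \<in> X \<Longrightarrow> finite (U x)" and T: "T \<subseteq> X"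
    and u: "\<Union>(U ` T) \<subseteq> Poly_Mapping.keys u"
  shows "Poly_Mapping.lookup
      (\<Sum>s\<in>X - T. sg \<rho> s T * edge_monomial (U s - \<Union>(U ` T)) * v (insert s T)) (u - ind (\<Union>(U ` T)))
    = (\<Sum>s\<in>{x\<in>X. U x \<subseteq> Poly_Mapping.keys u} - T.
         sg \<rho> s T * Poly_Mapping.lookup (v (insert s T)) (u - ind (\<Union>(U ` insert s T))))"
proof -
  let ?A = "\<Union>(U ` T)"
  have A: "finite ?A" using X T by (auto simp: finite_subset)
  have ku: "Poly_Mapping.keys u = ?A \<union> Poly_Mapping.keys (u - ind ?A)"
    using ind_add_diff[OF A u] keys_add_nat keys_ind[OF A] by metis
  have *: "Poly_Mapping.lookup (edge_monomial (U s - ?A) * v (insert s T)) (u - ind ?A) =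
      (if U s \<subseteq> Poly_Mapping.keys u
       then Poly_Mapping.lookup (v (insert s T)) (u - ind (\<Union>(U ` insert s T))) else 0)"
    if "s \<in> X" for s
  proof -
    have fin: "finite (U s)" using X that by simp
    have "\<Union>(U ` insert s T) = ?A \<union> U s" by auto
    then have "ind (\<Union>(U ` insert s T)) = ind ?A + ind (U s - ?A)"
      using ind_Un_Diff[OF A fin] by simp
    then have "u - ind ?A - ind (U s - ?A) = u - ind (\<Union>(U ` insert s T))"
      by (metis diff_diff_add)
    moreover have "U s - ?A \<subseteq> Poly_Mapping.keys (u - ind ?A) \<longleftrightarrow> U s \<subseteq> Poly_Mapping.keys u"
      using ku by blast
    ultimately show ?thesis using fin by (simp add: lookup_edge_monomial_times)
  qed
  have "Poly_Mapping.lookup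
      (\<Sum>s\<in>X - T. sg \<rho> s T * edge_monomial (U s - ?A) * v (insert s T)) (u - ind ?A)
    = (\<Sum>s\<in>X - T. sg \<rho> s T * (if U s \<subseteq> Poly_Mapping.keys u
       then Poly_Mapping.lookup (v (insert s T)) (u - ind (\<Union>(U ` insert s T))) else 0))"
    unfolding lookup_sum mult.assoc lookup_sg_times by (rule sum.cong) (simp_all only: * DiffD1)
  also have "\<dots> = (\<Sum>s\<in>{x\<in>X. U x \<subseteq> Poly_Mapping.keys u} - T.
         sg \<rho> s T * Poly_Mapping.lookup (v (insert s T)) (u - ind (\<Union>(U ` insert s T))))"
    by (rule sum.mono_neutral_cong_right) (use X in auto)
  finally show ?thesis .
qed

text \<open>The contracting homotopy acts in each multidegree as the cone over the smallest index
  whose monomial divides that multidegree.\<close>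

lemma tay_exact:
  fixes v :: "'i set \<Rightarrow> ('a, 'k::field) mpoly"
  assumes X: "finite X" "inj_on \<rho> X" and U: "\<And>x. x \<in> X \<Longrightarrow> finite (U x) \<and> U x \<subseteq> V"
    and v: "\<And>S. S \<in> cells X i \<Longrightarrow> v S \<in> PR V"
    and cyc: "\<And>T j. i = Suc j \<Longrightarrow> T \<in> cells X j \<Longrightarrow>
       (\<Sum>S\<in>cells X i. tay \<rho> U T S * v S) = 0"
    and aug: "\<And>m. i = 0 \<Longrightarrow> m \<in> Poly_Mapping.keys (v {}) \<Longrightarrow> \<exists>x\<in>X. U x \<subseteq> Poly_Mapping.keys m"
  shows "\<exists>w. (\<forall>S\<in>cells X (Suc i). w S \<in> PR V) \<and>
    (\<forall>T\<in>cells X i. v T = (\<Sum>S\<in>cells X (Suc i). tay \<rho> U T S * w S))"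
proof -
  define Xu where "Xu u = {x\<in>X. U x \<subseteq> Poly_Mapping.keys u}" for u :: "'a \<Rightarrow>\<^sub>0 nat"
  define x0 where "x0 u = (SOME x. x \<in> Xu u \<and> (\<forall>y\<in>Xu u. \<rho> x \<le> \<rho> y))" for u :: "'a \<Rightarrow>\<^sub>0 nat"
  have x0: "x0 u \<in> Xu u \<and> (\<forall>y\<in>Xu u. \<rho> (x0 u) \<le> \<rho> y)" if "Xu u \<noteq> {}" for u
  proof -
    from that obtain x where "x \<in> Xu u" by blast
    from ex_has_least_nat[of "\<lambda>x. x \<in> Xu u", OF this, of \<rho>]
    have "\<exists>x. x \<in> Xu u \<and> (\<forall>y\<in>Xu u. \<rho> x \<le> \<rho> y)" by blast
    from someI_ex[OF this] show ?thesis unfolding x0_def .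
  qed
  have finU: "finite (\<Union>(U ` S))" if "S \<subseteq> X" for S
    using X U that by (auto simp: finite_subset)
  \<comment> \<open>The coefficient at \<open>m\<close> on the cell \<open>S\<close> sits in
    multidegree \<open>u\<close>, that is \<open>m\<close> times the lcm of \<open>S\<close>. The
    apex \<open>x0 u\<close> depends on \<open>u\<close> alone, so all cells of one multidegree use
    the same cone.\<close>
  define g where "g S m = (let u = m + ind (\<Union>(U ` S)) in
      if x0 u \<in> S then Poly_Mapping.lookup (v (S - {x0 u})) (u - ind (\<Union>(U ` (S - {x0 u})))) else 0)"
    for S m
  define w where "w S = Abs_poly_mapping (g S)" for S
  have source: "\<exists>x\<in>S. \<exists>n\<in>Poly_Mapping.keys (v (S - {x})).
      m + ind (\<Union>(U ` S)) = ind (\<Union>(U ` (S - {x}))) + n" if S: "S \<subseteq> X" and "g S m \<noteq> 0" for S m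
  proof -
    define u where "u = m + ind (\<Union>(U ` S))"
    have x: "x0 u \<in> S" and n: "u - ind (\<Union>(U ` (S - {x0 u}))) \<in> Poly_Mapping.keys (v (S - {x0 u}))"
      using that by (auto simp: g_def u_def Let_def in_keys_iff split: if_splits)
    have "\<Union>(U ` (S - {x0 u})) \<subseteq> Poly_Mapping.keys u"
      using finU[OF S] by (auto simp: u_def keys_add_nat)
    moreover have "finite (\<Union>(U ` (S - {x0 u})))" using finU[OF S] by (rule rev_finite_subset) auto
    ultimately have "u = ind (\<Union>(U ` (S - {x0 u}))) + (u - ind (\<Union>(U ` (S - {x0 u}))))"
      by (simp add: ind_add_diff)
    with x n show ?thesis unfolding u_def by blast
  qed
  have lw: "Poly_Mapping.lookup (w S) = g S" if S: "S \<subseteq> X" for S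
    unfolding w_def
  proof (rule lookup_Abs_mpoly)
    \<comment> \<open>Each nonzero coefficient comes from a term of \<open>v\<close> on some facet
      of \<open>S\<close>, which confines the support to a finite set.\<close>
    let ?K = "(\<Union>x\<in>S. (\<lambda>n. ind (\<Union>(U ` (S - {x}))) + n - ind (\<Union>(U ` S))) ` Poly_Mapping.keys (v (S - {x})))"
    show "finite ?K" using S X by (auto simp: finite_subset)
    fix m assume "g S m \<noteq> 0"
    from source[OF S this] obtain x n where "x \<in> S" "n \<in> Poly_Mapping.keys (v (S - {x}))"
      "m + ind (\<Union>(U ` S)) = ind (\<Union>(U ` (S - {x}))) + n" by blast
    then show "m \<in> ?K" by (metis (no_types, lifting) UN_I add_diff_cancel_right' image_eqI)
  qed
  have "w S \<in> PR V" if S: "S \<in> cells X (Suc i)" for S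
    unfolding mem_PR
  proof
    fix m assume "m \<in> Poly_Mapping.keys (w S)"
    moreover have SX: "S \<subseteq> X" using S by (simp add: cells_def)
    ultimately obtain x n where x: "x \<in> S" and n: "n \<in> Poly_Mapping.keys (v (S - {x}))"
      and eq: "m + ind (\<Union>(U ` S)) = ind (\<Union>(U ` (S - {x}))) + n"
      using source[of S m] lw by (auto simp: in_keys_iff)
    have "v (S - {x}) \<in> PR V" using v cells_remove[OF X(1) S x] .
    then have "Poly_Mapping.keys n \<subseteq> V" using n by (auto simp: mem_PR)
    moreover have "Poly_Mapping.keys m \<subseteq> Poly_Mapping.keys (ind (\<Union>(U ` (S - {x}))) + n)"
      using eq by (metis keys_add_nat sup_ge1)
    moreover have "finite (\<Union>(U ` (S - {x})))" "\<Union>(U ` (S - {x})) \<subseteq> V"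
      using SX U by (auto intro: rev_finite_subset[OF finU[OF SX]])
    ultimately show "Poly_Mapping.keys m \<subseteq> V" by (auto simp: keys_add_nat)
  qed
  moreover have "v T = (\<Sum>S\<in>cells X (Suc i). tay \<rho> U T S * w S)" if T: "T \<in> cells X i" for T
  proof (rule poly_mapping_eqI)
    fix n
    let ?A = "\<Union>(U ` T)"
    define u where "u = n + ind ?A"
    define f where "f S = Poly_Mapping.lookup (v S) (u - ind (\<Union>(U ` S)))" for S
    have TX: "T \<subseteq> X" using T by (simp add: cells_def)
    have finX: "\<And>x. x \<in> X \<Longrightarrow> finite (U x)" using U by blast
    have Au: "?A \<subseteq> Poly_Mapping.keys u" using finU[OF TX] by (simp add: u_def keys_add_nat)
    have n: "n = u - ind ?A" by (simp add: u_def)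
    have TXu: "T \<subseteq> Xu u" using TX Au by (auto simp: Xu_def)
    have Xu: "finite (Xu u)" "inj_on \<rho> (Xu u)" using X by (auto simp: Xu_def inj_on_def)
    have gw: "Poly_Mapping.lookup (w (insert s T)) (u - ind (\<Union>(U ` insert s T))) =
        (if x0 u \<in> insert s T then f (insert s T - {x0 u}) else 0)" if "s \<in> Xu u - T" for s
    proof -
      have sX: "insert s T \<subseteq> X" using that TX by (auto simp: Xu_def)
      have "\<Union>(U ` insert s T) \<subseteq> Poly_Mapping.keys u" using that Au by (auto simp: Xu_def)
      then have "u - ind (\<Union>(U ` insert s T)) + ind (\<Union>(U ` insert s T)) = u"
        using ind_add_diff[OF finU[OF sX]] by (simp add: add.commute)
      then show ?thesis unfolding lw[OF sX] g_def f_def Let_def by simp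
    qed
    have "Poly_Mapping.lookup (\<Sum>S\<in>cells X (Suc i). tay \<rho> U T S * w S) n =
        (\<Sum>s\<in>Xu u - T. sg \<rho> s T *
            Poly_Mapping.lookup (w (insert s T)) (u - ind (\<Union>(U ` insert s T))))"
      unfolding sum_tay[OF X(1) T] n Xu_def by (rule lookup_tay[OF X(1) finX TX Au])
    also have "\<dots> = (\<Sum>s\<in>Xu u - T. sg \<rho> s T *
        (if x0 u \<in> insert s T then f (insert s T - {x0 u}) else 0))"
      using gw by (intro sum.cong) simp_all
    also have "\<dots> = f T"
    proof (cases "Xu u = {}")
      case True
      \<comment> \<open>Without an index dividing \<open>u\<close> there is no apex; then only the
        empty cell in position 0 is left, and \<open>aug\<close> says that its coefficient
        vanishes.\<close>
      then have "T = {}" using TXu by blast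
      then have "i = 0" "u = n" using T by (auto simp: cells_def u_def)
      then have "n \<notin> Poly_Mapping.keys (v {})" using aug True by (auto simp: Xu_def)
      then show ?thesis using True \<open>T = {}\<close> \<open>u = n\<close> by (simp add: f_def in_keys_iff)
    next
      case False
      show ?thesis
      proof (rule cone[OF Xu])
        assume xT: "x0 u \<in> T"
        define T' where "T' = T - {x0 u}"
        have "card T > 0" using xT X(1) TX by (auto simp: card_gt_0_iff finite_subset)
        then obtain j where j: "i = Suc j" using T by (cases i) (auto simp: cells_def)
        have T': "T' \<in> cells X j" using T xT X unfolding j T'_def by (simp add: cells_remove)
        have T'X: "T' \<subseteq> X" and Au': "\<Union>(U ` T') \<subseteq> Poly_Mapping.keys u"
          using TX Au by (auto simp: T'_def)
        have "0 = Poly_Mapping.lookup (\<Sum>S\<in>cells X (Suc j). tay \<rho> U T' S * v S) (u - ind (\<Union>(U ` T')))"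
          using cyc[OF j T'] by (simp flip: j)
        also have "\<dots> = (\<Sum>s\<in>Xu u - T'. sg \<rho> s T' * f (insert s T'))"
          unfolding sum_tay[OF X(1) T'] f_def Xu_def by (rule lookup_tay[OF X(1) finX T'X Au'])
        finally show "(\<Sum>s\<in>Xu u - (T - {x0 u}). sg \<rho> s (T - {x0 u}) * f (insert s (T - {x0 u}))) = 0"
          by (simp flip: T'_def)
      qed (use x0[OF False] TXu in auto)
    qed
    also have "f T = Poly_Mapping.lookup (v T) n" by (simp add: f_def n)
    finally show "Poly_Mapping.lookup (v T) n =
        Poly_Mapping.lookup (\<Sum>S\<in>cells X (Suc i). tay \<rho> U T S * w S) n" by simp
  qed
  ultimately show ?thesis by blast
qed

text \<open>If \<open>T\<close> lies in \<open>Q\<close>, exactly two cells lie between them, one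
  for each order of adding the two vertices of \<open>Q - T\<close>. Both paths carry lcm(Q) /
  lcm(T), and the signs are opposite because only the larger vertex counts the other one before
  it.\<close>

lemma tay_comp:
  fixes U :: "'i \<Rightarrow> 'a set"
  assumes X: "finite X" "inj_on \<rho> X" and U: "\<And>x. x \<in> X \<Longrightarrow> finite (U x)"
    and T: "T \<in> cells X i" and Q: "Q \<in> cells X (Suc (Suc i))"
  shows "(\<Sum>S\<in>cells X (Suc i). tay \<rho> U T S * tay \<rho> U S Q) = (0 :: ('a, 'k::field) mpoly)"
proof (cases "T \<subseteq> Q")
  case False
  then have "tay \<rho> U T S * tay \<rho> U S Q = (0 :: ('a, 'k) mpoly)" for S
    by (cases "T \<subseteq> S") (auto simp: tay_def)
  then show ?thesis by simp
next
  case True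
  have fin: "finite T" "finite Q" and sub: "T \<subseteq> X" "Q \<subseteq> X"
    and card: "card T = i" "card Q = Suc (Suc i)"
    using T Q X by (auto simp: cells_def finite_subset)
  have "card (Q - T) = 2" using card fin True by (simp add: card_Diff_subset)
  then obtain a b where ab: "Q - T = {a, b}" "a \<noteq> b" by (auto simp: card_2_iff)
  have abX: "a \<in> X" "b \<in> X" "a \<notin> T" "b \<notin> T" using ab sub by auto
  have key: "sg \<rho> a T * edge_monomial (U a - \<Union>(U ` T)) * tay \<rho> U (insert a T) Q
      + sg \<rho> b T * edge_monomial (U b - \<Union>(U ` T)) * tay \<rho> U (insert b T) Q = (0 :: ('a, 'k) mpoly)"
    if ab: "Q - T = {a, b}" "a \<noteq> b" "a \<in> X" "b \<in> X" "a \<notin> T" "b \<notin> T" "\<rho> a < \<rho> b" for a b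
  proof -
    have Q: "Q = insert b (insert a T)" "Q = insert a (insert b T)" using ab True by auto
    have e1: "edge_monomial (U a - \<Union>(U ` T)) * edge_monomial (U b - \<Union>(U ` insert a T)) =
        (edge_monomial (U a \<union> U b - \<Union>(U ` T)) :: ('a, 'k) mpoly)"
      using U[of a] U[of b] ab by (subst edge_monomial_mult) (auto intro: arg_cong[of _ _ edge_monomial])
    have e2: "edge_monomial (U b - \<Union>(U ` T)) * edge_monomial (U a - \<Union>(U ` insert b T)) =
        (edge_monomial (U a \<union> U b - \<Union>(U ` T)) :: ('a, 'k) mpoly)"
      using U[of a] U[of b] ab by (subst edge_monomial_mult) (auto intro: arg_cong[of _ _ edge_monomial])
    have "tay \<rho> U (insert a T) Q = (- sg \<rho> b T :: ('a, 'k) mpoly) * edge_monomial (U b - \<Union>(U ` insert a T))"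
      unfolding Q(1) using ab fin by (subst tay_insert) (auto simp: sg_insert_smaller)
    moreover have "tay \<rho> U (insert b T) Q = (sg \<rho> a T :: ('a, 'k) mpoly) * edge_monomial (U a - \<Union>(U ` insert b T))"
      unfolding Q(2) using ab fin by (subst tay_insert) (auto simp: sg_insert_larger)
    ultimately have "sg \<rho> a T * edge_monomial (U a - \<Union>(U ` T)) * tay \<rho> U (insert a T) Q
      + sg \<rho> b T * edge_monomial (U b - \<Union>(U ` T)) * tay \<rho> U (insert b T) Q =
      - (sg \<rho> a T * sg \<rho> b T :: ('a, 'k) mpoly) * (edge_monomial (U a - \<Union>(U ` T)) * edge_monomial (U b - \<Union>(U ` insert a T)))
      + (sg \<rho> a T * sg \<rho> b T) * (edge_monomial (U b - \<Union>(U ` T)) * edge_monomial (U a - \<Union>(U ` insert b T)))"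
      by (simp add: ac_simps)
    also have "\<dots> = 0" unfolding e1 e2 by simp
    finally show ?thesis .
  qed
  have "(\<Sum>S\<in>cells X (Suc i). tay \<rho> U T S * tay \<rho> U S Q) =
      (\<Sum>s\<in>X - T. (sg \<rho> s T :: ('a, 'k) mpoly) * edge_monomial (U s - \<Union>(U ` T)) * tay \<rho> U (insert s T) Q)"
    by (rule sum_tay[OF X(1) T])
  also have "\<dots> = (\<Sum>s\<in>{a, b}. sg \<rho> s T * edge_monomial (U s - \<Union>(U ` T)) * tay \<rho> U (insert s T) Q)"
  proof (rule sum.mono_neutral_right)
    show "\<forall>s\<in>X - T - {a, b}. sg \<rho> s T * edge_monomial (U s - \<Union>(U ` T)) * tay \<rho> U (insert s T) Q =
        (0 :: ('a, 'k) mpoly)"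
    proof
      fix s assume "s \<in> X - T - {a, b}"
      with ab(1) have "s \<notin> Q" by blast
      then have "tay \<rho> U (insert s T) Q = (0 :: ('a, 'k) mpoly)" by (intro tay_eq_0) blast
      then show "sg \<rho> s T * edge_monomial (U s - \<Union>(U ` T)) * tay \<rho> U (insert s T) Q =
        (0 :: ('a, 'k) mpoly)" by simp
    qed
  qed (use X abX in auto)
  also have "\<dots> = 0"
  proof (cases "\<rho> a < \<rho> b")
    case True
    then show ?thesis using key[of a b] ab abX by simp
  next
    case False
    then have "\<rho> b < \<rho> a" using X(2) ab abX by (metis inj_on_def linorder_neqE_nat)
    moreover have "Q - T = {b, a}" using ab(1) by blast
    ultimately show ?thesis using key[of b a] ab(2) abX by (simp add: add.commute)
  qed
  finally show ?thesis .
qed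

section \<open>Graded resolutions and their minimization\<close>

lemma sum_remove_zero: "finite B \<Longrightarrow> a \<in> B \<Longrightarrow> f a = 0 \<Longrightarrow> sum f (B - {a}) = sum f B"
  for f :: "'b \<Rightarrow> 'c::comm_monoid_add"
  by (simp add: sum.remove)

text \<open>Kernel of \<open>D\<close> equals image of \<open>E\<close> on the module over
  \<open>B1\<close>. Vectors are functions of which only the values on the index set count, so a
  basis element is cancelled by shrinking a set while all others keep their names.\<close>

definition exact_pair :: "'a set \<Rightarrow> 'b set \<Rightarrow> 'b set \<Rightarrow> 'b set \<Rightarrow>
    ('b \<Rightarrow> 'b \<Rightarrow> ('a, 'k::field) mpoly) \<Rightarrow> ('b \<Rightarrow> 'b \<Rightarrow> ('a, 'k) mpoly) \<Rightarrow> bool" where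
  "exact_pair V B0 B1 B2 D E \<longleftrightarrow>
     (\<forall>v. (\<forall>b\<in>B1. v b \<in> PR V) \<longrightarrow>
        ((\<forall>a\<in>B0. (\<Sum>b\<in>B1. D a b * v b) = 0) \<longleftrightarrow>
         (\<exists>w. (\<forall>c\<in>B2. w c \<in> PR V) \<and> (\<forall>b\<in>B1. v b = (\<Sum>c\<in>B2. E b c * w c)))))"

lemma exact_pairI:
  assumes fin: "finite B1" "finite B2"
    and comp: "\<And>a c. a \<in> B0 \<Longrightarrow> c \<in> B2 \<Longrightarrow> (\<Sum>b\<in>B1. D a b * E b c) = 0"
    and exact: "\<And>v. (\<And>b. b \<in> B1 \<Longrightarrow> v b \<in> PR V) \<Longrightarrow>
      (\<And>a. a \<in> B0 \<Longrightarrow> (\<Sum>b\<in>B1. D a b * v b) = 0) \<Longrightarrow>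
      \<exists>w. (\<forall>c\<in>B2. w c \<in> PR V) \<and> (\<forall>b\<in>B1. v b = (\<Sum>c\<in>B2. E b c * w c))"
  shows "exact_pair V B0 B1 B2 D E"
proof -
  have "(\<Sum>b\<in>B1. D a b * v b) = 0"
    if a: "a \<in> B0" and v: "\<forall>b\<in>B1. v b = (\<Sum>c\<in>B2. E b c * w c)" for v w a
  proof -
    have "(\<Sum>b\<in>B1. D a b * v b) = (\<Sum>b\<in>B1. \<Sum>c\<in>B2. D a b * E b c * w c)"
      using v by (simp add: sum_distrib_left mult.assoc)
    also have "\<dots> = (\<Sum>c\<in>B2. (\<Sum>b\<in>B1. D a b * E b c) * w c)"
      by (subst sum.swap) (simp add: sum_distrib_right)
    also have "\<dots> = 0" using comp a by simp
    finally show ?thesis .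
  qed
  then show ?thesis unfolding exact_pair_def using exact by blast
qed

text \<open>Column \<open>c\<close> of \<open>E\<close> is the image of a unit vector, hence a
  cycle.\<close>

lemma exact_pair_comp:
  fixes E :: "'b \<Rightarrow> 'b \<Rightarrow> ('a, 'k::field) mpoly"
  assumes "exact_pair V B0 B1 B2 D E" "finite B2" "\<And>b c. b \<in> B1 \<Longrightarrow> c \<in> B2 \<Longrightarrow> E b c \<in> PR V"
    and "a \<in> B0" "c \<in> B2"
  shows "(\<Sum>b\<in>B1. D a b * E b c) = 0"
proof -
  define w :: "'b \<Rightarrow> ('a, 'k) mpoly" where "w q = (if q = c then 1 else 0)" for q
  have "E b c = (\<Sum>q\<in>B2. E b q * w q)" for b
  proof -
    have "(\<Sum>q\<in>B2. E b q * w q) = (\<Sum>q\<in>B2. if q = c then E b q else 0)"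
      by (rule sum.cong) (auto simp: w_def)
    then show ?thesis using assms by simp
  qed
  moreover have "\<forall>q\<in>B2. w q \<in> PR V" by (simp add: w_def)
  ultimately have "\<exists>w. (\<forall>q\<in>B2. w q \<in> PR V) \<and> (\<forall>b\<in>B1. E b c = (\<Sum>q\<in>B2. E b q * w q))"
    by blast
  moreover have "\<forall>b\<in>B1. E b c \<in> PR V" using assms by blast
  ultimately have "\<forall>a\<in>B0. (\<Sum>b\<in>B1. D a b * E b c) = 0"
    using assms(1)[unfolded exact_pair_def, THEN spec[of _ "\<lambda>b. E b c"]] by blast
  then show ?thesis using assms by blast
qed

lemma exact_pair_exact:
  assumes "exact_pair V B0 B1 B2 D E" "\<forall>b\<in>B1. v b \<in> PR V" "\<forall>a\<in>B0. (\<Sum>b\<in>B1. D a b * v b) = 0"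
  shows "\<exists>w. (\<forall>c\<in>B2. w c \<in> PR V) \<and> (\<forall>b\<in>B1. v b = (\<Sum>c\<in>B2. E b c * w c))"
  using assms(1)[unfolded exact_pair_def, THEN spec[of _ v]] assms(2,3) by blast

definition graded_exact :: "'a set \<Rightarrow> (nat \<Rightarrow> 'b set) \<Rightarrow> (nat \<Rightarrow> 'b \<Rightarrow> nat) \<Rightarrow>
    (nat \<Rightarrow> 'b \<Rightarrow> 'b \<Rightarrow> ('a, 'k::field) mpoly) \<Rightarrow> bool" where
  "graded_exact V B d D \<longleftrightarrow>
     (\<forall>i. finite (B i)) \<and>
     (\<forall>i. \<forall>a\<in>B i. \<forall>b\<in>B (Suc i).
        D i a b \<in> PR V \<and> homogeneous (int (d (Suc i) b) - int (d i a)) (D i a b)) \<and>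
     (\<forall>i. exact_pair V (B i) (B (Suc i)) (B (Suc (Suc i))) (D i) (D (Suc i)))"

definition row_image :: "'a set \<Rightarrow> 'b set \<Rightarrow> ('b \<Rightarrow> ('a, 'k::field) mpoly) \<Rightarrow> ('a, 'k) mpoly set" where
  "row_image V B f = {\<Sum>b\<in>B. f b * v b | v. \<forall>b\<in>B. v b \<in> PR V}"

text \<open>The augmented resolution: position 0 is the ring, generated by \<open>r\<close> in
  degree 0, and the image of \<open>D 0\<close> in it is the ideal. A generator in position
  \<open>i + 1\<close> has homological degree \<open>i\<close> over the ideal.\<close>

definition resolves :: "'a set \<Rightarrow> ('a, 'k::field) mpoly set \<Rightarrow> (nat \<Rightarrow> 'b set) \<Rightarrow>
    (nat \<Rightarrow> 'b \<Rightarrow> nat) \<Rightarrow> (nat \<Rightarrow> 'b \<Rightarrow> 'b \<Rightarrow> ('a, 'k) mpoly) \<Rightarrow> 'b \<Rightarrow> bool" where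
  "resolves V I B d D r \<longleftrightarrow>
     graded_exact V B d D \<and> B 0 = {r} \<and> d 0 r = 0 \<and> row_image V (B 1) (D 0 r) = I \<and>
     (\<exists>p. \<forall>i>p. B i = {})"

text \<open>The augmentation \<open>D 0\<close> is exempt because its entries are the generators of
  the ideal; cancellation therefore never touches the ring in position 0.\<close>

definition min_entries :: "(nat \<Rightarrow> 'b set) \<Rightarrow> (nat \<Rightarrow> 'b \<Rightarrow> 'b \<Rightarrow> ('a, 'k::field) mpoly) \<Rightarrow> bool" where
  "min_entries B D \<longleftrightarrow> (\<forall>i. \<forall>a\<in>B (Suc i). \<forall>b\<in>B (Suc (Suc i)).
     Poly_Mapping.lookup (D (Suc i) a b) 0 = 0)"

text \<open>Gaussian elimination: the entry \<open>M a b\<close> is a unit with inverse \<open>c\<close>, and the rank one trivial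
  summand that it spans is split off.\<close>

definition elim_entry ::
    "('b \<Rightarrow> 'b \<Rightarrow> ('a, 'k::field) mpoly) \<Rightarrow> 'b \<Rightarrow> 'b \<Rightarrow> ('a, 'k) mpoly \<Rightarrow> 'b \<Rightarrow> 'b \<Rightarrow> ('a, 'k) mpoly" where
  "elim_entry M a b c x y = M x y - M x b * c * M a y"

context
  fixes V :: "'a set" and M :: "'b \<Rightarrow> 'b \<Rightarrow> ('a, 'k::field) mpoly" and a b c Bx By
  assumes fin: "finite Bx" "finite By" and ab: "a \<in> Bx" "b \<in> By"
    and inv: "M a b * c = 1" and c: "c \<in> PR V"
    and MP: "\<And>x y. x \<in> Bx \<Longrightarrow> y \<in> By \<Longrightarrow> M x y \<in> PR V"
begin

lemma elim_entry_b: "elim_entry M a b c x b = 0"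
proof -
  have "M x b * c * M a b = M x b * (M a b * c)" by (simp only: ac_simps)
  then show ?thesis by (simp add: elim_entry_def inv)
qed

lemma elim_entry_a: "elim_entry M a b c a y = 0"
  by (simp add: elim_entry_def inv)

lemma sum_elim_row:
  "(\<Sum>y\<in>By - {b}. elim_entry M a b c x y * w y) =
     (\<Sum>y\<in>By. M x y * w y) - M x b * c * (\<Sum>y\<in>By. M a y * w y)"
proof -
  have "(\<Sum>y\<in>By - {b}. elim_entry M a b c x y * w y) = (\<Sum>y\<in>By. elim_entry M a b c x y * w y)"
    using fin ab by (simp add: sum.remove[of By b] elim_entry_b)
  also have "\<dots> = (\<Sum>y\<in>By. M x y * w y - M x b * c * (M a y * w y))"
    by (simp add: elim_entry_def algebra_simps)
  finally show ?thesis by (simp add: sum_subtractf sum_distrib_left)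
qed

lemma sum_elim_col:
  "(\<Sum>x\<in>Bx - {a}. L x * elim_entry M a b c x y) =
     (\<Sum>x\<in>Bx. L x * M x y) - (\<Sum>x\<in>Bx. L x * M x b) * c * M a y"
proof -
  have "(\<Sum>x\<in>Bx - {a}. L x * elim_entry M a b c x y) = (\<Sum>x\<in>Bx. L x * elim_entry M a b c x y)"
    using fin ab by (simp add: sum.remove[of Bx a] elim_entry_a)
  also have "\<dots> = (\<Sum>x\<in>Bx. L x * M x y - L x * M x b * (c * M a y))"
    by (simp add: elim_entry_def algebra_simps)
  finally show ?thesis by (simp add: sum_subtractf sum_distrib_right mult.assoc)
qed

text \<open>Exactness where \<open>a\<close> is lost. A cycle is extended by 0 at \<open>a\<close>
  and lifted through \<open>M\<close>. Row \<open>a\<close> of the lift is then 0, so the correction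
  in \<open>elim_entry\<close> drops out and the lift without its coordinate \<open>b\<close> still
  works.\<close>

lemma exact_pair_elim_target:
  assumes ex: "exact_pair V Z Bx By L M"
  shows "exact_pair V Z (Bx - {a}) (By - {b}) L (elim_entry M a b c)"
proof (rule exact_pairI)
  fix z y assume z: "z \<in> Z" and y: "y \<in> By - {b}"
  then show "(\<Sum>x\<in>Bx - {a}. L z x * elim_entry M a b c x y) = 0"
    using exact_pair_comp[OF ex fin(2) MP z, of y] exact_pair_comp[OF ex fin(2) MP z ab(2)]
    by (simp add: sum_elim_col)
next
  fix v assume v: "\<And>x. x \<in> Bx - {a} \<Longrightarrow> v x \<in> PR V"
    and 0: "\<And>z. z \<in> Z \<Longrightarrow> (\<Sum>x\<in>Bx - {a}. L z x * v x) = 0"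
  have "(v(a := 0)) x \<in> PR V" if "x \<in> Bx" for x using v that by simp
  moreover have "(\<Sum>x\<in>Bx. L z x * (v(a := 0)) x) = 0" if "z \<in> Z" for z
  proof -
    have "(\<Sum>x\<in>Bx. L z x * (v(a := 0)) x) = (\<Sum>x\<in>Bx - {a}. L z x * (v(a := 0)) x)"
      by (rule sum_remove_zero[symmetric]) (use fin ab in auto)
    also have "\<dots> = (\<Sum>x\<in>Bx - {a}. L z x * v x)" by (rule sum.cong) auto
    finally show ?thesis using 0 that by simp
  qed
  ultimately have "\<exists>w. (\<forall>y\<in>By. w y \<in> PR V) \<and> (\<forall>x\<in>Bx. (v(a := 0)) x = (\<Sum>y\<in>By. M x y * w y))"
    by (intro exact_pair_exact[OF ex]) blast+
  then obtain w where w: "\<And>y. y \<in> By \<Longrightarrow> w y \<in> PR V"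
    "\<And>x. x \<in> Bx \<Longrightarrow> (v(a := 0)) x = (\<Sum>y\<in>By. M x y * w y)" by blast
  have "v x = (\<Sum>y\<in>By - {b}. elim_entry M a b c x y * w y)" if "x \<in> Bx - {a}" for x
    using w(2)[of x] w(2)[of a] that ab by (simp add: sum_elim_row)
  then show "\<exists>w. (\<forall>y\<in>By - {b}. w y \<in> PR V) \<and>
      (\<forall>x\<in>Bx - {a}. v x = (\<Sum>y\<in>By - {b}. elim_entry M a b c x y * w y))"
    using w(1) by blast
qed (use fin in auto)

text \<open>Exactness where \<open>b\<close> is lost. The missing coordinate is forced: as
  \<open>M a b\<close> is a unit, \<open>- (c * t)\<close> is the one value that satisfies row
  \<open>a\<close>, and the other rows then follow.\<close>

lemma exact_pair_elim_source:
  assumes ex: "exact_pair V Bx By C M N" and C: "finite C"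
    and NP: "\<And>y q. y \<in> By \<Longrightarrow> q \<in> C \<Longrightarrow> N y q \<in> PR V"
  shows "exact_pair V (Bx - {a}) (By - {b}) C (elim_entry M a b c) N"
proof (rule exact_pairI)
  fix x q assume x: "x \<in> Bx - {a}" and q: "q \<in> C"
  then show "(\<Sum>y\<in>By - {b}. elim_entry M a b c x y * N y q) = 0"
    using exact_pair_comp[OF ex C NP _ q, of x] exact_pair_comp[OF ex C NP ab(1) q]
    by (simp add: sum_elim_row)
next
  fix w assume w: "\<And>y. y \<in> By - {b} \<Longrightarrow> w y \<in> PR V"
    and 0: "\<And>x. x \<in> Bx - {a} \<Longrightarrow> (\<Sum>y\<in>By - {b}. elim_entry M a b c x y * w y) = 0"
  define t where "t = (\<Sum>y\<in>By - {b}. M a y * w y)"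
  define w' where "w' = w(b := - (c * t))"
  have t: "t \<in> PR V" unfolding t_def using MP w ab by (intro PR_sum PR_mult) auto
  have w'P: "w' y \<in> PR V" if "y \<in> By" for y
    using w that c t by (auto simp: w'_def intro: PR_mult PR_uminus)
  have same: "(\<Sum>y\<in>By - {b}. f y * w' y) = (\<Sum>y\<in>By - {b}. f y * w y)" for f
    by (rule sum.cong) (auto simp: w'_def)
  have "(\<Sum>y\<in>By. M a y * w' y) = M a b * w' b + t"
    using fin ab by (simp add: sum.remove[of By b] same t_def)
  also have "M a b * w' b = - ((M a b * c) * t)" by (simp add: w'_def mult.assoc)
  finally have row: "(\<Sum>y\<in>By. M a y * w' y) = 0" by (simp add: inv)
  have "(\<Sum>y\<in>By. M x y * w' y) = 0" if "x \<in> Bx" for x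
    using sum_elim_row[of x w'] 0[of x] row that by (cases "x = a") (auto simp: same)
  then have "\<exists>u. (\<forall>q\<in>C. u q \<in> PR V) \<and> (\<forall>y\<in>By. w' y = (\<Sum>q\<in>C. N y q * u q))"
    using w'P by (intro exact_pair_exact[OF ex]) blast+
  then obtain u where u: "\<And>q. q \<in> C \<Longrightarrow> u q \<in> PR V" "\<And>y. y \<in> By \<Longrightarrow> w' y = (\<Sum>q\<in>C. N y q * u q)"
    by blast
  have "w y = (\<Sum>q\<in>C. N y q * u q)" if "y \<in> By - {b}" for y
    using u(2)[of y] that by (simp add: w'_def)
  then show "\<exists>u. (\<forall>q\<in>C. u q \<in> PR V) \<and> (\<forall>y\<in>By - {b}. w y = (\<Sum>q\<in>C. N y q * u q))"
    using u(1) by blast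
qed (use fin C in auto)

text \<open>\<open>N\<close> loses its row \<open>b\<close>, but no cycles are gained: row
  \<open>a\<close> of the relation that \<open>M\<close> times \<open>N\<close> is 0 expresses row
  \<open>b\<close> of \<open>N\<close>, up to the unit \<open>M a b\<close>, through the remaining
  rows.\<close>

lemma exact_pair_elim_after:
  assumes ex: "exact_pair V Bx By C M N" and C: "finite C"
    and NP: "\<And>y q. y \<in> By \<Longrightarrow> q \<in> C \<Longrightarrow> N y q \<in> PR V"
    and ex': "exact_pair V By C E N Q" and E: "finite E"
    and QP: "\<And>y q. y \<in> C \<Longrightarrow> q \<in> E \<Longrightarrow> Q y q \<in> PR V"
  shows "exact_pair V (By - {b}) C E N Q"
proof (rule exact_pairI)
  fix y q assume "y \<in> By - {b}" "q \<in> E"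
  then show "(\<Sum>x\<in>C. N y x * Q x q) = 0"
    using exact_pair_comp[OF ex' E QP] by simp
next
  fix v assume v: "\<And>q. q \<in> C \<Longrightarrow> v q \<in> PR V"
    and 0: "\<And>y. y \<in> By - {b} \<Longrightarrow> (\<Sum>q\<in>C. N y q * v q) = 0"
  have "0 = (\<Sum>q\<in>C. (\<Sum>y\<in>By. M a y * N y q) * v q)"
    using exact_pair_comp[OF ex C NP ab(1)] by simp
  also have "\<dots> = (\<Sum>y\<in>By. M a y * (\<Sum>q\<in>C. N y q * v q))"
    by (simp add: sum_distrib_left sum_distrib_right mult.assoc) (rule sum.swap)
  also have "\<dots> = M a b * (\<Sum>q\<in>C. N b q * v q)"
    using fin ab 0 by (simp add: sum.remove[of By b])
  finally have "c * (M a b * (\<Sum>q\<in>C. N b q * v q)) = 0" by simp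
  moreover have "c * (M a b * (\<Sum>q\<in>C. N b q * v q)) = (M a b * c) * (\<Sum>q\<in>C. N b q * v q)"
    by (simp only: ac_simps)
  ultimately have "(\<Sum>q\<in>C. N b q * v q) = 0" by (simp add: inv)
  then have z: "(\<Sum>q\<in>C. N y q * v q) = 0" if "y \<in> By" for y
    using 0 that by (cases "y = b") auto
  show "\<exists>w. (\<forall>q\<in>E. w q \<in> PR V) \<and> (\<forall>x\<in>C. v x = (\<Sum>q\<in>E. Q x q * w q))"
    using v z by (intro exact_pair_exact[OF ex']) blast+
qed (use C E in auto)

text \<open>Column \<open>b\<close> of \<open>M\<close> lies in the kernel of \<open>L\<close> and
  has a unit in coordinate \<open>a\<close>; subtracting a multiple of it clears that coordinate
  without changing the image under \<open>L\<close>.\<close>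

lemma elim_image:
  assumes ex: "exact_pair V Z Bx By L M" and w: "\<And>x. x \<in> Bx \<Longrightarrow> w x \<in> PR V"
  shows "\<exists>w'. (\<forall>x\<in>Bx - {a}. w' x \<in> PR V) \<and>
    (\<forall>z\<in>Z. (\<Sum>x\<in>Bx - {a}. L z x * w' x) = (\<Sum>x\<in>Bx. L z x * w x))"
proof -
  define w' where "w' x = w x - M x b * (c * w a)" for x
  have w'P: "w' x \<in> PR V" if "x \<in> Bx - {a}" for x
    unfolding w'_def using that w MP ab c by (intro PR_diff PR_mult) auto
  have "w' a = w a - (M a b * c) * w a" by (simp add: w'_def mult.assoc)
  then have a0: "w' a = 0" by (simp add: inv)
  moreover have "(\<Sum>x\<in>Bx - {a}. L z x * w' x) = (\<Sum>x\<in>Bx. L z x * w x)" if "z \<in> Z" for z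
  proof -
    have "(\<Sum>x\<in>Bx - {a}. L z x * w' x) = (\<Sum>x\<in>Bx. L z x * w' x)"
      using fin ab a0 by (simp add: sum.remove[of Bx a])
    also have "\<dots> = (\<Sum>x\<in>Bx. L z x * w x) - (\<Sum>x\<in>Bx. L z x * M x b) * (c * w a)"
      by (simp add: w'_def right_diff_distrib sum_subtractf sum_distrib_right mult.assoc)
    finally show ?thesis using exact_pair_comp[OF ex fin(2) MP that ab(2)] by simp
  qed
  ultimately show ?thesis using w'P by (intro exI[of _ w']) blast
qed

lemma exact_pair_elim_before:
  assumes ex: "exact_pair V Z Bx By L M" and Z: "finite Z"
    and LP: "\<And>z x. z \<in> Z \<Longrightarrow> x \<in> Bx \<Longrightarrow> L z x \<in> PR V"
    and ex': "exact_pair V Y Z Bx K L"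
  shows "exact_pair V Y Z (Bx - {a}) K L"
proof (rule exact_pairI)
  fix y x assume "y \<in> Y" "x \<in> Bx - {a}"
  then show "(\<Sum>z\<in>Z. K y z * L z x) = 0" using exact_pair_comp[OF ex' fin(1) LP] by simp
next
  fix v assume v: "\<And>z. z \<in> Z \<Longrightarrow> v z \<in> PR V" and 0: "\<And>y. y \<in> Y \<Longrightarrow> (\<Sum>z\<in>Z. K y z * v z) = 0"
  have "\<exists>w. (\<forall>x\<in>Bx. w x \<in> PR V) \<and> (\<forall>z\<in>Z. v z = (\<Sum>x\<in>Bx. L z x * w x))"
    using v 0 by (intro exact_pair_exact[OF ex']) blast+
  then obtain w where w: "\<And>x. x \<in> Bx \<Longrightarrow> w x \<in> PR V"
    "\<And>z. z \<in> Z \<Longrightarrow> v z = (\<Sum>x\<in>Bx. L z x * w x)" by blast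
  from elim_image[OF ex, of w] w(1)
  obtain w' where "\<forall>x\<in>Bx - {a}. w' x \<in> PR V"
    "\<forall>z\<in>Z. (\<Sum>x\<in>Bx - {a}. L z x * w' x) = (\<Sum>x\<in>Bx. L z x * w x)" by blast
  then have "(\<forall>x\<in>Bx - {a}. w' x \<in> PR V) \<and> (\<forall>z\<in>Z. v z = (\<Sum>x\<in>Bx - {a}. L z x * w' x))"
    by (simp add: w(2))
  then show "\<exists>w. (\<forall>x\<in>Bx - {a}. w x \<in> PR V) \<and> (\<forall>z\<in>Z. v z = (\<Sum>x\<in>Bx - {a}. L z x * w x))"
    by (rule exI[of _ w'])
qed (use fin Z in auto)

end

text \<open>A constant term has degree 0, which must then be the degree of all terms. So an entry
  violating minimality is a nonzero scalar between two generators of equal degree, and can be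
  eliminated.\<close>

lemma homogeneous_const:
  assumes "homogeneous e p" "Poly_Mapping.lookup p 0 \<noteq> 0"
  shows "e = 0" "p = Poly_Mapping.single 0 (Poly_Mapping.lookup p 0)"
proof -
  have "0 \<in> Poly_Mapping.keys p" using assms(2) by (simp add: in_keys_iff)
  then show e: "e = 0" using assms(1) by (fastforce simp: homogeneous_def monomial_degree_def)
  show "p = Poly_Mapping.single 0 (Poly_Mapping.lookup p 0)"
  proof (rule poly_mapping_eqI)
    fix m
    have "m \<notin> Poly_Mapping.keys p" if "m \<noteq> 0"
      using assms(1) e monomial_degree_0_iff[of m] that by (auto simp: homogeneous_def)
    then show "Poly_Mapping.lookup p m =
        Poly_Mapping.lookup (Poly_Mapping.single 0 (Poly_Mapping.lookup p 0)) m"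
      by (auto simp: lookup_single when_def in_keys_iff)
  qed
qed

text \<open>The cancelled pair has equal degrees and the inverse \<open>c\<close> is a scalar, so
  the correction in \<open>elim_entry\<close> is homogeneous of the old degree and \<open>d\<close>
  can be kept.\<close>

lemma resolves_cancel:
  fixes D :: "nat \<Rightarrow> 'b \<Rightarrow> 'b \<Rightarrow> ('a, 'k::field) mpoly"
  assumes res: "resolves V I B d D r"
    and a: "a \<in> B (Suc n)" and b: "b \<in> B (Suc (Suc n))"
    and nz: "Poly_Mapping.lookup (D (Suc n) a b) 0 \<noteq> 0"
  shows "\<exists>D'. resolves V I
    (B(Suc n := B (Suc n) - {a}, Suc (Suc n) := B (Suc (Suc n)) - {b})) d D' r"
proof -
  have ge: "graded_exact V B d D" and B0: "B 0 = {r}" "d 0 r = 0"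
    and im: "row_image V (B 1) (D 0 r) = I" and bd: "\<exists>p. \<forall>i>p. B i = {}"
    using res by (auto simp: resolves_def)
  have fin: "finite (B i)" and DP: "x \<in> B i \<Longrightarrow> y \<in> B (Suc i) \<Longrightarrow> D i x y \<in> PR V"
    and Dh: "x \<in> B i \<Longrightarrow> y \<in> B (Suc i) \<Longrightarrow> homogeneous (int (d (Suc i) y) - int (d i x)) (D i x y)"
    and ex: "exact_pair V (B i) (B (Suc i)) (B (Suc (Suc i))) (D i) (D (Suc i))" for i x y
    using ge by (auto simp: graded_exact_def)
  define u where "u = Poly_Mapping.lookup (D (Suc n) a b) 0"
  define c where "c = (Poly_Mapping.single 0 (inverse u) :: ('a, 'k) mpoly)"
  have Dab: "D (Suc n) a b = Poly_Mapping.single 0 u" and dab: "d (Suc (Suc n)) b = d (Suc n) a"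
    using homogeneous_const[OF Dh[OF a b] nz] by (simp_all add: u_def)
  have inv: "D (Suc n) a b * c = 1" using nz unfolding Dab c_def by (simp add: mult_single flip: u_def)
  have cP: "c \<in> PR V" and ch: "homogeneous 0 c"
    by (auto simp: c_def mem_PR homogeneous_def monomial_degree_def split: if_splits)
  note el = fin[of "Suc n"] fin[of "Suc (Suc n)"] a b inv cP
  define B' where "B' = B(Suc n := B (Suc n) - {a}, Suc (Suc n) := B (Suc (Suc n)) - {b})"
  define D' where "D' = D(Suc n := elim_entry (D (Suc n)) a b c)"
  have "finite (B' i)" for i using fin by (simp add: B'_def)
  moreover have sub: "B' i \<subseteq> B i" for i by (auto simp: B'_def)
  have "D' i x y \<in> PR V \<and> homogeneous (int (d (Suc i) y) - int (d i x)) (D' i x y)"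
    if "x \<in> B' i" "y \<in> B' (Suc i)" for i x y
  proof -
    have xy: "x \<in> B i" "y \<in> B (Suc i)" using that sub by blast+
    show ?thesis
    proof (cases "i = Suc n")
      case False
      then show ?thesis using DP[OF xy] Dh[OF xy] by (simp add: D'_def)
    next
      case True
      have xb: "D i x b \<in> PR V" "homogeneous (int (d (Suc i) b) - int (d i x)) (D i x b)"
        and ay: "D i a y \<in> PR V" "homogeneous (int (d (Suc i) y) - int (d i a)) (D i a y)"
        using xy a b True DP[of x i b] Dh[of x i b] DP[of a i y] Dh[of a i y] by auto
      have "homogeneous (int (d (Suc i) y) - int (d i x)) (D i x b * c * D i a y)"
        by (intro homogeneous_mult'[OF homogeneous_mult[OF xb(2) ch] ay(2)]) (simp add: True dab)
      then show ?thesis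
        using xb ay cP DP[OF xy] Dh[OF xy] True
        by (auto simp: D'_def elim_entry_def intro!: PR_diff PR_mult homogeneous_diff)
    qed
  qed
  moreover have "exact_pair V (B' i) (B' (Suc i)) (B' (Suc (Suc i))) (D' i) (D' (Suc i))" for i
  proof -
    \<comment> \<open>The middle position is \<open>Suc i\<close>. Exactness is affected at
      \<open>Suc n\<close> and \<open>Suc (Suc n)\<close>, which lose a generator, and at the
      neighbours just above and just below them.\<close>
    consider "i = n" | "i = Suc n" | "i = Suc (Suc n)" | "n = Suc i" |
      "i \<noteq> n" "i \<noteq> Suc n" "i \<noteq> Suc (Suc n)" "n \<noteq> Suc i" by blast
    then show ?thesis
    proof cases
      case 1
      then show ?thesis
        using exact_pair_elim_target[OF el DP ex[of n]] by (simp add: B'_def D'_def)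
    next
      case 2
      then show ?thesis
        using exact_pair_elim_source[OF el DP ex[of "Suc n"] fin DP] by (simp add: B'_def D'_def)
    next
      case 3
      then show ?thesis
        using exact_pair_elim_after[OF el DP ex[of "Suc n"] fin DP ex[of "Suc (Suc n)"] fin DP]
        by (simp add: B'_def D'_def)
    next
      case 4
      then show ?thesis
        using exact_pair_elim_before[OF el DP ex[of n] fin DP] ex[of i] by (simp add: B'_def D'_def)
    next
      case 5
      then show ?thesis using ex[of i] by (simp add: B'_def D'_def)
    qed
  qed
  moreover have "row_image V (B' 1) (D' 0 r) = I"
  proof (cases "n = 0")
    case False
    then show ?thesis using im by (simp add: B'_def D'_def)
  next
    case True
    \<comment> \<open>For \<open>n = 0\<close> the neighbour below is the ring; there the image of
      \<open>D 0\<close>, rather than exactness, has to survive the loss of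
      \<open>a\<close>.\<close>
    have B1: "B' 1 = B 1 - {a}" and a1: "a \<in> B 1" using True a by (simp_all add: B'_def)
    have "row_image V (B 1 - {a}) (D 0 r) = row_image V (B 1) (D 0 r)"
    proof (intro equalityI subsetI)
      fix p assume "p \<in> row_image V (B 1 - {a}) (D 0 r)"
      then obtain v where v: "p = (\<Sum>x\<in>B 1 - {a}. D 0 r x * v x)" "\<forall>x\<in>B 1 - {a}. v x \<in> PR V"
        by (auto simp: row_image_def)
      have "(\<Sum>x\<in>B 1 - {a}. D 0 r x * v x) = (\<Sum>x\<in>B 1 - {a}. D 0 r x * (v(a := 0)) x)"
        by (rule sum.cong) auto
      also have "\<dots> = (\<Sum>x\<in>B 1. D 0 r x * (v(a := 0)) x)"
        by (rule sum_remove_zero) (use fin a1 in auto)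
      finally show "p \<in> row_image V (B 1) (D 0 r)"
        using v unfolding row_image_def by (intro CollectI exI[of _ "v(a := 0)"]) auto
    next
      fix p assume "p \<in> row_image V (B 1) (D 0 r)"
      then obtain v where v: "p = (\<Sum>x\<in>B 1. D 0 r x * v x)" "\<forall>x\<in>B 1. v x \<in> PR V"
        by (auto simp: row_image_def)
      obtain w' where "\<And>x. x \<in> B (Suc n) - {a} \<Longrightarrow> w' x \<in> PR V"
        "\<And>z. z \<in> B n \<Longrightarrow> (\<Sum>x\<in>B (Suc n) - {a}. D n z x * w' x) = (\<Sum>x\<in>B (Suc n). D n z x * v x)"
        using elim_image[OF el DP ex[of n], of v] v(2) True by auto
      then show "p \<in> row_image V (B 1 - {a}) (D 0 r)"
        using v(1) True B0 by (auto simp: row_image_def intro!: exI[of _ w'])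
    qed
    then show ?thesis using im B1 by (simp add: D'_def)
  qed
  moreover have "B' 0 = {r}" using B0 by (simp add: B'_def)
  moreover have "\<exists>p. \<forall>i>p. B' i = {}" using bd sub by (metis subset_empty)
  ultimately have "resolves V I B' d D' r"
    using B0 unfolding resolves_def graded_exact_def by blast
  then show ?thesis unfolding B'_def by blast
qed

text \<open>Each cancellation removes generators from a finite total over all positions, so the
  process ends, and it can only end when no entry has a constant term.\<close>

lemma resolves_minimize:
  fixes D :: "nat \<Rightarrow> 'b \<Rightarrow> 'b \<Rightarrow> ('a, 'k::field) mpoly"
  assumes "resolves V I B d D r"
  shows "\<exists>B (D :: nat \<Rightarrow> 'b \<Rightarrow> 'b \<Rightarrow> ('a, 'k) mpoly). resolves V I B d D r \<and> min_entries B D"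
  using assms
proof (induction "card (Sigma UNIV B)" arbitrary: B D rule: less_induct)
  case less
  show ?case
  proof (cases "min_entries B D")
    case True
    then show ?thesis using less.prems by blast
  next
    case False
    then obtain n a b where ab: "a \<in> B (Suc n)" "b \<in> B (Suc (Suc n))"
      "Poly_Mapping.lookup (D (Suc n) a b) 0 \<noteq> 0" by (auto simp: min_entries_def)
    define B' where "B' = B(Suc n := B (Suc n) - {a}, Suc (Suc n) := B (Suc (Suc n)) - {b})"
    obtain D' :: "nat \<Rightarrow> 'b \<Rightarrow> 'b \<Rightarrow> ('a, 'k) mpoly" where D': "resolves V I B' d D' r"
      using resolves_cancel[OF less.prems ab] unfolding B'_def by blast
    obtain p where "\<forall>i>p. B i = {}" "\<forall>i. finite (B i)"
      using less.prems by (auto simp: resolves_def graded_exact_def)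
    then have "finite (Sigma {..p} B)" "Sigma UNIV B \<subseteq> Sigma {..p} B"
      by (auto, metis empty_iff not_le_imp_less)
    then have "finite (Sigma UNIV B)" by (rule rev_finite_subset)
    moreover have "Sigma UNIV B' \<subset> Sigma UNIV B"
    proof
      show "Sigma UNIV B' \<subseteq> Sigma UNIV B" by (auto simp: B'_def split: if_splits)
      have "(Suc n, a) \<in> Sigma UNIV B - Sigma UNIV B'" using ab by (simp add: B'_def)
      then show "Sigma UNIV B' \<noteq> Sigma UNIV B" by blast
    qed
    ultimately have "card (Sigma UNIV B') < card (Sigma UNIV B)" by (rule psubset_card_mono)
    then show ?thesis using less.hyps D' by blast
  qed
qed

section \<open>Existence of minimal graded free resolutions\<close>

lemma sg_cases: "sg \<rho> s T = (1 :: 'r::comm_ring_1) \<or> sg \<rho> s T = (- 1 :: 'r)"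
  by (cases "even (card {t \<in> T. \<rho> t < \<rho> s})") (simp_all add: sg_def)

lemma PR_sg: "sg \<rho> s T \<in> PR V"
  using sg_cases[of \<rho> s T] PR_uminus[OF PR_one] PR_one by metis

lemma homogeneous_sg_times:
  fixes p :: "('a, 'k::field) mpoly"
  assumes "homogeneous e p"
  shows "homogeneous e (sg \<rho> s T * p)"
  using sg_cases[of \<rho> s T, where 'r = "('a, 'k) mpoly"] assms
  by (elim disjE) (simp_all add: homogeneous_uminus)

lemma tay_graded:
  assumes U: "\<And>x. x \<in> S \<Longrightarrow> finite (U x) \<and> U x \<subseteq> V" and S: "finite S"
  shows "(tay \<rho> U T S :: ('a, 'k::field) mpoly) \<in> PR V \<and>
    homogeneous (int (card (\<Union>(U ` S))) - int (card (\<Union>(U ` T)))) (tay \<rho> U T S :: ('a, 'k) mpoly)"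
proof (cases "\<exists>s. s \<notin> T \<and> S = insert s T")
  case False
  then have "tay \<rho> U T S = (0 :: ('a, 'k) mpoly)" by (intro tay_eq_0) blast
  then show ?thesis by simp
next
  case True
  then obtain s where s: "s \<notin> T" "S = insert s T" by blast
  have fin: "finite (U s)" "finite (\<Union>(U ` T))" "U s \<subseteq> V" using U S s by auto
  have "\<Union>(U ` S) = \<Union>(U ` T) \<union> (U s - \<Union>(U ` T))" using s by auto
  then have "card (\<Union>(U ` S)) = card (\<Union>(U ` T)) + card (U s - \<Union>(U ` T))"
    using fin by (metis Diff_disjoint card_Un_disjoint finite_Diff)
  moreover have "homogeneous (int (card (U s - \<Union>(U ` T)))) (tay \<rho> U T S :: ('a, 'k) mpoly)"
    using fin s by (simp add: tay_insert homogeneous_sg_times homogeneous_edge_monomial)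
  moreover have "tay \<rho> U T S \<in> (PR V :: ('a, 'k) mpoly set)"
    using fin s by (auto simp: tay_insert intro!: PR_mult PR_sg edge_monomial_PR)
  ultimately show ?thesis by simp
qed

lemma graded_exact_tay:
  fixes U :: "'i \<Rightarrow> 'a set"
  assumes X: "finite X" "inj_on \<rho> X" and U: "\<And>x. x \<in> X \<Longrightarrow> finite (U x) \<and> U x \<subseteq> V"
  shows "graded_exact V (cells X) (\<lambda>i S. card (\<Union>(U ` S)))
    (\<lambda>i. tay \<rho> U :: _ \<Rightarrow> _ \<Rightarrow> ('a, 'k::field) mpoly)"
  unfolding graded_exact_def
proof (intro conjI allI ballI)
  fix i T S assume S: "S \<in> cells X (Suc i)"
  then have SX: "S \<subseteq> X" by (simp add: cells_def)
  then have "\<And>x. x \<in> S \<Longrightarrow> finite (U x) \<and> U x \<subseteq> V" "finite S"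
    using U X by (auto simp: finite_subset)
  from tay_graded[of S U V \<rho> T, OF this]
  show "(tay \<rho> U T S :: ('a, 'k) mpoly) \<in> PR V"
    "homogeneous (int (card (\<Union>(U ` S))) - int (card (\<Union>(U ` T)))) (tay \<rho> U T S :: ('a, 'k) mpoly)"
    by blast+
next
  fix i
  show "exact_pair V (cells X i) (cells X (Suc i)) (cells X (Suc (Suc i))) (tay \<rho> U)
      (tay \<rho> U :: _ \<Rightarrow> _ \<Rightarrow> ('a, 'k) mpoly)"
  proof (rule exact_pairI)
    fix v :: "'i set \<Rightarrow> ('a, 'k) mpoly"
    assume v: "\<And>b. b \<in> cells X (Suc i) \<Longrightarrow> v b \<in> PR V"
      and 0: "\<And>T. T \<in> cells X i \<Longrightarrow> (\<Sum>S\<in>cells X (Suc i). tay \<rho> U T S * v S) = 0"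
    show "\<exists>w. (\<forall>S\<in>cells X (Suc (Suc i)). w S \<in> PR V) \<and>
      (\<forall>T\<in>cells X (Suc i). v T = (\<Sum>S\<in>cells X (Suc (Suc i)). tay \<rho> U T S * w S))"
      by (rule tay_exact[OF X U v]) (use 0 in auto)
  qed (use X U in \<open>simp_all add: finite_cells tay_comp\<close>)
qed (simp add: finite_cells X)

text \<open>The ideal generated by the square-free monomials with supports in \<open>G\<close>,
  described through the terms of its members so that membership becomes a condition on
  supports.\<close>

definition mon_ideal :: "'a set \<Rightarrow> 'a set set \<Rightarrow> ('a, 'k::field) mpoly set" where
  "mon_ideal V G = {p \<in> PR V. \<forall>m\<in>Poly_Mapping.keys p. \<exists>g\<in>G. g \<subseteq> Poly_Mapping.keys m}"

lemma cells_0: "finite X \<Longrightarrow> cells X 0 = {{}}"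
  by (auto simp: cells_def finite_subset)

text \<open>From right to left this is \<open>tay_exact\<close> in position 0: that each term of
  \<open>p\<close> is divisible by a generator is precisely its hypothesis
  \<open>aug\<close>.\<close>

lemma row_image_tay:
  fixes U :: "'i \<Rightarrow> 'a set"
  assumes X: "finite X" "inj_on \<rho> X" and U: "\<And>x. x \<in> X \<Longrightarrow> finite (U x) \<and> U x \<subseteq> V"
  shows "row_image V (cells X 1) (tay \<rho> U {}) = (mon_ideal V (U ` X) :: ('a, 'k::field) mpoly set)"
proof (intro equalityI subsetI)
  fix p :: "('a, 'k) mpoly"
  assume "p \<in> row_image V (cells X 1) (tay \<rho> U {})"
  then obtain v where p: "p = (\<Sum>S\<in>cells X (Suc 0). tay \<rho> U {} S * v S)"
    and v: "\<forall>S\<in>cells X 1. v S \<in> PR V" by (auto simp: row_image_def)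
  have "tay \<rho> U {} S \<in> (PR V :: ('a, 'k) mpoly set)" if "S \<in> cells X 1" for S
  proof -
    have "S \<subseteq> X" using that by (simp add: cells_def)
    then have "\<And>x. x \<in> S \<Longrightarrow> finite (U x) \<and> U x \<subseteq> V" "finite S"
      using U X by (auto simp: finite_subset)
    from tay_graded[of S U V \<rho> "{}", OF this] show ?thesis by blast
  qed
  then have "p \<in> PR V" unfolding p using v by (intro PR_sum PR_mult) auto
  moreover have "\<exists>g\<in>U ` X. g \<subseteq> Poly_Mapping.keys m" if "m \<in> Poly_Mapping.keys p" for m
  proof -
    have E: "{} \<in> cells X 0" using X by (simp add: cells_0)
    have "(\<Sum>s\<in>X. Poly_Mapping.lookup (sg \<rho> s {} * (edge_monomial (U s) * v {s})) m) \<noteq> 0"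
      using that unfolding p sum_tay[OF X(1) E] by (simp add: in_keys_iff lookup_sum mult.assoc)
    then obtain s where "s \<in> X" "Poly_Mapping.lookup (sg \<rho> s {} * (edge_monomial (U s) * v {s})) m \<noteq> 0"
      by (meson sum.neutral)
    then have "U s \<subseteq> Poly_Mapping.keys m"
      using U by (auto simp: lookup_sg_times lookup_edge_monomial_times split: if_splits)
    then show ?thesis using \<open>s \<in> X\<close> by blast
  qed
  ultimately show "p \<in> mon_ideal V (U ` X)" by (simp add: mon_ideal_def)
next
  fix p :: "('a, 'k) mpoly"
  assume p: "p \<in> mon_ideal V (U ` X)"
  have "\<exists>w. (\<forall>S\<in>cells X (Suc 0). w S \<in> PR V) \<and>
    (\<forall>T\<in>cells X 0. p = (\<Sum>S\<in>cells X (Suc 0). tay \<rho> U T S * w S))"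
    by (rule tay_exact[OF X U, where v = "\<lambda>_. p"]) (use p in \<open>auto simp: mon_ideal_def\<close>)
  then show "p \<in> row_image V (cells X 1) (tay \<rho> U {})"
    using X by (auto simp: row_image_def cells_0)
qed

lemma ex_min_resolution:
  fixes V :: "'a set"
  assumes V: "finite V" and G: "\<And>g. g \<in> G \<Longrightarrow> g \<subseteq> V"
  shows "\<exists>B d (D :: nat \<Rightarrow> 'a set set \<Rightarrow> 'a set set \<Rightarrow> ('a, 'k::field) mpoly) r.
    resolves V (mon_ideal V G) B d D r \<and> min_entries B D"
proof -
  have X: "finite G" by (rule finite_subset[of _ "Pow V"]) (use V G in auto)
  obtain \<rho> :: "'a set \<Rightarrow> nat" where \<rho>: "inj_on \<rho> G"
    using finite_imp_inj_to_nat_seg[OF X] by blast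
  have U: "\<And>g. g \<in> G \<Longrightarrow> finite (id g) \<and> id g \<subseteq> V" using V G by (auto intro: finite_subset)
  have "resolves V (mon_ideal V G) (cells G) (\<lambda>i S. card (\<Union>(id ` S)))
      (\<lambda>i. tay \<rho> id :: _ \<Rightarrow> _ \<Rightarrow> ('a, 'k) mpoly) {}"
    unfolding resolves_def
  proof (intro conjI)
    have "cells G i = {}" if "i > card G" for i
    proof -
      have "card S \<noteq> i" if "S \<subseteq> G" for S using card_mono[OF X that] \<open>i > card G\<close> by simp
      then show ?thesis by (auto simp: cells_def)
    qed
    then show "\<exists>p. \<forall>i>p. cells G i = {}" by blast
  qed (use graded_exact_tay[where U = id, OF X \<rho> U] row_image_tay[where U = id, OF X \<rho> U] X in \<open>simp_all add: cells_0\<close>)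
  from resolves_minimize[OF this] show ?thesis by blast
qed

section \<open>From indexed families to matrices, with the ring prepended as position 0\<close>

definition shifted :: "(nat \<Rightarrow> nat list) \<Rightarrow> nat \<Rightarrow> nat list" where
  "shifted s i = (case i of 0 \<Rightarrow> [0] | Suc j \<Rightarrow> s j)"

lemma shifted_simps [simp]: "shifted s 0 = [0]" "shifted s (Suc i) = s i"
  by (simp_all add: shifted_def)

lemma mult_mat_vec_nth:
  assumes "A \<in> carrier_mat m n" "v \<in> carrier_vec n" "i < m"
  shows "(A *\<^sub>v v) $ i = (\<Sum>j<n. A $$ (i, j) * v $ j)"
  using assms by (auto simp: scalar_prod_def atLeast0LessThan intro!: sum.cong)

lemma exact_pair_mat:
  fixes A :: "('a, 'k::field) mpoly mat"
  assumes A: "A \<in> carrier_mat m n" and E: "E \<in> carrier_mat n l"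
    and EP: "\<And>a b. a < n \<Longrightarrow> b < l \<Longrightarrow> E $$ (a, b) \<in> PR V"
  shows "{v \<in> free_module V n. A *\<^sub>v v = 0\<^sub>v (dim_row A)} = (\<lambda>w. E *\<^sub>v w) ` free_module V l
    \<longleftrightarrow> exact_pair V {..<m} {..<n} {..<l} (\<lambda>a b. A $$ (a, b)) (\<lambda>a b. E $$ (a, b))"
proof -
  have ker: "A *\<^sub>v v = 0\<^sub>v (dim_row A) \<longleftrightarrow> (\<forall>a<m. (\<Sum>j<n. A $$ (a, j) * v $ j) = 0)"
    if "v \<in> free_module V n" for v
  proof -
    have "A *\<^sub>v v = 0\<^sub>v (dim_row A) \<longleftrightarrow> (\<forall>a<m. (A *\<^sub>v v) $ a = 0)"
      using A by (auto simp del: index_mult_mat_vec)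
    then show ?thesis using that A by (simp add: mult_mat_vec_nth free_module_def del: index_mult_mat_vec)
  qed
  have imE: "E *\<^sub>v w = v \<longleftrightarrow> (\<forall>b<n. v $ b = (\<Sum>c<l. E $$ (b, c) * w $ c))"
    if "w \<in> free_module V l" "v \<in> carrier_vec n" for v w
  proof -
    have "E *\<^sub>v w = v \<longleftrightarrow> (\<forall>b<n. (E *\<^sub>v w) $ b = v $ b)"
      using E that(2) by (auto simp del: index_mult_mat_vec)
    moreover have "(E *\<^sub>v w) $ b = (\<Sum>c<l. E $$ (b, c) * w $ c)" if "b < n" for b
      using \<open>w \<in> free_module V l\<close> that by (intro mult_mat_vec_nth[OF E]) (simp_all add: free_module_def)
    ultimately show ?thesis by metis
  qed
  have vecf: "vec q f \<in> free_module V q \<longleftrightarrow> (\<forall>b<q. f b \<in> PR V)" for q f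
    by (auto simp: free_module_def)
  have closed: "E *\<^sub>v w \<in> free_module V n" if "w \<in> free_module V l" for w
    using that E EP by (auto simp: free_module_def mult_mat_vec_nth simp del: index_mult_mat_vec
        intro!: PR_sum PR_mult)
  show ?thesis
  proof
    assume eq: "{v \<in> free_module V n. A *\<^sub>v v = 0\<^sub>v (dim_row A)} = (\<lambda>w. E *\<^sub>v w) ` free_module V l"
    show "exact_pair V {..<m} {..<n} {..<l} (\<lambda>a b. A $$ (a, b)) (\<lambda>a b. E $$ (a, b))"
      unfolding exact_pair_def
    proof (intro allI impI)
      fix f :: "nat \<Rightarrow> ('a, 'k) mpoly" assume f: "\<forall>b\<in>{..<n}. f b \<in> PR V"
      have vf: "vec n f \<in> free_module V n" using f by (simp add: vecf)
      have "(\<forall>a<m. (\<Sum>b<n. A $$ (a, b) * f b) = 0) \<longleftrightarrow> A *\<^sub>v vec n f = 0\<^sub>v (dim_row A)"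
        unfolding ker[OF vf] by simp
      also have "\<dots> \<longleftrightarrow> vec n f \<in> (\<lambda>w. E *\<^sub>v w) ` free_module V l"
        using eq vf by blast
      also have "\<dots> \<longleftrightarrow> (\<exists>w\<in>free_module V l. \<forall>b<n. f b = (\<Sum>c<l. E $$ (b, c) * w $ c))"
      proof -
        have "E *\<^sub>v w = vec n f \<longleftrightarrow> (\<forall>b<n. f b = (\<Sum>c<l. E $$ (b, c) * w $ c))"
          if "w \<in> free_module V l" for w
          unfolding imE[OF that vec_carrier] by simp
        then show ?thesis
          unfolding image_iff eq_commute[of "vec n f"] by (intro bex_cong refl)
      qed
      also have "\<dots> \<longleftrightarrow> (\<exists>g. (\<forall>c<l. g c \<in> PR V) \<and> (\<forall>b<n. f b = (\<Sum>c<l. E $$ (b, c) * g c)))"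
      proof
        assume "\<exists>g. (\<forall>c<l. g c \<in> PR V) \<and> (\<forall>b<n. f b = (\<Sum>c<l. E $$ (b, c) * g c))"
        then obtain g where "\<forall>c<l. g c \<in> PR V" "\<forall>b<n. f b = (\<Sum>c<l. E $$ (b, c) * g c)" by blast
        then show "\<exists>w\<in>free_module V l. \<forall>b<n. f b = (\<Sum>c<l. E $$ (b, c) * w $ c)"
          by (intro bexI[of _ "vec l g"]) (simp_all add: vecf)
      qed (auto simp: free_module_def)
      finally show "(\<forall>a\<in>{..<m}. (\<Sum>b<n. A $$ (a, b) * f b) = 0) \<longleftrightarrow>
          (\<exists>w. (\<forall>c\<in>{..<l}. w c \<in> PR V) \<and> (\<forall>b\<in>{..<n}. f b = (\<Sum>c<l. E $$ (b, c) * w c)))"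
        by (simp only: Ball_def lessThan_iff)
    qed
  next
    assume ex: "exact_pair V {..<m} {..<n} {..<l} (\<lambda>a b. A $$ (a, b)) (\<lambda>a b. E $$ (a, b))"
    have iff: "A *\<^sub>v v = 0\<^sub>v (dim_row A) \<longleftrightarrow>
        (\<exists>w. (\<forall>c<l. w c \<in> PR V) \<and> (\<forall>b<n. v $ b = (\<Sum>c<l. E $$ (b, c) * w c)))"
      if v: "v \<in> free_module V n" for v
      unfolding ker[OF v] using ex[unfolded exact_pair_def, THEN spec[of _ "\<lambda>b. v $ b"]] v
      by (simp add: free_module_def Ball_def)
    show "{v \<in> free_module V n. A *\<^sub>v v = 0\<^sub>v (dim_row A)} = (\<lambda>w. E *\<^sub>v w) ` free_module V l"
    proof (intro equalityI subsetI)
      fix v assume "v \<in> {v \<in> free_module V n. A *\<^sub>v v = 0\<^sub>v (dim_row A)}"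
      then obtain g where v: "v \<in> free_module V n" and g: "\<forall>c<l. g c \<in> PR V"
        "\<forall>b<n. v $ b = (\<Sum>c<l. E $$ (b, c) * g c)" using iff by blast
      have "E *\<^sub>v vec l g = v"
        using g v by (subst imE) (simp_all add: vecf free_module_def)
      then show "v \<in> (\<lambda>w. E *\<^sub>v w) ` free_module V l" using g vecf by blast
    next
      fix v assume "v \<in> (\<lambda>w. E *\<^sub>v w) ` free_module V l"
      then obtain w where w: "w \<in> free_module V l" "v = E *\<^sub>v w" by blast
      then have v: "v \<in> free_module V n" using closed by blast
      then have "\<forall>b<n. v $ b = (\<Sum>c<l. E $$ (b, c) * w $ c)"
        using imE[OF w(1), of v] w(2) by (simp add: free_module_def)
      then show "v \<in> {v \<in> free_module V n. A *\<^sub>v v = 0\<^sub>v (dim_row A)}"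
        using iff[OF v] v w(1) by (auto simp: free_module_def)
    qed
  qed
qed

lemma all_nat_split: "(\<forall>i::nat. P i) \<longleftrightarrow> P 0 \<and> (\<forall>i. P (Suc i))"
  by (metis nat.exhaust)

lemma row_image_mat:
  assumes "A \<in> carrier_mat 1 n"
  shows "(\<lambda>v. (A *\<^sub>v v) $ 0) ` free_module V n = row_image V {..<n} (\<lambda>b. A $$ (0, b))"
proof (intro equalityI subsetI)
  fix p assume "p \<in> (\<lambda>v. (A *\<^sub>v v) $ 0) ` free_module V n"
  then obtain v where "v \<in> free_module V n" "p = (A *\<^sub>v v) $ 0" by blast
  then have "p = (\<Sum>j<n. A $$ (0, j) * v $ j)" "\<forall>j\<in>{..<n}. v $ j \<in> PR V"
    using assms by (auto simp: mult_mat_vec_nth free_module_def simp del: index_mult_mat_vec)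
  then show "p \<in> row_image V {..<n} (\<lambda>b. A $$ (0, b))" unfolding row_image_def by blast
next
  fix p assume "p \<in> row_image V {..<n} (\<lambda>b. A $$ (0, b))"
  then obtain f where f: "p = (\<Sum>j<n. A $$ (0, j) * f j)" "\<forall>j\<in>{..<n}. f j \<in> PR V"
    unfolding row_image_def by blast
  then have "p = (A *\<^sub>v vec n f) $ 0" "vec n f \<in> free_module V n"
    using assms by (auto simp: mult_mat_vec_nth free_module_def simp del: index_mult_mat_vec)
  then show "p \<in> (\<lambda>v. (A *\<^sub>v v) $ 0) ` free_module V n" by blast
qed

text \<open>With \<open>shifted\<close> the augmentation \<open>A 0\<close> becomes one more
  differential, and the clauses about it merge with those about the other maps; minimality still
  starts at \<open>A 1\<close>.\<close>

lemma minimal_graded_free_resolution_iff: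
  fixes A :: "nat \<Rightarrow> ('a, 'k::field) mpoly mat"
  assumes A: "\<And>i. A i \<in> carrier_mat (length (shifted s i)) (length (shifted s (Suc i)))"
  shows "minimal_graded_free_resolution V I s A \<longleftrightarrow>
    resolves V I (\<lambda>i. {..<length (shifted s i)}) (\<lambda>i b. shifted s i ! b) (\<lambda>i a b. A i $$ (a, b)) 0 \<and>
    min_entries (\<lambda>i. {..<length (shifted s i)}) (\<lambda>i a b. A i $$ (a, b))"
    (is "?L \<longleftrightarrow> ?R")
proof -
  let ?G = "\<forall>i. graded_map V (shifted s i) (shifted s (Suc i)) (A i)"
  let ?E = "\<forall>i. exact_pair V {..<length (shifted s i)} {..<length (s i)} {..<length (s (Suc i))}
      (\<lambda>a b. A i $$ (a, b)) (\<lambda>a b. A (Suc i) $$ (a, b))"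
  let ?M = "\<forall>i. \<forall>a<length (s i). \<forall>b<length (s (Suc i)).
      Poly_Mapping.lookup (A (Suc i) $$ (a, b)) 0 = 0"
  let ?I = "row_image V {..<length (s 0)} (\<lambda>b. A 0 $$ (0, b)) = I"
  let ?P = "\<exists>p. \<forall>i>p. s i = []"
  have G: "?G \<longleftrightarrow> graded_map V [0] (s 0) (A 0) \<and> (\<forall>i. graded_map V (s i) (s (Suc i)) (A (Suc i)))"
    by (subst all_nat_split) simp
  have E: "?E \<longleftrightarrow> (\<forall>i. {v \<in> free_module V (length (s i)). A i *\<^sub>v v = 0\<^sub>v (dim_row (A i))} =
          (\<lambda>w. A (Suc i) *\<^sub>v w) ` free_module V (length (s (Suc i))))" if ?G
  proof -
    have "{v \<in> free_module V (length (s i)). A i *\<^sub>v v = 0\<^sub>v (dim_row (A i))} =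
          (\<lambda>w. A (Suc i) *\<^sub>v w) ` free_module V (length (s (Suc i))) \<longleftrightarrow>
        exact_pair V {..<length (shifted s i)} {..<length (s i)} {..<length (s (Suc i))}
          (\<lambda>a b. A i $$ (a, b)) (\<lambda>a b. A (Suc i) $$ (a, b))" for i
      using A[of i] A[of "Suc i"] that[rule_format, of "Suc i"]
      by (intro exact_pair_mat) (simp_all add: graded_map_def)
    then show ?thesis by simp
  qed
  have I: "?I \<longleftrightarrow> (\<lambda>v. (A 0 *\<^sub>v v) $ 0) ` free_module V (length (s 0)) = I"
  proof -
    have "A 0 \<in> carrier_mat 1 (length (s 0))" using A[of 0] by simp
    from row_image_mat[OF this] show ?thesis by simp
  qed
  have L: "?L \<longleftrightarrow> ?G \<and> ?I \<and> ?E \<and> ?M \<and> ?P"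
    unfolding minimal_graded_free_resolution_def I[symmetric] using E G by blast
  have P: "?P \<longleftrightarrow> (\<exists>p. \<forall>i>p. {..<length (shifted s i)} = {})"
  proof
    assume ?P
    then obtain p where p: "\<forall>i>p. s i = []" by blast
    have "shifted s i = []" if "i > Suc p" for i using that p by (cases i) auto
    then show "\<exists>p. \<forall>i>p. {..<length (shifted s i)} = {}" by (intro exI[of _ "Suc p"]) simp
  next
    assume "\<exists>p. \<forall>i>p. {..<length (shifted s i)} = {}"
    then obtain p where p: "\<forall>i>p. {..<length (shifted s i)} = {}" by blast
    have "s i = []" if "i > p" for i
      using p[rule_format, of "Suc i"] that by (simp add: lessThan_empty_iff bot_nat_def)
    then show ?P by blast
  qed
  have GE: "graded_exact V (\<lambda>i. {..<length (shifted s i)}) (\<lambda>i b. shifted s i ! b)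
      (\<lambda>i a b. A i $$ (a, b)) \<longleftrightarrow> ?G \<and> ?E"
    using A by (auto simp: graded_exact_def graded_map_def)
  have M: "min_entries (\<lambda>i. {..<length (shifted s i)}) (\<lambda>i a b. A i $$ (a, b)) \<longleftrightarrow> ?M"
    by (auto simp: min_entries_def)
  have "{..<length (shifted s 0)} = {0}" by auto
  then show ?thesis
    unfolding L resolves_def GE M P by auto
qed

lemma exact_pair_reindex:
  fixes D E :: "'b \<Rightarrow> 'b \<Rightarrow> ('a, 'k::field) mpoly" and h0 h1 h2 :: "'c \<Rightarrow> 'b"
  assumes h: "bij_betw h0 C0 B0" "bij_betw h1 C1 B1" "bij_betw h2 C2 B2"
    and ex: "exact_pair V B0 B1 B2 D E"
  shows "exact_pair V C0 C1 C2 (\<lambda>a b. D (h0 a) (h1 b)) (\<lambda>b c. E (h1 b) (h2 c))"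
  unfolding exact_pair_def
proof (intro allI impI)
  fix v :: "'c \<Rightarrow> ('a, 'k) mpoly" assume v: "\<forall>b\<in>C1. v b \<in> PR V"
  define v' where "v' = v \<circ> inv_into C1 h1"
  have v': "v' (h1 b) = v b" if "b \<in> C1" for b
    using that h(2) by (simp add: v'_def bij_betw_def)
  have ball: "(\<forall>a\<in>B0. P a) \<longleftrightarrow> (\<forall>a\<in>C0. P (h0 a))" "(\<forall>b\<in>B1. P b) \<longleftrightarrow> (\<forall>b\<in>C1. P (h1 b))"
    "(\<forall>c\<in>B2. P c) \<longleftrightarrow> (\<forall>c\<in>C2. P (h2 c))" for P
    using h by (auto simp: bij_betw_def)
  have sum1: "(\<Sum>b\<in>B1. D a b * v' b) = (\<Sum>b\<in>C1. D a (h1 b) * v b)" for a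
    unfolding sum.reindex_bij_betw[OF h(2), symmetric] using v' by (intro sum.cong) auto
  have sum2: "(\<Sum>c\<in>B2. E b c * w c) = (\<Sum>c\<in>C2. E b (h2 c) * w (h2 c))" for b w
    unfolding sum.reindex_bij_betw[OF h(3), symmetric] ..
  have "\<forall>b\<in>B1. v' b \<in> PR V" using v v' unfolding ball by simp
  then have "(\<forall>a\<in>B0. (\<Sum>b\<in>B1. D a b * v' b) = 0) \<longleftrightarrow>
      (\<exists>w. (\<forall>c\<in>B2. w c \<in> PR V) \<and> (\<forall>b\<in>B1. v' b = (\<Sum>c\<in>B2. E b c * w c)))"
    using ex unfolding exact_pair_def by blast
  also have "\<dots> \<longleftrightarrow> (\<exists>w. (\<forall>c\<in>C2. w (h2 c) \<in> PR V) \<and> (\<forall>b\<in>C1. v b = (\<Sum>c\<in>C2. E (h1 b) (h2 c) * w (h2 c))))"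
    unfolding ball sum2 using v' by simp
  also have "\<dots> \<longleftrightarrow> (\<exists>w. (\<forall>c\<in>C2. w c \<in> PR V) \<and> (\<forall>b\<in>C1. v b = (\<Sum>c\<in>C2. E (h1 b) (h2 c) * w c)))"
    (is "?l \<longleftrightarrow> ?r")
  proof
    assume ?r
    then obtain w where w: "\<forall>c\<in>C2. w c \<in> PR V" "\<forall>b\<in>C1. v b = (\<Sum>c\<in>C2. E (h1 b) (h2 c) * w c)" by blast
    define w' where "w' = w \<circ> inv_into C2 h2"
    have "w' (h2 c) = w c" if "c \<in> C2" for c
      using that h(3) by (simp add: w'_def bij_betw_def)
    then show ?l using w by (intro exI[of _ w']) simp
  next
    assume ?l
    then obtain w where "\<forall>c\<in>C2. w (h2 c) \<in> PR V"
      "\<forall>b\<in>C1. v b = (\<Sum>c\<in>C2. E (h1 b) (h2 c) * w (h2 c))" by blast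
    then show ?r by (intro exI[of _ "w \<circ> h2"]) simp
  qed
  finally show "(\<forall>a\<in>C0. (\<Sum>b\<in>C1. D (h0 a) (h1 b) * v b) = 0) \<longleftrightarrow>
      (\<exists>w. (\<forall>c\<in>C2. w c \<in> PR V) \<and> (\<forall>b\<in>C1. v b = (\<Sum>c\<in>C2. E (h1 b) (h2 c) * w c)))"
    unfolding ball sum1 .
qed

lemma ex_minimal_graded_free_resolution:
  fixes D :: "nat \<Rightarrow> 'b \<Rightarrow> 'b \<Rightarrow> ('a, 'k::field) mpoly"
  assumes res: "resolves V I B d D r" and min: "min_entries B D"
  shows "\<exists>s A. minimal_graded_free_resolution V I s A"
proof -
  have ge: "graded_exact V B d D" and B0: "B 0 = {r}" "d 0 r = 0"
    and im: "row_image V (B 1) (D 0 r) = I" and bd: "\<exists>p. \<forall>i>p. B i = {}"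
    using res by (auto simp: resolves_def)
  have "finite (B i)" for i using ge by (simp add: graded_exact_def)
  then have "\<forall>i. \<exists>xs. set xs = B i \<and> distinct xs" using finite_distinct_list by blast
  then obtain L where L: "\<And>i. set (L i) = B i \<and> distinct (L i)" by metis
  have L0: "L 0 = [r]"
  proof -
    have "length (L 0) = Suc 0" using distinct_card[of "L 0"] L[of 0] B0 by simp
    then show ?thesis using L[of 0] B0 by (auto simp: length_Suc_conv)
  qed
  have bij: "bij_betw (\<lambda>n. L i ! n) {..<length (L i)} (B i)" for i
    using L bij_betw_nth by metis
  \<comment> \<open>Position 0 is the ring, so the degree lists of the ideal start at position
    1.\<close>
  define s where "s i = map (d (Suc i)) (L (Suc i))" for i
  define A where "A i = mat (length (L i)) (length (L (Suc i))) (\<lambda>(a, b). D i (L i ! a) (L (Suc i) ! b))" for i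
  have sh: "shifted s i = map (d i) (L i)" for i
    by (cases i) (simp_all add: s_def L0 B0)
  have carr: "A i \<in> carrier_mat (length (shifted s i)) (length (shifted s (Suc i)))" for i
    by (simp add: A_def sh del: shifted_simps)
  have Lmem: "n < length (L i) \<Longrightarrow> L i ! n \<in> B i" for i n
    using L nth_mem by metis
  have "minimal_graded_free_resolution V I s A"
    unfolding minimal_graded_free_resolution_iff[of A s, OF carr]
  proof
    show "min_entries (\<lambda>i. {..<length (shifted s i)}) (\<lambda>i a b. A i $$ (a, b))"
      using min Lmem by (simp add: min_entries_def sh A_def del: shifted_simps)
    show "resolves V I (\<lambda>i. {..<length (shifted s i)}) (\<lambda>i b. shifted s i ! b) (\<lambda>i a b. A i $$ (a, b)) 0"
      unfolding resolves_def
    proof (intro conjI)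
      have "exact_pair V {..<length (L i)} {..<length (L (Suc i))} {..<length (L (Suc (Suc i)))}
        (\<lambda>a b. A i $$ (a, b)) (\<lambda>a b. A (Suc i) $$ (a, b))" for i
      proof -
        have "exact_pair V {..<length (L i)} {..<length (L (Suc i))} {..<length (L (Suc (Suc i)))}
          (\<lambda>a b. D i (L i ! a) (L (Suc i) ! b)) (\<lambda>a b. D (Suc i) (L (Suc i) ! a) (L (Suc (Suc i)) ! b))"
          using ge by (intro exact_pair_reindex[OF bij bij bij]) (simp add: graded_exact_def)
        then show ?thesis by (simp add: exact_pair_def A_def)
      qed
      moreover have "A i $$ (a, b) \<in> PR V \<and>
          homogeneous (int (d (Suc i) (L (Suc i) ! b)) - int (d i (L i ! a))) (A i $$ (a, b))"
        if "a < length (L i)" "b < length (L (Suc i))" for i a b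
        using ge that Lmem by (simp add: graded_exact_def A_def)
      ultimately show "graded_exact V (\<lambda>i. {..<length (shifted s i)}) (\<lambda>i b. shifted s i ! b)
          (\<lambda>i a b. A i $$ (a, b))"
        by (simp add: graded_exact_def sh del: shifted_simps)
      have "row_image V {..<length (L 1)} (\<lambda>b. A 0 $$ (0, b)) = row_image V (B 1) (D 0 r)"
      proof (intro equalityI subsetI)
        fix p assume "p \<in> row_image V {..<length (L 1)} (\<lambda>b. A 0 $$ (0, b))"
        then obtain v where v: "p = (\<Sum>b<length (L 1). A 0 $$ (0, b) * v b)"
          "\<forall>b\<in>{..<length (L 1)}. v b \<in> PR V" by (auto simp: row_image_def)
        define v' where "v' = v \<circ> inv_into {..<length (L 1)} (\<lambda>n. L 1 ! n)"
        have v': "v' (L 1 ! n) = v n" if "n < length (L 1)" for n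
          using that bij[of 1] by (simp add: v'_def bij_betw_def)
        have "(\<Sum>b\<in>B 1. D 0 r b * v' b) = p"
          unfolding sum.reindex_bij_betw[OF bij, symmetric] v(1)
          by (rule sum.cong) (simp_all add: v'[unfolded One_nat_def] A_def L0)
        moreover have "\<forall>b\<in>B 1. v' b \<in> PR V"
        proof
          fix b assume "b \<in> B 1"
          then obtain n where n: "n < length (L 1)" "L 1 ! n = b" using L[of 1] in_set_conv_nth by metis
          then show "v' b \<in> PR V" using v(2) v'[OF n(1)] by simp
        qed
        ultimately show "p \<in> row_image V (B 1) (D 0 r)" by (auto simp: row_image_def)
      next
        fix p assume "p \<in> row_image V (B 1) (D 0 r)"
        then obtain v where v: "p = (\<Sum>b\<in>B 1. D 0 r b * v b)" "\<forall>b\<in>B 1. v b \<in> PR V"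
          by (auto simp: row_image_def)
        have "p = (\<Sum>n<length (L 1). A 0 $$ (0, n) * v (L 1 ! n))"
          unfolding sum.reindex_bij_betw[OF bij, symmetric] v(1)
          by (rule sum.cong) (simp_all add: A_def L0)
        moreover have "\<forall>n\<in>{..<length (L 1)}. v (L 1 ! n) \<in> PR V" using v(2) Lmem by simp
        ultimately show "p \<in> row_image V {..<length (L 1)} (\<lambda>b. A 0 $$ (0, b))"
          unfolding row_image_def by (intro CollectI exI[of _ "\<lambda>n. v (L 1 ! n)"]) simp
      qed
      then show "row_image V {..<length (shifted s 1)} (\<lambda>b. A 0 $$ (0, b)) = I"
        using im by (simp add: sh del: shifted_simps)
      show "\<exists>p. \<forall>i>p. {..<length (shifted s i)} = {}"
      proof -
        obtain p where "\<forall>i>p. B i = {}" using bd by blast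
        then have "\<forall>i>p. L i = []" using L by (metis set_empty)
        then show ?thesis by (intro exI[of _ p]) (simp add: sh del: shifted_simps)
      qed
    qed auto
  qed
  then show ?thesis by blast
qed

section \<open>Balancing Tor\<close>

lemma resolves_of_minimal:
  assumes "minimal_graded_free_resolution V I s A"
  shows "resolves V I (\<lambda>i. {..<length (shifted s i)}) (\<lambda>i b. shifted s i ! b) (\<lambda>i a b. A i $$ (a, b)) 0"
proof -
  have "A i \<in> carrier_mat (length (shifted s i)) (length (shifted s (Suc i)))" for i
    using assms by (cases i) (simp_all add: minimal_graded_free_resolution_def graded_map_def)
  then show ?thesis using assms minimal_graded_free_resolution_iff by blast
qed

lemma sum_mult_swap:
  fixes f :: "'b \<Rightarrow> 'r::comm_ring_1"
  shows "(\<Sum>b\<in>B. f b * (\<Sum>s\<in>C. g s * x s b)) = (\<Sum>s\<in>C. g s * (\<Sum>b\<in>B. f b * x s b))"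
  unfolding sum_distrib_left by (subst sum.swap) (simp add: ac_simps)

lemma graded_exact_comp:
  fixes w :: "'b \<Rightarrow> ('a, 'k::field) mpoly"
  assumes ge: "graded_exact V B d D" and a: "a \<in> B i"
  shows "(\<Sum>b\<in>B (Suc i). D i a b * (\<Sum>c\<in>B (Suc (Suc i)). D (Suc i) b c * w c)) = 0"
proof -
  have "(\<Sum>b\<in>B (Suc i). D i a b * D (Suc i) b c) = 0" if "c \<in> B (Suc (Suc i))" for c
    using ge a that by (intro exact_pair_comp[of V "B i" _ "B (Suc (Suc i))"]) (auto simp: graded_exact_def)
  then have "(\<Sum>c\<in>B (Suc (Suc i)). (\<Sum>b\<in>B (Suc i). D i a b * D (Suc i) b c) * w c) = 0" by simp
  moreover have "(\<Sum>c\<in>B (Suc (Suc i)). (\<Sum>b\<in>B (Suc i). D i a b * D (Suc i) b c) * w c) =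
      (\<Sum>b\<in>B (Suc i). D i a b * (\<Sum>c\<in>B (Suc (Suc i)). D (Suc i) b c * w c))"
    unfolding sum_distrib_left sum_distrib_right by (subst sum.swap) (simp add: mult.assoc)
  ultimately show ?thesis by simp
qed

lemma graded_exact_lift:
  fixes v :: "'b \<Rightarrow> ('a, 'k::field) mpoly"
  assumes ge: "graded_exact V B d D"
    and v: "\<And>b. b \<in> B (Suc i) \<Longrightarrow> v b \<in> PR V"
    and 0: "\<And>a. a \<in> B i \<Longrightarrow> (\<Sum>b\<in>B (Suc i). D i a b * v b) = 0"
  shows "\<exists>w. (\<forall>c\<in>B (Suc (Suc i)). w c \<in> PR V) \<and>
    (\<forall>b\<in>B (Suc i). v b = (\<Sum>c\<in>B (Suc (Suc i)). D (Suc i) b c * w c))"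
  using ge v 0 by (intro exact_pair_exact[of V "B i" _ _ "D i"]) (auto simp: graded_exact_def)

text \<open>The map has degree 0, so taking in coordinate \<open>c\<close> the component of degree
  \<open>n - d2 c\<close> commutes with it; thus a lift of a homogeneous vector may be replaced by a
  homogeneous one.\<close>

lemma homogeneous_lift:
  fixes v :: "'b \<Rightarrow> ('a, 'k::field) mpoly"
  assumes E: "\<And>b c. b \<in> B1 \<Longrightarrow> c \<in> B2 \<Longrightarrow> homogeneous (int (d2 c) - int (d1 b)) (E b c)"
    and h: "\<And>b. b \<in> B1 \<Longrightarrow> homogeneous (n - int (d1 b)) (v b)"
    and v: "\<And>b. b \<in> B1 \<Longrightarrow> v b = (\<Sum>c\<in>B2. E b c * w c)" and b: "b \<in> B1"
  shows "v b = (\<Sum>c\<in>B2. E b c * hcomp (n - int (d2 c)) (w c))"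
proof -
  have "v b = hcomp (n - int (d1 b)) (\<Sum>c\<in>B2. E b c * w c)"
    using hcomp_homogeneous[OF h[OF b]] v[OF b] by simp
  also have "\<dots> = (\<Sum>c\<in>B2. hcomp (n - int (d1 b)) (E b c * w c))" by (rule hcomp_sum)
  also have "\<dots> = (\<Sum>c\<in>B2. E b c * hcomp (n - int (d2 c)) (w c))"
    by (rule sum.cong) (simp_all add: hcomp_mult[OF E[OF b]])
  finally show ?thesis .
qed

text \<open>The staircase argument that balances Tor: \<open>C\<close> plays the role of the Koszul complex and \<open>B\<close>
  that of a free resolution. If the step of \<open>B\<close> in which the staircase ends has no generator of
  degree \<open>j\<close>, then a cycle of degree \<open>j\<close> with coefficients in the image of \<open>D q\<close> is a boundary
  with coefficients in that image.\<close>

lemma staircase: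
  fixes D :: "nat \<Rightarrow> 'b \<Rightarrow> 'b \<Rightarrow> ('a, 'k::field) mpoly" and \<kappa> :: "nat \<Rightarrow> 'c \<Rightarrow> 'c \<Rightarrow> ('a, 'k) mpoly"
  assumes C: "graded_exact V C e \<kappa>" "C 0 = {t}" "e 0 t = 0"
    and B: "graded_exact V B d D"
    and aug: "\<And>f. f \<in> PR V \<Longrightarrow> Poly_Mapping.lookup f 0 = 0 \<Longrightarrow>
       \<exists>w. (\<forall>c\<in>C 1. w c \<in> PR V) \<and> f = (\<Sum>c\<in>C 1. \<kappa> 0 t c * w c)"
    and "\<And>b. b \<in> B (Suc q + p) \<Longrightarrow> int (d (Suc q + p) b) \<noteq> j"
    and "\<And>S b. S \<in> C p \<Longrightarrow> b \<in> B (Suc q) \<Longrightarrow> z S b \<in> PR V"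
    and "\<And>S b. S \<in> C p \<Longrightarrow> b \<in> B (Suc q) \<Longrightarrow> homogeneous (j - int (e p S) - int (d (Suc q) b)) (z S b)"
    and "\<And>p' R a. p = Suc p' \<Longrightarrow> R \<in> C p' \<Longrightarrow> a \<in> B q \<Longrightarrow>
       (\<Sum>S\<in>C p. \<kappa> p' R S * (\<Sum>b\<in>B (Suc q). D q a b * z S b)) = 0"
  shows "\<exists>w. (\<forall>S\<in>C (Suc p). \<forall>b\<in>B (Suc q). w S b \<in> PR V) \<and>
    (\<forall>S\<in>C p. \<forall>a\<in>B q. (\<Sum>b\<in>B (Suc q). D q a b * z S b) =
       (\<Sum>S'\<in>C (Suc p). \<kappa> p S S' * (\<Sum>b\<in>B (Suc q). D q a b * w S' b)))"
  using assms(6-)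
proof (induction p arbitrary: q z)
  case 0
  \<comment> \<open>Here the absence of generators enters: a constant term of \<open>z t b\<close>
    would force \<open>d (Suc q) b = j\<close>. Without constant terms the coefficients lie in the
    ideal of the variables and lift along \<open>\<kappa> 0\<close>.\<close>
  have "\<forall>b\<in>B (Suc q). \<exists>w. (\<forall>c\<in>C 1. w c \<in> PR V) \<and> z t b = (\<Sum>c\<in>C 1. \<kappa> 0 t c * w c)"
  proof (intro ballI aug)
    fix b assume b: "b \<in> B (Suc q)"
    show "z t b \<in> PR V" using 0(2) C b by simp
    show "Poly_Mapping.lookup (z t b) 0 = 0"
    proof (rule ccontr)
      assume "Poly_Mapping.lookup (z t b) 0 \<noteq> 0"
      then have "j - int (e 0 t) - int (d (Suc q) b) = 0"
        using homogeneous_const(1) 0(3)[of t b] C(2) b by blast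
      then show False using 0(1)[of b] C(3) b by simp
    qed
  qed
  from bchoice[OF this] obtain w where w: "\<And>b c. b \<in> B (Suc q) \<Longrightarrow> c \<in> C 1 \<Longrightarrow> w b c \<in> PR V"
    "\<And>b. b \<in> B (Suc q) \<Longrightarrow> z t b = (\<Sum>c\<in>C 1. \<kappa> 0 t c * w b c)" by blast
  have "(\<Sum>b\<in>B (Suc q). D q a b * z t b) =
      (\<Sum>S'\<in>C 1. \<kappa> 0 t S' * (\<Sum>b\<in>B (Suc q). D q a b * w b S'))" for a
  proof -
    have "(\<Sum>b\<in>B (Suc q). D q a b * z t b) = (\<Sum>b\<in>B (Suc q). D q a b * (\<Sum>c\<in>C 1. \<kappa> 0 t c * w b c))"
      by (rule sum.cong) (simp_all only: w(2))
    also have "\<dots> = (\<Sum>S'\<in>C 1. \<kappa> 0 t S' * (\<Sum>b\<in>B (Suc q). D q a b * w b S'))"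
      by (rule sum_mult_swap)
    finally show ?thesis .
  qed
  then show ?case using w(1) C(2) by (intro exI[of _ "\<lambda>c b. w b c"]) simp
next
  case (Suc p)
  have DP: "D i a b \<in> PR V" and Dh: "homogeneous (int (d (Suc i) b) - int (d i a)) (D i a b)"
    if "a \<in> B i" "b \<in> B (Suc i)" for i a b using B that by (simp_all add: graded_exact_def)
  have KP: "\<kappa> i a b \<in> PR V" and Kh: "homogeneous (int (e (Suc i) b) - int (e i a)) (\<kappa> i a b)"
    if "a \<in> C i" "b \<in> C (Suc i)" for i a b using C that by (simp_all add: graded_exact_def)
  \<comment> \<open>One stair: the differential of \<open>C\<close> sends \<open>z\<close> into the
    kernel of \<open>D q\<close> by the cycle condition, so the result lifts one position further
    along \<open>B\<close> while the position in \<open>C\<close> drops. The total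
    \<open>Suc q + p\<close> and the degree \<open>j\<close> are preserved.\<close>
  define z' where "z' R b = (\<Sum>S\<in>C (Suc p). \<kappa> p R S * z S b)" for R b
  have z'P: "z' R b \<in> PR V" if "R \<in> C p" "b \<in> B (Suc q)" for R b
    unfolding z'_def using that Suc.prems(2) KP by (intro PR_sum PR_mult) auto
  have z'h: "homogeneous (j - int (e p R) - int (d (Suc q) b)) (z' R b)"
    if "R \<in> C p" "b \<in> B (Suc q)" for R b
    unfolding z'_def
  proof (rule homogeneous_sum)
    fix S assume "S \<in> C (Suc p)"
    then show "homogeneous (j - int (e p R) - int (d (Suc q) b)) (\<kappa> p R S * z S b)"
      by (intro homogeneous_mult'[OF Kh Suc.prems(3)]) (use that in auto)
  qed
  have "\<forall>R\<in>C p. \<exists>u. (\<forall>c\<in>B (Suc (Suc q)). u c \<in> PR V \<and> homogeneous (j - int (e p R) - int (d (Suc (Suc q)) c)) (u c)) \<and>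
      (\<forall>b\<in>B (Suc q). z' R b = (\<Sum>c\<in>B (Suc (Suc q)). D (Suc q) b c * u c))"
  proof
    fix R assume R: "R \<in> C p"
    have "(\<Sum>b\<in>B (Suc q). D q a b * z' R b) = 0" if a: "a \<in> B q" for a
      unfolding z'_def by (subst sum_mult_swap) (rule Suc.prems(4)[OF refl R a])
    with graded_exact_lift[OF B, of q "z' R"] z'P[OF R] obtain w where
      w: "\<And>c. c \<in> B (Suc (Suc q)) \<Longrightarrow> w c \<in> PR V"
      "\<And>b. b \<in> B (Suc q) \<Longrightarrow> z' R b = (\<Sum>c\<in>B (Suc (Suc q)). D (Suc q) b c * w c)" by blast
    have "z' R b = (\<Sum>c\<in>B (Suc (Suc q)). D (Suc q) b c *
        hcomp (j - int (e p R) - int (d (Suc (Suc q)) c)) (w c))" if "b \<in> B (Suc q)" for b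
      by (rule homogeneous_lift[OF Dh z'h[OF R] w(2) that])
    then show "\<exists>u. (\<forall>c\<in>B (Suc (Suc q)). u c \<in> PR V \<and> homogeneous (j - int (e p R) - int (d (Suc (Suc q)) c)) (u c)) \<and>
      (\<forall>b\<in>B (Suc q). z' R b = (\<Sum>c\<in>B (Suc (Suc q)). D (Suc q) b c * u c))"
      using w(1) by (intro exI[of _ "\<lambda>c. hcomp (j - int (e p R) - int (d (Suc (Suc q)) c)) (w c)"])
        (simp add: PR_hcomp homogeneous_hcomp)
  qed
  from bchoice[OF this] obtain u where uP: "\<And>R c. R \<in> C p \<Longrightarrow> c \<in> B (Suc (Suc q)) \<Longrightarrow> u R c \<in> PR V"
    and uh: "\<And>R c. R \<in> C p \<Longrightarrow> c \<in> B (Suc (Suc q)) \<Longrightarrow>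
      homogeneous (j - int (e p R) - int (d (Suc (Suc q)) c)) (u R c)"
    and u: "\<And>R b. R \<in> C p \<Longrightarrow> b \<in> B (Suc q) \<Longrightarrow> z' R b = (\<Sum>c\<in>B (Suc (Suc q)). D (Suc q) b c * u R c)"
    by blast
  have "\<exists>w. (\<forall>S\<in>C (Suc p). \<forall>b\<in>B (Suc (Suc q)). w S b \<in> PR V) \<and>
    (\<forall>S\<in>C p. \<forall>a\<in>B (Suc q). (\<Sum>b\<in>B (Suc (Suc q)). D (Suc q) a b * u S b) =
       (\<Sum>S'\<in>C (Suc p). \<kappa> p S S' * (\<Sum>b\<in>B (Suc (Suc q)). D (Suc q) a b * w S' b)))"
  proof (rule Suc.IH)
    fix p' Q b assume p': "p = Suc p'" and Q: "Q \<in> C p'" and b: "b \<in> B (Suc q)"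
    have "(\<Sum>R\<in>C p. \<kappa> p' Q R * (\<Sum>c\<in>B (Suc (Suc q)). D (Suc q) b c * u R c)) =
        (\<Sum>R\<in>C p. \<kappa> p' Q R * z' R b)"
      using u b by (intro sum.cong) simp_all
    also have "\<dots> = 0" unfolding z'_def p' by (rule graded_exact_comp[OF C(1) Q])
    finally show "(\<Sum>R\<in>C p. \<kappa> p' Q R * (\<Sum>c\<in>B (Suc (Suc q)). D (Suc q) b c * u R c)) = 0" .
  qed (use Suc.prems(1) uP uh in auto)
  then obtain w' where w'P: "\<And>S b. S \<in> C (Suc p) \<Longrightarrow> b \<in> B (Suc (Suc q)) \<Longrightarrow> w' S b \<in> PR V"
    and w': "\<And>R a. R \<in> C p \<Longrightarrow> a \<in> B (Suc q) \<Longrightarrow> (\<Sum>b\<in>B (Suc (Suc q)). D (Suc q) a b * u R b) =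
       (\<Sum>S'\<in>C (Suc p). \<kappa> p R S' * (\<Sum>b\<in>B (Suc (Suc q)). D (Suc q) a b * w' S' b))"
    by blast
  \<comment> \<open>The chain \<open>dw\<close> is killed by \<open>D q\<close> and has the same
    \<open>C\<close>-boundary as \<open>z\<close>. Hence \<open>z - dw\<close> is a cycle of
    \<open>C\<close> in every coordinate and lifts, and the lift represents \<open>z\<close> after
    applying \<open>D q\<close>.\<close>
  define dw where "dw S b = (\<Sum>c\<in>B (Suc (Suc q)). D (Suc q) b c * w' S c)" for S b
  have dwP: "dw S b \<in> PR V" if "S \<in> C (Suc p)" "b \<in> B (Suc q)" for S b
    unfolding dw_def using that DP w'P by (intro PR_sum PR_mult) auto
  have "\<forall>b\<in>B (Suc q). \<exists>w. (\<forall>c\<in>C (Suc (Suc p)). w c \<in> PR V) \<and>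
      (\<forall>S\<in>C (Suc p). z S b - dw S b = (\<Sum>c\<in>C (Suc (Suc p)). \<kappa> (Suc p) S c * w c))"
  proof (intro ballI graded_exact_lift[OF C(1)])
    fix b R assume b: "b \<in> B (Suc q)" and R: "R \<in> C p"
    have "(\<Sum>S\<in>C (Suc p). \<kappa> p R S * dw S b) = z' R b"
      unfolding dw_def using w'[OF R b] u[OF R b] by simp
    then show "(\<Sum>S\<in>C (Suc p). \<kappa> p R S * (z S b - dw S b)) = 0"
      by (simp add: right_diff_distrib sum_subtractf z'_def)
  qed (use Suc.prems(2) dwP in \<open>auto intro: PR_diff\<close>)
  from bchoice[OF this] obtain w where wP: "\<And>b c. b \<in> B (Suc q) \<Longrightarrow> c \<in> C (Suc (Suc p)) \<Longrightarrow> w b c \<in> PR V"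
    and w: "\<And>b S. b \<in> B (Suc q) \<Longrightarrow> S \<in> C (Suc p) \<Longrightarrow>
      z S b - dw S b = (\<Sum>c\<in>C (Suc (Suc p)). \<kappa> (Suc p) S c * w b c)" by blast
  have "(\<Sum>b\<in>B (Suc q). D q a b * z S b) =
      (\<Sum>S'\<in>C (Suc (Suc p)). \<kappa> (Suc p) S S' * (\<Sum>b\<in>B (Suc q). D q a b * w b S'))"
    if S: "S \<in> C (Suc p)" and a: "a \<in> B q" for S a
  proof -
    have "(\<Sum>b\<in>B (Suc q). D q a b * dw S b) = 0"
      unfolding dw_def by (rule graded_exact_comp[OF B a])
    then have "(\<Sum>b\<in>B (Suc q). D q a b * z S b) = (\<Sum>b\<in>B (Suc q). D q a b * (z S b - dw S b))"
      by (simp add: right_diff_distrib sum_subtractf)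
    also have "\<dots> = (\<Sum>b\<in>B (Suc q). D q a b * (\<Sum>c\<in>C (Suc (Suc p)). \<kappa> (Suc p) S c * w b c))"
      using w S by (intro sum.cong) simp_all
    also have "\<dots> = (\<Sum>S'\<in>C (Suc (Suc p)). \<kappa> (Suc p) S S' * (\<Sum>b\<in>B (Suc q). D q a b * w b S'))"
      by (rule sum_mult_swap)
    finally show ?thesis .
  qed
  then show ?case using wP by (intro exI[of _ "\<lambda>c b. w b c"]) blast
qed

section \<open>A generator detected by transversals\<close>

text \<open>The elements of \<open>T\<close> preceding \<open>s\<close> are those preceding
  \<open>s'\<close>, so the signs differ only through the mutual order of \<open>s\<close> and
  \<open>s'\<close>: exactly one of them counts the other.\<close>

lemma sg_swap:
  assumes T: "finite T" "s \<notin> T" "s' \<notin> T" and neq: "\<rho> s \<noteq> \<rho> s'"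
    and same: "\<And>t. t \<in> T \<Longrightarrow> \<rho> t < \<rho> s \<longleftrightarrow> \<rho> t < \<rho> s'"
  shows "sg \<rho> s (insert s' T) = - (sg \<rho> s' (insert s T) :: 'r::comm_ring_1)"
proof -
  have eq: "sg \<rho> s T = (sg \<rho> s' T :: 'r)"
    unfolding sg_def using same by (metis (mono_tags, lifting) Collect_cong)
  consider "\<rho> s < \<rho> s'" | "\<rho> s' < \<rho> s" using neq by linarith
  then show ?thesis
  proof cases
    case 1
    then show ?thesis
      using T eq by (simp add: sg_insert_smaller[of T s \<rho> s'] sg_insert_larger[of \<rho> s' s])
  next
    case 2
    then show ?thesis
      using T eq by (simp add: sg_insert_smaller[of T s' \<rho> s] sg_insert_larger[of \<rho> s s'])
  qed
qed

text \<open>The indicator of the transversals of the classes \<open>1, \<dots>, p\<close> is a cocycle as soon as the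
  transversals of all classes are disregarded: a set of \<open>p + 1\<close> vertices that contains such a
  transversal but avoids class \<open>0\<close> doubles exactly one class, and the two ways of removing one
  of the doubled vertices carry opposite signs because \<open>\<rho>\<close> is monotone on the classes.\<close>

lemma transversal_cancel:
  fixes F :: "'a set \<Rightarrow> 'r::comm_ring_1" and c :: "'a \<Rightarrow> nat"
  assumes W: "finite W" "inj_on \<rho> W"
    and mono: "\<And>y y'. y \<in> W \<Longrightarrow> y' \<in> W \<Longrightarrow> c y < c y' \<Longrightarrow> \<rho> y < \<rho> y'"
    and c: "\<And>y. y \<in> W \<Longrightarrow> c y < Suc p"
    and F: "\<And>Q. Q \<subseteq> W \<Longrightarrow> card Q = Suc p \<Longrightarrow> c ` Q = {..<Suc p} \<Longrightarrow> F Q = 0"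
  shows "(\<Sum>S\<in>{S. S \<subseteq> W \<and> card S = p \<and> c ` S = {1..<Suc p}}. \<Sum>s\<in>W - S. sg \<rho> s S * F (insert s S)) = 0"
proof -
  define Tr where "Tr = {S. S \<subseteq> W \<and> card S = p \<and> c ` S = {1..<Suc p}}"
  define A where "A = (SIGMA S:Tr. W - S)"
  have Tr: "finite Tr" using W by (auto simp: Tr_def)
  then have A: "finite A" using W by (auto simp: A_def)
  \<comment> \<open>Pairs of a transversal and an added vertex are grouped by their union
    \<open>Q\<close>; a nonempty fibre is killed by \<open>F\<close> or consists of two opposite
    terms.\<close>
  have fibre: "(\<Sum>z\<in>{z \<in> A. insert (snd z) (fst z) = Q}. sg \<rho> (snd z) (fst z) * F (insert (snd z) (fst z))) = 0"
    for Q
  proof (cases "{z \<in> A. insert (snd z) (fst z) = Q} = {}")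
    case True
    show ?thesis unfolding True by simp
  next
    case False
    then obtain S s where S: "S \<in> Tr" "s \<in> W - S" "Q = insert s S" by (auto simp: A_def)
    have SW: "S \<subseteq> W" "finite S" "card S = p" "c ` S = {1..<Suc p}"
      using S W by (auto simp: Tr_def finite_subset)
    have QW: "Q \<subseteq> W" using S SW by auto
    show ?thesis
    proof (cases "c s = 0")
      case True
      have "insert 0 {1..<Suc p} = {..<Suc p}" by auto
      then have "c ` Q = {..<Suc p}" using S SW True by simp
      moreover have "card Q = Suc p" using S SW by simp
      ultimately have "F Q = 0" using QW F by blast
      then show ?thesis by (intro sum.neutral) auto
    next
      case False
      then have "c s \<in> c ` S" using c[of s] S SW by auto
      then obtain s' where s': "s' \<in> S" "c s' = c s" by auto
      \<comment> \<open>A transversal has \<open>p\<close> vertices for \<open>p\<close> classes,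
        hence one in each; this makes the partner \<open>s'\<close> of \<open>s\<close>
        unique.\<close>
      have injS: "inj_on c S1" if "S1 \<in> Tr" for S1
        using that W by (intro eq_card_imp_inj_on) (auto simp: Tr_def finite_subset)
      define T where "T = S - {s'}"
      have T: "S = insert s' T" "s' \<notin> T" "s \<notin> T" "finite T" "s \<noteq> s'" "s \<in> W" "s' \<in> W"
        using s' S SW by (auto simp: T_def)
      have cardT: "Suc (card T) = p" using T SW by simp
      have S': "insert s T \<in> Tr"
      proof -
        have "c ` insert s T = c ` S" unfolding T(1) using s' by simp
        then show ?thesis using T SW cardT by (auto simp: Tr_def)
      qed
      have "{z \<in> A. insert (snd z) (fst z) = Q} = {(S, s), (insert s T, s')}"
      proof (intro equalityI subsetI)
        fix z assume z: "z \<in> {z \<in> A. insert (snd z) (fst z) = Q}"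
        obtain S1 s1 where [simp]: "z = (S1, s1)" by (cases z)
        have S1: "S1 \<in> Tr" "s1 \<notin> S1" "insert s1 S1 = Q" using z by (auto simp: A_def)
        have "s1 = s \<or> s1 = s'"
        proof (rule ccontr)
          assume "\<not> (s1 = s \<or> s1 = s')"
          then have "s \<in> S1" "s' \<in> S1" using S1 S s' by auto
          then show False using injS[OF S1(1)] s'(2) T(5) by (metis inj_on_def)
        qed
        moreover have "S1 = Q - {s1}" using S1 by auto
        ultimately show "z \<in> {(S, s), (insert s T, s')}" using S T by auto
      next
        fix z assume "z \<in> {(S, s), (insert s T, s')}"
        then show "z \<in> {z \<in> A. insert (snd z) (fst z) = Q}"
          using S S' T by (auto simp: A_def)
      qed
      moreover have "sg \<rho> s S = - (sg \<rho> s' (insert s T) :: 'r)"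
        unfolding T(1)
      proof (rule sg_swap[OF T(4,3,2)])
        show "\<rho> s \<noteq> \<rho> s'" using W(2) T by (metis inj_on_def)
        fix t assume t: "t \<in> T"
        then have tW: "t \<in> W" "t \<in> S" "t \<noteq> s'" using SW T by auto
        \<comment> \<open>\<open>t\<close> lies in a class other than that of \<open>s\<close> and
          \<open>s'\<close>, and \<rho> sorts by class, so both are on the same side of
          \<open>t\<close>.\<close>
        then have "c t \<noteq> c s'" using injS[OF S(1)] s'(1) by (metis inj_on_def)
        then show "\<rho> t < \<rho> s \<longleftrightarrow> \<rho> t < \<rho> s'"
          using mono[of t s] mono[of s t] mono[of t s'] mono[of s' t] tW T s'(2)
          by (metis linorder_neqE_nat order_less_asym)
      qed
      moreover have "insert s' (insert s T) = Q" using S T by auto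
      moreover have "(S, s) \<noteq> (insert s T, s')" using T by auto
      ultimately show ?thesis using S by simp
    qed
  qed
  have "(\<Sum>S\<in>Tr. \<Sum>s\<in>W - S. sg \<rho> s S * F (insert s S)) =
      (\<Sum>z\<in>A. sg \<rho> (snd z) (fst z) * F (insert (snd z) (fst z)))"
    unfolding A_def using Tr W by (subst sum.Sigma) (auto simp: case_prod_unfold)
  also have "\<dots> = (\<Sum>Q\<in>(\<lambda>z. insert (snd z) (fst z)) ` A.
      \<Sum>z\<in>{z \<in> A. insert (snd z) (fst z) = Q}. sg \<rho> (snd z) (fst z) * F (insert (snd z) (fst z)))"
    using A by (intro sum.group[symmetric]) auto
  also have "\<dots> = 0" using fibre by simp
  finally show ?thesis by (simp add: Tr_def)
qed

lemma ex_monotone_ranking: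
  fixes c :: "'a \<Rightarrow> nat"
  assumes "finite V"
  shows "\<exists>\<rho> :: 'a \<Rightarrow> nat. inj_on \<rho> V \<and> (\<forall>y\<in>V. \<forall>y'\<in>V. c y < c y' \<longrightarrow> \<rho> y < \<rho> y')"
proof -
  obtain f :: "'a \<Rightarrow> nat" and N where f: "f ` V = {i. i < N}" "inj_on f V"
    using finite_imp_inj_to_nat_seg[OF assms] by blast
  \<comment> \<open>Lexicographic order with the class first; \<open>f y\<close> acts as the last
    digit in base \<open>N\<close>.\<close>
  define \<rho> where "\<rho> y = c y * N + f y" for y
  have fN: "f y < N" if "y \<in> V" for y using f that by blast
  have "inj_on \<rho> V"
  proof (rule inj_onI)
    fix y y' assume y: "y \<in> V" "y' \<in> V" "\<rho> y = \<rho> y'"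
    then have "(c y * N + f y) mod N = (c y' * N + f y') mod N" by (simp add: \<rho>_def)
    then have "f y = f y'" using fN y by simp
    then show "y = y'" using f(2) y by (simp add: inj_on_def)
  qed
  moreover have "\<rho> y < \<rho> y'" if "y \<in> V" "y' \<in> V" "c y < c y'" for y y'
  proof -
    have "\<rho> y < Suc (c y) * N" using fN[OF that(1)] by (simp add: \<rho>_def)
    also have "\<dots> \<le> c y' * N" using that(3) by (intro mult_right_mono) auto
    also have "\<dots> \<le> \<rho> y'" by (simp add: \<rho>_def)
    finally show ?thesis .
  qed
  ultimately show ?thesis by blast
qed

text \<open>The homological core, free of matchings. By \<open>hit\<close> a generator inside
  \<open>W\<close> swallows a whole class, which makes the functional vanish on boundaries over the
  ideal. By \<open>cover\<close> a generator survives the deletion of all chosen vertices but one,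
  which puts the Koszul boundary of \<open>X\<close> into the ideal.\<close>

lemma resolution_generator:
  fixes D :: "nat \<Rightarrow> 'b \<Rightarrow> 'b \<Rightarrow> ('a, 'k::field) mpoly" and c :: "'a \<Rightarrow> nat" and x :: "nat \<Rightarrow> 'a"
  assumes V: "finite V" "W \<subseteq> V"
    and c: "\<And>y. y \<in> W \<Longrightarrow> c y < Suc p"
    and x: "\<And>i. i < Suc p \<Longrightarrow> x i \<in> W \<and> c (x i) = i"
    and hit: "\<And>g. g \<in> G \<Longrightarrow> g \<subseteq> W \<Longrightarrow> \<exists>i<Suc p. {y \<in> W. c y = i} \<subseteq> g"
    and cover: "\<And>j. j < Suc p \<Longrightarrow> \<exists>g\<in>G. g \<subseteq> W - x ` ({..<Suc p} - {j})"
    and res: "resolves V (mon_ideal V G) B d D r"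
  shows "\<exists>b\<in>B (Suc p). d (Suc p) b = card W"
proof (rule ccontr)
  assume neg: "\<not> ?thesis"
  obtain \<rho> :: "'a \<Rightarrow> nat" where \<rho>: "inj_on \<rho> V" "\<And>y y'. y \<in> V \<Longrightarrow> y' \<in> V \<Longrightarrow> c y < c y' \<Longrightarrow> \<rho> y < \<rho> y'"
    using ex_monotone_ranking[OF V(1), of c] by blast
  define U where "U v = {v}" for v :: 'a
  have UU [simp]: "\<Union>(U ` S) = S" for S by (auto simp: U_def)
  define \<kappa> :: "'a set \<Rightarrow> 'a set \<Rightarrow> ('a, 'k) mpoly" where "\<kappa> = tay \<rho> U"
  have U: "\<And>v. v \<in> V \<Longrightarrow> finite (U v) \<and> U v \<subseteq> V" by (simp add: U_def)
  have K: "graded_exact V (cells V) (\<lambda>i S. card S) (\<lambda>i. \<kappa>)"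
    using graded_exact_tay[where U = U, OF V(1) \<rho>(1) U] by (simp add: \<kappa>_def)
  have B: "graded_exact V B d D" "B 0 = {r}" "d 0 r = 0" and im: "row_image V (B 1) (D 0 r) = mon_ideal V G"
    using res by (auto simp: resolves_def)
  have W: "finite W" using V finite_subset by blast
  define X where "X = x ` {..<Suc p}"
  have injx: "inj_on x {..<Suc p}" by (rule inj_on_inverseI[of _ c]) (use x in simp)
  have X: "X \<subseteq> W" "finite X" "card X = Suc p" using x injx by (auto simp: X_def card_image)
  have x0X: "x 0 \<in> X" by (auto simp: X_def)
  have cX: "X \<in> cells V (Suc p)" using X V by (auto simp: cells_def)
  \<comment> \<open>The coefficient of \<open>y\<close> lies outside the ideal: by
    \<open>hit\<close> every generator inside \<open>W\<close> meets \<open>X\<close>. So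
    \<open>z\<close>, the boundary of \<open>y\<close>, is a cycle over the ideal that need not
    bound there.\<close>
  define y where "y Q = (if Q = X then edge_monomial (W - X) else 0 :: ('a, 'k) mpoly)" for Q
  define z where "z S = (\<Sum>Q\<in>cells V (Suc p). \<kappa> S Q * y Q)" for S
  have zX: "z S = \<kappa> S X * edge_monomial (W - X)" for S
  proof -
    have "z S = (\<Sum>Q\<in>cells V (Suc p). if Q = X then \<kappa> S X * edge_monomial (W - X) else 0)"
      unfolding z_def by (rule sum.cong) (auto simp: y_def)
    then show ?thesis using cX V by (simp add: finite_cells)
  qed
  have z_remove: "z (X - {a}) = sg \<rho> a (X - {a}) * edge_monomial (W - (X - {a}))" if a: "a \<in> X" for a
  proof -
    have "\<kappa> (X - {a}) X = sg \<rho> a (X - {a}) * edge_monomial {a}"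
    proof -
      have "U a - \<Union>(U ` (X - {a})) = {a}" unfolding UU by (auto simp: U_def)
      moreover have nin: "a \<notin> X - {a}" by simp
      ultimately show ?thesis using tay_insert[OF nin, of \<rho> U]
        by (simp only: \<kappa>_def insert_Diff[OF a])
    qed
    moreover have "edge_monomial {a} * edge_monomial (W - X) = (edge_monomial (W - (X - {a})) :: ('a, 'k) mpoly)"
      using W X a by (subst edge_monomial_mult) (auto intro!: arg_cong[of _ _ edge_monomial])
    ultimately show ?thesis unfolding zX by (simp add: mult.assoc)
  qed
  have z_other: "z S = 0" if "\<And>a. a \<in> X \<Longrightarrow> S \<noteq> X - {a}" for S
  proof -
    have "X \<noteq> insert a S" if "a \<notin> S" for a
      using \<open>\<And>a. a \<in> X \<Longrightarrow> S \<noteq> X - {a}\<close>[of a] that by auto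
    then have "\<kappa> S X = 0" unfolding \<kappa>_def by (intro tay_eq_0) auto
    then show ?thesis by (simp add: zX)
  qed
  \<comment> \<open>A facet of \<open>X\<close> omits one vertex \<open>x j\<close>; its coefficient
    is the monomial of \<open>W\<close> without the other chosen vertices, and \<open>cover\<close>
    supplies a generator dividing it.\<close>
  have z_ideal: "z S \<in> mon_ideal V G" and z_hom: "homogeneous (int (card W) - int p) (z S)" for S
  proof -
    have "z S \<in> mon_ideal V G \<and> homogeneous (int (card W) - int p) (z S)"
    proof (cases "\<exists>a\<in>X. S = X - {a}")
      case False
      then show ?thesis using z_other[of S] by (auto simp: mon_ideal_def)
    next
      case True
      then obtain j where j: "j < Suc p" "S = X - {x j}" by (auto simp: X_def)
      have "x j \<in> X" using j by (auto simp: X_def)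
      then have zS: "z S = sg \<rho> (x j) S * edge_monomial (W - S)" using z_remove j by simp
      have "S = x ` ({..<Suc p} - {j})"
        unfolding j(2) X_def using inj_on_image_set_diff[OF injx, of "{..<Suc p}" "{j}"] j by auto
      then obtain g where g: "g \<in> G" "g \<subseteq> W - S" using cover[OF j(1)] by blast
      have ks: "Poly_Mapping.keys (z S) \<subseteq> {ind (W - S)}"
        unfolding zS using W sg_cases[of \<rho> "x j" S, where 'r = "('a, 'k) mpoly"]
        by (auto simp: edge_monomial_eq)
      have "card (W - S) = card W - p"
        using X \<open>x j \<in> X\<close> W j(2) by (subst card_Diff_subset) auto
      moreover have "p \<le> card W" using card_mono[OF W X(1)] X(3) by simp
      ultimately have "homogeneous (int (card W) - int p) (z S)"
        using ks W by (auto simp: homogeneous_def monomial_degree_ind)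
      moreover have "z S \<in> mon_ideal V G"
      proof -
        have "Poly_Mapping.keys m = W - S" if "m \<in> Poly_Mapping.keys (z S)" for m
          using ks that W by auto
        then show ?thesis using V(2) g by (auto simp: mon_ideal_def mem_PR)
      qed
      ultimately show ?thesis by blast
    qed
    then show "z S \<in> mon_ideal V G" "homogeneous (int (card W) - int p) (z S)" by blast+
  qed
  \<comment> \<open>\<open>staircase\<close> works with coordinates in the first free module of the
    resolution, so the cycle is pulled back along \<open>D 0\<close>, homogeneously.\<close>
  have "\<forall>S. \<exists>w. (\<forall>b\<in>B 1. w b \<in> PR V \<and> homogeneous (int (card W) - int p - int (d 1 b)) (w b)) \<and>
      z S = (\<Sum>b\<in>B 1. D 0 r b * w b)"
  proof
    fix S
    obtain w where w: "\<forall>b\<in>B 1. w b \<in> PR V" "z S = (\<Sum>b\<in>B 1. D 0 r b * w b)"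
      using z_ideal[of S] unfolding im[symmetric] row_image_def by auto
    have "z S = (\<Sum>b\<in>B 1. D 0 r b * hcomp (int (card W) - int p - int (d 1 b)) (w b))"
    proof (rule homogeneous_lift[where ?B1.0 = "B 0" and ?d1.0 = "d 0" and b = r and v = "\<lambda>_. z S"
            and E = "D 0" and n = "int (card W) - int p" and ?d2.0 = "d 1"])
      show "homogeneous (int (card W) - int p - int (d 0 b)) (z S)" if "b \<in> B 0" for b
        using z_hom[of S] that B(2,3) by simp
      show "z S = (\<Sum>c\<in>B 1. D 0 b c * w c)" if "b \<in> B 0" for b
        using w(2) that B(2) by simp
      show "r \<in> B 0" using B(2) by simp
      show "homogeneous (int (d 1 c) - int (d 0 b)) (D 0 b c)" if "b \<in> B 0" "c \<in> B 1" for b c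
      proof -
        have "c \<in> B (Suc 0)" using that(2) by simp
        then have "homogeneous (int (d (Suc 0) c) - int (d 0 b)) (D 0 b c)"
          using B(1) that(1) unfolding graded_exact_def by blast
        then show ?thesis by simp
      qed
    qed
    then show "\<exists>w. (\<forall>b\<in>B 1. w b \<in> PR V \<and> homogeneous (int (card W) - int p - int (d 1 b)) (w b)) \<and>
        z S = (\<Sum>b\<in>B 1. D 0 r b * w b)"
      using w(1) by (intro exI[of _ "\<lambda>b. hcomp (int (card W) - int p - int (d 1 b)) (w b)"])
        (simp add: PR_hcomp homogeneous_hcomp)
  qed
  from choice[OF this] obtain z0 where z0P: "\<And>S b. b \<in> B 1 \<Longrightarrow> z0 S b \<in> PR V"
    and z0h: "\<And>S b. b \<in> B 1 \<Longrightarrow> homogeneous (int (card W) - int p - int (d 1 b)) (z0 S b)"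
    and z0: "\<And>S. z S = (\<Sum>b\<in>B 1. D 0 r b * z0 S b)" by blast
  have "\<exists>w. (\<forall>S\<in>cells V (Suc p). \<forall>b\<in>B (Suc 0). w S b \<in> PR V) \<and>
    (\<forall>S\<in>cells V p. \<forall>a\<in>B 0. (\<Sum>b\<in>B (Suc 0). D 0 a b * z0 S b) =
       (\<Sum>S'\<in>cells V (Suc p). \<kappa> S S' * (\<Sum>b\<in>B (Suc 0). D 0 a b * w S' b)))"
  proof (rule staircase[OF K cells_0[OF V(1)] card.empty B(1), where j = "int (card W)"])
    fix f :: "('a, 'k) mpoly" assume f: "f \<in> PR V" "Poly_Mapping.lookup f 0 = 0"
    have "f \<in> mon_ideal V (U ` V)"
      unfolding mon_ideal_def
    proof (intro CollectI conjI ballI)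
      fix m assume m: "m \<in> Poly_Mapping.keys f"
      then have "m \<noteq> 0" using f(2) by (auto simp: in_keys_iff)
      then obtain v where "v \<in> Poly_Mapping.keys m" by fastforce
      moreover have "Poly_Mapping.keys m \<subseteq> V" using f(1) m by (auto simp: mem_PR)
      ultimately show "\<exists>g\<in>U ` V. g \<subseteq> Poly_Mapping.keys m" by (auto simp: U_def)
    qed (rule f)
    then have "f \<in> row_image V (cells V 1) (tay \<rho> U {})"
      using row_image_tay[where U = U, OF V(1) \<rho>(1) U] by blast
    then show "\<exists>w. (\<forall>c\<in>cells V 1. w c \<in> PR V) \<and> f = (\<Sum>c\<in>cells V 1. \<kappa> {} c * w c)"
      unfolding row_image_def \<kappa>_def by blast
  next
    fix b assume "b \<in> B (Suc 0 + p)"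
    then show "int (d (Suc 0 + p) b) \<noteq> int (card W)" using neg by auto
  next
    fix S b assume "S \<in> cells V p" "b \<in> B (Suc 0)"
    then show "z0 S b \<in> PR V" "homogeneous (int (card W) - int (card S) - int (d (Suc 0) b)) (z0 S b)"
      using z0P[of b S] z0h[of b S] by (simp_all add: cells_def)
  next
    fix p' R a assume p: "p = Suc p'" and R: "R \<in> cells V p'" and a: "a \<in> B 0"
    have "(\<Sum>S\<in>cells V p. \<kappa> R S * (\<Sum>b\<in>B (Suc 0). D 0 a b * z0 S b)) =
        (\<Sum>S\<in>cells V p. \<kappa> R S * z S)" using a B z0 by simp
    also have "\<dots> = 0" unfolding z_def p by (rule graded_exact_comp[OF K R])
    finally show "(\<Sum>S\<in>cells V p. \<kappa> R S * (\<Sum>b\<in>B (Suc 0). D 0 a b * z0 S b)) = 0" .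
  qed
  then obtain w where wP: "\<forall>S\<in>cells V (Suc p). \<forall>b\<in>B 1. w S b \<in> PR V"
    and w: "\<And>S. S \<in> cells V p \<Longrightarrow> z S = (\<Sum>Q\<in>cells V (Suc p). \<kappa> S Q * (\<Sum>b\<in>B 1. D 0 r b * w Q b))"
    using B(2) z0 by auto
  define g where "g Q = (\<Sum>b\<in>B 1. D 0 r b * w Q b)" for Q
  have g_ideal: "g Q \<in> mon_ideal V G" if "Q \<in> cells V (Suc p)" for Q
    unfolding im[symmetric] g_def row_image_def using wP that by blast
  \<comment> \<open>The part of the chain \<open>g\<close> in multidegree \<open>W\<close>; the
    functional is evaluated on its boundary.\<close>
  define F where "F Q = Poly_Mapping.lookup (g Q) (ind (W - Q))" for Q
  define Tr where "Tr = {S. S \<subseteq> W \<and> card S = p \<and> c ` S = {1..<Suc p}}"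
  have Tr: "finite Tr" using W by (auto simp: Tr_def)
  have "Poly_Mapping.lookup (z S) (ind (W - S)) = (\<Sum>s\<in>W - S. sg \<rho> s S * F (insert s S))" if S: "S \<in> Tr" for S
  proof -
    have SV: "S \<in> cells V p" and SW: "S \<subseteq> W" using S V by (auto simp: Tr_def cells_def)
    have fin: "finite (W - S)" using W by simp
    have coface: "Poly_Mapping.lookup (sg \<rho> s S * edge_monomial (U s - S) * g (insert s S)) (ind (W - S)) =
        (if s \<in> W then sg \<rho> s S * F (insert s S) else 0)" if s: "s \<in> V - S" for s
    proof -
      have Us: "U s - S = {s}" using s by (auto simp: U_def)
      have rest: "ind (W - S) - ind {s} = ind (W - insert s S)" if "s \<in> W"
      proof -
        have eq: "W - S = {s} \<union> (W - insert s S)" using that s by auto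
        have "ind ({s} \<union> (W - insert s S)) = ind {s} + ind (W - insert s S)"
          by (rule ind_union_disjoint) (use W in auto)
        then have "ind (W - S) = ind {s} + ind (W - insert s S)" by (simp only: eq)
        then show ?thesis by simp
      qed
      have keys: "{s} \<subseteq> Poly_Mapping.keys (ind (W - S)) \<longleftrightarrow> s \<in> W"
        unfolding keys_ind[OF fin] using s by blast
      have "finite {s}" by simp
      show ?thesis
        unfolding Us mult.assoc lookup_sg_times lookup_edge_monomial_times[OF \<open>finite {s}\<close>] keys F_def
        using rest by (cases "s \<in> W") (simp_all only: if_True if_False simp_thms mult_zero_right)
    qed
    have "z S = (\<Sum>Q\<in>cells V (Suc p). tay \<rho> U S Q * g Q)"
      using w[OF SV] by (simp add: g_def \<kappa>_def)
    also have "\<dots> = (\<Sum>s\<in>V - S. sg \<rho> s S * edge_monomial (U s - S) * g (insert s S))"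
      using sum_tay[OF V(1) SV, of \<rho> U g] by simp
    finally have "Poly_Mapping.lookup (z S) (ind (W - S)) =
        (\<Sum>s\<in>V - S. Poly_Mapping.lookup (sg \<rho> s S * edge_monomial (U s - S) * g (insert s S)) (ind (W - S)))"
      by (simp only: lookup_sum)
    also have "\<dots> = (\<Sum>s\<in>V - S. if s \<in> W then sg \<rho> s S * F (insert s S) else 0)"
      using coface by (rule sum.cong[OF refl])
    also have "\<dots> = (\<Sum>s\<in>W - S. sg \<rho> s S * F (insert s S))"
      by (rule sum.mono_neutral_cong_right) (use V in auto)
    finally show ?thesis .
  qed
  then have "(\<Sum>S\<in>Tr. Poly_Mapping.lookup (z S) (ind (W - S))) =
      (\<Sum>S\<in>Tr. \<Sum>s\<in>W - S. sg \<rho> s S * F (insert s S))" by simp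
  also have "\<dots> = 0"
    unfolding Tr_def
  proof (rule transversal_cancel[OF W])
    show "inj_on \<rho> W" using \<rho>(1) V(2) by (rule inj_on_subset)
    fix Q assume Q: "Q \<subseteq> W" "card Q = Suc p" "c ` Q = {..<Suc p}"
    \<comment> \<open>A nonzero coefficient would put a generator inside \<open>W - Q\<close>; it
      contains a full class by \<open>hit\<close>, yet \<open>Q\<close> meets every class.\<close>
    show "F Q = 0"
    proof (rule ccontr)
      assume "F Q \<noteq> 0"
      then have "ind (W - Q) \<in> Poly_Mapping.keys (g Q)" by (simp add: F_def in_keys_iff)
      moreover have "g Q \<in> mon_ideal V G" using Q V by (intro g_ideal) (auto simp: cells_def)
      ultimately obtain h where h: "h \<in> G" "h \<subseteq> W - Q" using W by (auto simp: mon_ideal_def)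
      then obtain i where i: "i < Suc p" "{y \<in> W. c y = i} \<subseteq> h" using hit[of h] by blast
      then have "i \<in> c ` Q" using Q(3) by simp
      then obtain q where "q \<in> Q" "c q = i" by blast
      then show False using i(2) h(2) Q(1) by blast
    qed
  qed (use \<rho>(2) V c in auto)
  finally have "(\<Sum>S\<in>Tr. Poly_Mapping.lookup (z S) (ind (W - S))) = 0" .
  \<comment> \<open>A facet of \<open>X\<close> that keeps \<open>x 0\<close> meets class 0 and is
    thus not in \<open>Tr\<close>, so a single term survives.\<close>
  moreover have "(\<Sum>S\<in>Tr. Poly_Mapping.lookup (z S) (ind (W - S))) =
      (\<Sum>S\<in>{X - {x 0}}. Poly_Mapping.lookup (z S) (ind (W - S)))"
  proof (rule sum.mono_neutral_right[OF Tr])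
    have S0: "X - {x 0} \<in> Tr"
    proof -
      have "X - {x 0} = x ` ({..<Suc p} - {0})"
        unfolding X_def using inj_on_image_set_diff[OF injx, of "{..<Suc p}" "{0}"] by auto
      also have "{..<Suc p} - {0} = {1..<Suc p}" by auto
      finally have "c ` (X - {x 0}) = (\<lambda>i. c (x i)) ` {1..<Suc p}" by (simp only: image_image)
      also have "\<dots> = {1..<Suc p}" using x by (force simp: image_iff)
      finally show ?thesis using X x0X by (auto simp: Tr_def)
    qed
    then show "{X - {x 0}} \<subseteq> Tr" by simp
    show "\<forall>S\<in>Tr - {X - {x 0}}. Poly_Mapping.lookup (z S) (ind (W - S)) = 0"
    proof
      fix S assume S: "S \<in> Tr - {X - {x 0}}"
      have "S \<noteq> X - {a}" if "a \<in> X" for a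
      proof
        assume eq: "S = X - {a}"
        then have "a \<noteq> x 0" using S by blast
        then have "x 0 \<in> S" using eq x0X by blast
        then have "c (x 0) \<in> c ` S" by blast
        then show False using S x[of 0] by (simp add: Tr_def)
      qed
      then have "z S = 0" by (rule z_other)
      then show "Poly_Mapping.lookup (z S) (ind (W - S)) = 0" by simp
    qed
  qed
  moreover have "(\<Sum>S\<in>{X - {x 0}}. Poly_Mapping.lookup (z S) (ind (W - S))) = (1 :: 'k)"
  proof -
    have "sg \<rho> (x 0) (X - {x 0}) = (1 :: ('a, 'k) mpoly)"
    proof (rule sg_min)
      fix t assume "t \<in> X - {x 0}"
      then obtain i where i: "i < Suc p" "t = x i" "i \<noteq> 0" by (auto simp: X_def)
      then have "c (x 0) < c t" using x[of i] x[of 0] by simp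
      then show "\<rho> (x 0) \<le> \<rho> t" 
        \<comment> \<open>Class 0 comes first in the ranking, so the surviving sign is 1.\<close>
        using \<rho>(2)[of "x 0" t] i x[of i] x[of 0] V(2) by (simp add: subset_iff less_imp_le)
    qed
    then have "z (X - {x 0}) = edge_monomial (W - (X - {x 0}))" using z_remove[OF x0X] by simp
    then show ?thesis using W by (simp add: edge_monomial_eq)
  qed
  ultimately show False by simp
qed

section \<open>Square-free powers as monomial ideals\<close>

lemma mpoly_ring_simps [simp]:
  "a \<oplus>\<^bsub>mpoly_ring V\<^esub> b = a + b" "a \<otimes>\<^bsub>mpoly_ring V\<^esub> b = a * b" "\<zero>\<^bsub>mpoly_ring V\<^esub> = 0" "\<one>\<^bsub>mpoly_ring V\<^esub> = 1"
  by (simp_all add: mpoly_ring_def)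

lemma ring_mpoly_ring: "ring (mpoly_ring V :: ('a, 'k::field) mpoly ring)"
  using cring_mpoly_ring by (rule cring.axioms(1))

lemma mon_ideal_add: "p \<in> mon_ideal V G \<Longrightarrow> q \<in> mon_ideal V G \<Longrightarrow> p + q \<in> mon_ideal V G"
  using Poly_Mapping.keys_add[of p q] by (auto simp: mon_ideal_def intro: PR_add)

lemma mon_ideal_mult: "p \<in> PR V \<Longrightarrow> q \<in> mon_ideal V G \<Longrightarrow> p * q \<in> mon_ideal V G"
  unfolding mon_ideal_def
proof (intro CollectI conjI ballI)
  fix m assume p: "p \<in> PR V" and q: "q \<in> {p \<in> PR V. \<forall>m\<in>Poly_Mapping.keys p. \<exists>g\<in>G. g \<subseteq> Poly_Mapping.keys m}"
    and "m \<in> Poly_Mapping.keys (p * q)"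
  then obtain a b where "a \<in> Poly_Mapping.keys p" "b \<in> Poly_Mapping.keys q" "m = a + b"
    using keys_mult[of p q] by blast
  moreover from this(2) q obtain g where "g \<in> G" "g \<subseteq> Poly_Mapping.keys b" by blast
  ultimately show "\<exists>g\<in>G. g \<subseteq> Poly_Mapping.keys m" by (auto simp: keys_add_nat)
qed (auto intro: PR_mult)

lemma ideal_mon_ideal: "ideal (mon_ideal V G) (mpoly_ring V :: ('a, 'k::field) mpoly ring)"
proof (rule idealI[OF ring_mpoly_ring])
  let ?J = "mon_ideal V G :: ('a, 'k) mpoly set"
  show "subgroup ?J (add_monoid (mpoly_ring V))"
  proof (rule group.subgroupI)
    show "Group.group (add_monoid (mpoly_ring V :: ('a, 'k) mpoly ring))"
      using ring.is_abelian_group[OF ring_mpoly_ring] by (rule abelian_group.a_group)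
    have "0 \<in> ?J" by (simp add: mon_ideal_def)
    then show "?J \<noteq> {}" by blast
    fix p assume p: "p \<in> ?J"
    then have "- p \<in> ?J" by (auto simp: mon_ideal_def PR_uminus)
    moreover have "inv\<^bsub>add_monoid (mpoly_ring V)\<^esub> p = - p"
    proof -
      have "p \<in> PR V" "- p \<in> PR V" using p by (auto simp: mon_ideal_def PR_uminus)
      then have "\<ominus>\<^bsub>mpoly_ring V\<^esub> p = - p"
        using abelian_group.minus_equality[OF ring.is_abelian_group[OF ring_mpoly_ring], where y = "- p" and x = p] by simp
      then show ?thesis by (simp add: a_inv_def)
    qed
    ultimately show "inv\<^bsub>add_monoid (mpoly_ring V)\<^esub> p \<in> ?J" by simp
  next
    show "?J \<subseteq> carrier (add_monoid (mpoly_ring V))" by (auto simp: mon_ideal_def)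
    show "p \<otimes>\<^bsub>add_monoid (mpoly_ring V)\<^esub> q \<in> ?J" if "p \<in> ?J" "q \<in> ?J" for p q
      using mon_ideal_add[OF that] by simp
  qed
next
  fix a x assume "a \<in> (mon_ideal V G :: ('a, 'k) mpoly set)" "x \<in> (PR V :: ('a, 'k) mpoly set)"
  then show "x \<otimes>\<^bsub>mpoly_ring V\<^esub> a \<in> mon_ideal V G" "a \<otimes>\<^bsub>mpoly_ring V\<^esub> x \<in> mon_ideal V G"
    using mon_ideal_mult[of x V a G] by (simp_all add: mult.commute)
qed

text \<open>Each term of a member is a generator times a term of the ring, so the member is a finite
  sum of elements of \<open>J\<close>.\<close>

lemma mon_ideal_least:
  fixes J :: "('a, 'k::field) mpoly set"
  assumes J: "ideal J (mpoly_ring V)" and V: "finite V" and G: "\<And>g. g \<in> G \<Longrightarrow> g \<subseteq> V \<and> edge_monomial g \<in> J"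
  shows "mon_ideal V G \<subseteq> J"
proof
  fix p :: "('a, 'k) mpoly" assume p: "p \<in> mon_ideal V G"
  have add: "a + b \<in> J" if "a \<in> J" "b \<in> J" for a b
    using additive_subgroup.a_closed[OF ideal.axioms(1)[OF J] that] by simp
  have "0 \<in> J" using additive_subgroup.zero_closed[OF ideal.axioms(1)[OF J]] by simp
  then have sum: "sum f A \<in> J" if "\<And>x. x \<in> A \<Longrightarrow> f x \<in> J" for f and A :: "('a \<Rightarrow>\<^sub>0 nat) set"
    using that by (induction A rule: infinite_finite_induct) (auto intro: add)
  have "Poly_Mapping.single m (Poly_Mapping.lookup p m) \<in> J" if m: "m \<in> Poly_Mapping.keys p" for m
  proof -
    obtain g where g: "g \<in> G" "g \<subseteq> Poly_Mapping.keys m" using p m by (auto simp: mon_ideal_def)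
    have fin: "finite g" using G[OF g(1)] V finite_subset by blast
    let ?q = "Poly_Mapping.single (m - ind g) (Poly_Mapping.lookup p m) :: ('a, 'k) mpoly"
    have "Poly_Mapping.keys m \<subseteq> V" using p m by (auto simp: mon_ideal_def mem_PR)
    moreover have "Poly_Mapping.keys (m - ind g) \<subseteq> Poly_Mapping.keys m"
      by (auto simp: in_keys_iff lookup_minus)
    ultimately have "?q \<in> PR V" by (auto simp: mem_PR)
    then have "?q * edge_monomial g \<in> J"
      using ideal.I_l_closed[OF J, of "edge_monomial g" ?q] G[OF g(1)] by simp
    moreover have "?q * edge_monomial g = Poly_Mapping.single m (Poly_Mapping.lookup p m)"
      using ind_add_diff[OF fin g(2)] by (simp add: edge_monomial_eq[OF fin] mult_single add.commute)
    ultimately show ?thesis by simp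
  qed
  then show "p \<in> J" by (subst poly_mapping_expand) (rule sum)
qed

section \<open>Powers of the edge ideal and matchings\<close>

context
  fixes H :: "'a hypergraph"
  assumes H: "simple_hypergraph H"
begin

lemma finite_hverts: "finite (hverts H)" and hedges_subset: "e \<in> hedges H \<Longrightarrow> e \<subseteq> hverts H"
  and hedges_nonempty: "e \<in> hedges H \<Longrightarrow> e \<noteq> {}"
  using H by (auto simp: simple_hypergraph_def)

lemma finite_hedges: "finite (hedges H)"
  by (rule finite_subset[of _ "Pow (hverts H)"]) (use finite_hverts hedges_subset in auto)

lemma finite_edge: "e \<in> hedges H \<Longrightarrow> finite e"
  using finite_hverts hedges_subset finite_subset by blast

lemma edge_monomials_PR: "edge_monomial ` hedges H \<subseteq> (PR (hverts H) :: ('a, 'k::field) mpoly set)"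
proof (rule image_subsetI)
  fix e assume "e \<in> hedges H"
  then show "(edge_monomial e :: ('a, 'k) mpoly) \<in> PR (hverts H)"
    by (intro edge_monomial_PR finite_edge hedges_subset)
qed

lemma edge_ideal_is_ideal: "ideal (edge_ideal H :: ('a, 'k::field) mpoly set) (mpoly_ring (hverts H))"
  unfolding edge_ideal_def
  by (rule ring.genideal_ideal[OF ring_mpoly_ring edge_monomials_PR])

lemma edge_monomial_mem: "e \<in> hedges H \<Longrightarrow> edge_monomial e \<in> (edge_ideal H :: ('a, 'k::field) mpoly set)"
  using ring.genideal_self[OF ring_mpoly_ring edge_monomials_PR] unfolding edge_ideal_def by blast

lemma edge_ideal_subset: "(edge_ideal H :: ('a, 'k::field) mpoly set) \<subseteq> mon_ideal (hverts H) (hedges H)"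
  unfolding edge_ideal_def
proof (rule ring.genideal_minimal[OF ring_mpoly_ring ideal_mon_ideal], rule image_subsetI)
  fix e assume e: "e \<in> hedges H"
  then show "(edge_monomial e :: ('a, 'k) mpoly) \<in> mon_ideal (hverts H) (hedges H)"
    using edge_monomial_PR[OF finite_edge[OF e] hedges_subset[OF e]] finite_edge[OF e]
    by (auto simp: mon_ideal_def edge_monomial_eq intro!: bexI[of _ e])
qed

abbreviation edge_ideal_power :: "nat \<Rightarrow> ('a, 'k::field) mpoly set" where
  "edge_ideal_power k \<equiv> edge_ideal H [^]\<^bsub>ideals_set (mpoly_ring (hverts H))\<^esub> k"

lemma edge_ideal_power_0: "(edge_ideal_power 0 :: ('a, 'k::field) mpoly set) = PR (hverts H)"
  by (simp add: nat_pow_def ideals_set_def)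

lemma edge_ideal_power_Suc:
  "(edge_ideal_power (Suc k) :: ('a, 'k::field) mpoly set) =
     ideal_prod (mpoly_ring (hverts H)) (edge_ideal_power k) (edge_ideal H)"
  by (simp add: nat_pow_def ideals_set_def)

text \<open>The edges form a list because a power allows repeated factors. Each passage to the next
  power contributes one edge, dividing the term of the factor from the edge ideal.\<close>

lemma keys_edge_ideal_power:
  assumes "p \<in> (edge_ideal_power k :: ('a, 'k::field) mpoly set)" "m \<in> Poly_Mapping.keys p"
  shows "\<exists>es m'. set es \<subseteq> hedges H \<and> length es = k \<and> m = sum_list (map ind es) + m'"
  using assms
proof (induction k arbitrary: p m)
  case 0
  then show ?case by simp
next
  case (Suc k)
  from Suc.prems show ?case
    unfolding edge_ideal_power_Suc
  proof (induction p arbitrary: m rule: ideal_prod.induct)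
    case (prod i j)
    then obtain a b where ab: "a \<in> Poly_Mapping.keys i" "b \<in> Poly_Mapping.keys j" "m = a + b"
      using keys_mult[of i j] by auto
    obtain es m1 where es: "set es \<subseteq> hedges H" "length es = k" "a = sum_list (map ind es) + m1"
      using Suc.IH[OF prod(1) ab(1)] by blast
    obtain e where e: "e \<in> hedges H" "e \<subseteq> Poly_Mapping.keys b"
      using subsetD[OF edge_ideal_subset prod(2)] ab(2) by (auto simp: mon_ideal_def)
    have b: "b = ind e + (b - ind e)" using ind_add_diff[OF finite_edge[OF e(1)] e(2)] by simp
    have "m = sum_list (map ind (e # es)) + (m1 + (b - ind e))"
      unfolding ab(3) es(3) by (subst b) (simp add: ac_simps)
    then show ?case using es e(1) by (intro exI[of _ "e # es"] exI[of _ "m1 + (b - ind e)"]) simp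
  next
    case (sum s1 s2)
    then show ?case using Poly_Mapping.keys_add[of s1 s2] by auto
  qed
qed

lemma prod_edge_monomial_mem_power:
  "finite N \<Longrightarrow> N \<subseteq> hedges H \<Longrightarrow>
     (\<Prod>e\<in>N. edge_monomial e) \<in> (edge_ideal_power (card N) :: ('a, 'k::field) mpoly set)"
proof (induction N rule: finite_induct)
  case empty
  show ?case unfolding card.empty edge_ideal_power_0 by simp
next
  case (insert e N)
  then have "(\<Prod>e\<in>N. edge_monomial e) * edge_monomial e \<in>
      ideal_prod (mpoly_ring (hverts H)) (edge_ideal_power (card N)) (edge_ideal H :: ('a, 'k) mpoly set)"
    using ideal_prod.prod[of "(\<Prod>e\<in>N. edge_monomial e) :: ('a, 'k) mpoly" "edge_ideal_power (card N)"
        "edge_monomial e" "edge_ideal H" "mpoly_ring (hverts H)"] edge_monomial_mem[of e, where 'k = 'k] by simp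
  then show ?case using insert unfolding card_insert_disjoint[OF insert(1,2)] edge_ideal_power_Suc
    by (simp add: mult.commute)
qed

lemma edge_monomial_Union:
  "finite N \<Longrightarrow> disjoint N \<Longrightarrow> N \<subseteq> hedges H \<Longrightarrow>
     edge_monomial (\<Union>N) = (\<Prod>e\<in>N. edge_monomial e)"
proof (induction N rule: finite_induct)
  case (insert e N)
  have "e \<inter> y = {}" if "y \<in> N" for y
    using disjointD[OF insert.prems(1), of e y] insert.hyps(2) that by auto
  then have "e \<inter> \<Union>N = {}" by blast
  moreover have "disjoint N" using insert.prems(1) by (simp add: pairwise_insert)
  moreover have "finite e" "finite (\<Union>N)" using insert finite_edge by auto
  ultimately show ?case using insert by (simp add: edge_monomial_mult[symmetric])
qed simp

text \<open>A vertex shared by two listed edges would get exponent at least 2. Since edges are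
  nonempty, this also excludes repetitions, so the length of the list is the size of the
  matching.\<close>

lemma squarefree_edges_matching:
  assumes "set es \<subseteq> hedges H" "\<And>x. Poly_Mapping.lookup (sum_list (map ind es)) x \<le> 1"
  shows "matching H (set es) \<and> card (set es) = length es \<and> Poly_Mapping.keys (sum_list (map ind es)) = \<Union>(set es)"
  using assms
proof (induction es)
  case Nil
  then show ?case by (simp add: matching_def disjoint_def)
next
  case (Cons e es)
  have fin: "finite e" and ne: "e \<noteq> {}" using Cons.prems(1) finite_edge hedges_nonempty by auto
  have le: "Poly_Mapping.lookup (ind e) x + Poly_Mapping.lookup (sum_list (map ind es)) x \<le> 1" for x
    using Cons.prems(2)[of x] by (simp add: lookup_add)
  have "Poly_Mapping.lookup (sum_list (map ind es)) x \<le> 1" for x using le[of x] by simp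
  then have IH: "matching H (set es)" "card (set es) = length es"
    "Poly_Mapping.keys (sum_list (map ind es)) = \<Union>(set es)"
    using Cons.IH Cons.prems(1) by auto
  have dis: "e \<inter> \<Union>(set es) = {}"
  proof (rule ccontr)
    assume "e \<inter> \<Union>(set es) \<noteq> {}"
    then obtain x where "x \<in> e" "x \<in> Poly_Mapping.keys (sum_list (map ind es))" using IH(3) by auto
    then show False using le[of x] fin by (simp add: lookup_ind in_keys_iff)
  qed
  then have "e \<notin> set es" using ne by auto
  moreover have "disjoint (insert e (set es))"
  proof -
    have "disjnt e y" "disjnt y e" if "y \<in> set es" for y using dis that by (auto simp: disjnt_def)
    then show ?thesis using IH(1) by (simp add: matching_def pairwise_insert)
  qed
  ultimately show ?case using IH Cons.prems(1) fin by (simp add: matching_def keys_add_nat)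
qed

text \<open>A divisor of a square-free monomial is square-free, so the \<open>k\<close> edges
  dividing a square-free element of the power form a matching. Conversely the edge monomials of a
  matching multiply to the square-free monomial of its vertex set.\<close>

lemma squarefree_power_eq:
  "squarefree_power (hverts H) (edge_ideal H) k =
     (mon_ideal (hverts H) {\<Union>N | N. matching H N \<and> card N = k} :: ('a, 'k::field) mpoly set)"
    (is "?S = mon_ideal ?V ?G")
proof
  have sub: "squarefree_monomials \<inter> edge_ideal_power k \<subseteq> (mon_ideal ?V ?G :: ('a, 'k) mpoly set)"
  proof
    fix p :: "('a, 'k) mpoly" assume p: "p \<in> squarefree_monomials \<inter> edge_ideal_power k"
    then obtain m where m: "p = Poly_Mapping.single m 1" "\<And>x. Poly_Mapping.lookup m x \<le> 1"
      by (auto simp: squarefree_monomials_def)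
    obtain es m' where es: "set es \<subseteq> hedges H" "length es = k" "m = sum_list (map ind es) + m'"
      using keys_edge_ideal_power[of p k m] p m(1) by auto
    have "Poly_Mapping.lookup (sum_list (map ind es)) x \<le> 1" for x
      using m(2)[of x] unfolding es(3) lookup_add by linarith
    note match = squarefree_edges_matching[OF es(1) this]
    \<comment> \<open>\<open>squarefree_monomials\<close> ranges over all variables; membership in
      an ideal of the ring confines \<open>p\<close> to those in \<open>hverts H\<close>.\<close>
    have "ideal (edge_ideal_power k) (mpoly_ring ?V :: ('a, 'k) mpoly ring)"
    proof -
      have carr: "carrier (ideals_set R) = {I. ideal I R}" for R :: "('a, 'k) mpoly ring"
        by (simp add: ideals_set_def)
      have "(edge_ideal H :: ('a, 'k) mpoly set) \<in> carrier (ideals_set (mpoly_ring ?V))"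
        unfolding carr using edge_ideal_is_ideal by simp
      from monoid.nat_pow_closed[OF comm_monoid.axioms(1)[OF
          cring.ideals_set_is_comm_monoid[OF cring_mpoly_ring]] this, of k]
      show ?thesis unfolding carr by simp
    qed
    from ideal.Icarr[OF this, of p] have "p \<in> PR ?V" using p by blast
    moreover have "\<Union>(set es) \<subseteq> Poly_Mapping.keys m"
      unfolding es(3) keys_add_nat conjunct2[OF conjunct2[OF match]] by (rule Un_upper1)
    ultimately show "p \<in> mon_ideal ?V ?G"
      using match es(2) by (auto simp: mon_ideal_def m(1) intro!: exI[of _ "\<Union>(set es)"] exI[of _ "set es"])
  qed
  show "?S \<subseteq> (mon_ideal ?V ?G :: ('a, 'k) mpoly set)"
    unfolding squarefree_power_def by (rule ring.genideal_minimal[OF ring_mpoly_ring ideal_mon_ideal sub])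
  have carr: "squarefree_monomials \<inter> edge_ideal_power k \<subseteq> (PR ?V :: ('a, 'k) mpoly set)"
    using sub by (auto simp: mon_ideal_def)
  show "(mon_ideal ?V ?G :: ('a, 'k) mpoly set) \<subseteq> ?S"
  proof (rule mon_ideal_least[OF _ finite_hverts])
    show "ideal ?S (mpoly_ring ?V :: ('a, 'k) mpoly ring)"
      unfolding squarefree_power_def by (rule ring.genideal_ideal[OF ring_mpoly_ring carr])
    fix g assume "g \<in> ?G"
    then obtain N where N: "g = \<Union>N" "matching H N" "card N = k" by blast
    have NH: "N \<subseteq> hedges H" "disjoint N" using N(2) by (simp_all add: matching_def)
    have fin: "finite N" using NH(1) finite_hedges finite_subset by blast
    have g: "g \<subseteq> ?V" using N(1) NH hedges_subset by blast
    then have "finite g" using finite_hverts finite_subset by blast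
    then have "edge_monomial g \<in> (squarefree_monomials :: ('a, 'k) mpoly set)"
      by (auto simp: squarefree_monomials_def edge_monomial_eq lookup_ind intro!: exI[of _ "ind g"])
    moreover have "edge_monomial g \<in> (edge_ideal_power k :: ('a, 'k) mpoly set)"
      using prod_edge_monomial_mem_power[OF fin NH(1), where 'k = 'k]
      unfolding N(1) edge_monomial_Union[OF fin NH(2,1)] N(3) .
    ultimately have "edge_monomial g \<in> ?S"
      using ring.genideal_self[OF ring_mpoly_ring carr] unfolding squarefree_power_def by blast
    then show "g \<subseteq> ?V \<and> edge_monomial g \<in> ?S" using g by blast
  qed
qed

end

text \<open>Finite length and finite degree lists bound the set under \<open>Max\<close>, which is
  thus an actual maximum. The resolution behind it is selected by choice, hence \<open>gen\<close>
  quantifies over all of them.\<close>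

lemma regularity_ge:
  fixes J :: "('a, 'k::field) mpoly set"
  assumes J: "J \<noteq> {0}" and ex: "\<exists>s A. minimal_graded_free_resolution V J s A"
    and gen: "\<And>s A. minimal_graded_free_resolution V J s A \<Longrightarrow> j \<in> set (s i)"
  shows "regularity V J \<ge> int j - int i"
proof -
  define s where "s = (SOME s. \<exists>A. minimal_graded_free_resolution V J s A)"
  have "\<exists>A. minimal_graded_free_resolution V J s A"
    unfolding s_def by (rule someI_ex[OF ex])
  then obtain A where A: "minimal_graded_free_resolution V J s A" by blast
  have betti: "graded_betti V J i j \<noteq> 0 \<longleftrightarrow> j \<in> set (s i)" for i j
    by (simp add: graded_betti_def count_list_0_iff flip: s_def)
  obtain p where p: "\<forall>i>p. s i = []" using A by (auto simp: minimal_graded_free_resolution_def)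
  let ?X = "{int j - int i | i j. graded_betti V J i j \<noteq> 0}"
  have "?X \<subseteq> (\<Union>i\<in>{..p}. (\<lambda>j. int j - int i) ` set (s i))"
  proof
    fix x assume "x \<in> ?X"
    then obtain i j where ij: "x = int j - int i" "j \<in> set (s i)" using betti by blast
    then have "i \<le> p" using p by (metis empty_iff list.set(1) not_le_imp_less)
    then show "x \<in> (\<Union>i\<in>{..p}. (\<lambda>j. int j - int i) ` set (s i))" using ij by blast
  qed
  then have "finite ?X" by (rule finite_subset) simp
  moreover have "int j - int i \<in> ?X" using gen[OF A] betti by blast
  ultimately have "int j - int i \<le> Max ?X" by (rule Max_ge)
  then show ?thesis using J by (simp add: regularity_def)
qed

section \<open>Admissible matchings\<close>

lemma matching_inter:
  "matching H N \<Longrightarrow> e \<in> N \<Longrightarrow> e' \<in> N \<Longrightarrow> y \<in> e \<Longrightarrow> y \<in> e' \<Longrightarrow> e = e'"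
  unfolding matching_def by (metis disjointD disjoint_iff)

lemma matching_subset: "matching H N \<Longrightarrow> N' \<subseteq> N \<Longrightarrow> matching H N'"
  unfolding matching_def by (meson order_trans pairwise_subset)

context
  fixes H :: "'a hypergraph"
  assumes H: "simple_hypergraph H"
begin

lemma matching_finite: "matching H N \<Longrightarrow> finite N"
  using finite_hedges[OF H] finite_subset by (auto simp: matching_def)

lemma matching_Union_subset: "matching H N \<Longrightarrow> \<Union>N \<subseteq> hverts H"
  using hedges_subset[OF H] by (auto simp: matching_def)

text \<open>If every matching of size \<open>|N|\<close> inside \<open>V(N)\<close> is perfect, then \<open>|N|\<close> is the matching number
  of \<open>H[V(N)]\<close> and every vertex of \<open>V(N)\<close> is critical: a matching that misses one loses an edge.\<close>

lemma card_restricted_matching: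
  assumes N: "matching H N" "N \<noteq> {}"
    and perfect: "\<And>N'. matching (induced H (\<Union>N)) N' \<Longrightarrow> card N' = card N \<Longrightarrow> \<Union>N' = \<Union>N"
    and Q: "matching H Q"
  shows "card {e \<in> Q. e \<subseteq> \<Union>N} + (if \<Union>N \<subseteq> \<Union>Q then 0 else 1) \<le> card N"
proof -
  define Q' where "Q' = {e \<in> Q. e \<subseteq> \<Union>N}"
  have fin: "finite Q'" using matching_finite[OF Q] by (simp add: Q'_def)
  have sub: "\<Union>T = \<Union>N" if "T \<subseteq> Q'" "card T = card N" for T
  proof (rule perfect[OF _ that(2)])
    have "matching H T" using matching_subset[OF Q, of T] that(1) by (auto simp: Q'_def)
    then show "matching (induced H (\<Union>N)) T" using that(1) by (auto simp: matching_def induced_def Q'_def)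
  qed
  have "card Q' \<le> card N"
  proof (rule ccontr)
    assume "\<not> card Q' \<le> card N"
    \<comment> \<open>A proper subset of size \<open>card N\<close> would already cover all of
      \<open>V(N)\<close>, leaving no room for a further nonempty edge disjoint from it.\<close>
    then obtain T where T: "T \<subseteq> Q'" "card T = card N"
      using obtain_subset_with_card_n[of "card N" Q'] by auto
    then have "T \<noteq> Q'" using \<open>\<not> card Q' \<le> card N\<close> by auto
    then obtain e where e: "e \<in> Q'" "e \<notin> T" using T by blast
    have eQ: "e \<in> Q" "e \<subseteq> \<Union>N" using e(1) by (auto simp: Q'_def)
    then obtain y where y: "y \<in> e" using hedges_nonempty[OF H, of e] Q by (auto simp: matching_def)
    then have "y \<in> \<Union>T" using sub[OF T] eQ by blast
    then obtain e' where e': "e' \<in> T" "y \<in> e'" by blast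
    then have "e' \<in> Q" using T by (auto simp: Q'_def)
    then have "e = e'" using matching_inter[OF Q eQ(1)] y e' by blast
    then show False using e e' by blast
  qed
  moreover have "\<Union>N \<subseteq> \<Union>Q" if "card Q' = card N"
  proof -
    have "\<Union>Q' = \<Union>N" using sub that by blast
    then show ?thesis by (auto simp: Q'_def)
  qed
  ultimately have "card Q' + (if \<Union>N \<subseteq> \<Union>Q then 0 else 1) \<le> card N" by fastforce
  then show ?thesis by (simp add: Q'_def)
qed

lemma regularity_admissible:
  assumes adm: "gen_admissible_matching H k M"
  shows "regularity (hverts H) (squarefree_power (hverts H) (edge_ideal H :: ('a, 'k::field) mpoly set) k)
    \<ge> int (card (\<Union>M)) - int (card M) + int k"
proof -
  have k: "1 \<le> k" and M: "matching H M" using adm by (simp_all add: gen_admissible_matching_def)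
  obtain P where P: "partition_on M P"
    and edges: "\<forall>e\<in>hedges (induced H (\<Union>M)). \<exists>N\<in>P. e \<in> hedges (induced H (\<Union>N))"
    and card: "k \<le> card M" "card M \<le> card P + k - 1"
    and perf: "\<forall>N\<in>P. \<forall>N'. matching (induced H (\<Union>N)) N' \<and> card N' = card N \<longrightarrow> \<Union>N' = \<Union>N"
    using adm unfolding gen_admissible_matching_def by (elim conjE exE) (rule that)
  have perfect: "\<Union>N' = \<Union>N" if "N \<in> P" "matching (induced H (\<Union>N)) N'" "card N' = card N" for N N'
    using perf that by blast
  let ?V = "hverts H"
  let ?G = "{\<Union>N | N. matching H N \<and> card N = k}"
  define W where "W = \<Union>M"
  define J :: "('a, 'k) mpoly set" where "J = squarefree_power ?V (edge_ideal H) k"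
  have J: "J = mon_ideal ?V ?G" unfolding J_def by (rule squarefree_power_eq[OF H])
  have finM: "finite M" using matching_finite[OF M] .
  have WV: "W \<subseteq> ?V" unfolding W_def by (rule matching_Union_subset[OF M])
  have finP: "finite P" using P finM by (rule finite_elements[rotated])
  define R where "R = card P"
  obtain f where f: "bij_betw f {..<R} P"
    using ex_bij_betw_nat_finite[OF finP] by (auto simp: R_def atLeast0LessThan)
  \<comment> \<open>One less than the number of classes; \<open>card M \<le> card P + k - 1\<close>
    provides at least \<open>p + 1\<close> parts.\<close>
  define p where "p = card M - k"
  have pR: "Suc p \<le> R" using card k by (simp add: p_def R_def)
  have fP: "f i \<in> P" if "i < R" for i using f that by (auto simp: bij_betw_def)
  have fM: "f i \<subseteq> M" "f i \<noteq> {}" if "i < R" for i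
    using partition_onD1[OF P] partition_onD3[OF P] fP[OF that] by auto
  have f_eq: "i = j" if "i < R" "j < R" "e \<in> f i" "e \<in> f j" for i j e
  proof -
    have "f i = f j" using partition_onD2[OF P] fP that by (metis disjointD disjoint_iff)
    then show ?thesis using f that by (auto simp: bij_betw_def inj_on_def)
  qed
  have l_unique: "i = j" if ij: "i < R" "j < R" "y \<in> \<Union>(f i)" "y \<in> \<Union>(f j)" for i j y
  proof -
    obtain e e' where "e \<in> f i" "y \<in> e" "e' \<in> f j" "y \<in> e'" using ij by blast
    moreover from this have "e = e'" using matching_inter[OF M, of e e' y] fM ij by blast
    ultimately show ?thesis using f_eq ij by blast
  qed
  have l_ex: "\<exists>i<R. y \<in> \<Union>(f i)" if yW: "y \<in> W" for y
  proof -
    obtain e where "e \<in> M" "y \<in> e" using yW by (auto simp: W_def)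
    moreover from this obtain N where "N \<in> P" "e \<in> N" using partition_onD1[OF P] by blast
    moreover from this obtain i where "i < R" "f i = N" using f by (auto simp: bij_betw_def)
    ultimately show ?thesis by blast
  qed
  define l where "l y = (THE i. i < R \<and> y \<in> \<Union>(f i))" for y
  have l: "l y = i" if "i < R" "y \<in> \<Union>(f i)" for y i
    unfolding l_def using that l_unique by (intro the_equality) blast+
  \<comment> \<open>Parts numbered \<open>p\<close> or higher are merged into the last class, which
    leaves exactly \<open>p + 1\<close> classes.\<close>
  define c where "c y = min (l y) p" for y
  have "\<forall>i. \<exists>e y. i < R \<longrightarrow> e \<in> f i \<and> y \<in> e"
    using fM M hedges_nonempty[OF H] by (metis matching_def ex_in_conv subsetD)
  then obtain e x where ex: "\<And>i. i < R \<Longrightarrow> e i \<in> f i" "\<And>i. i < R \<Longrightarrow> x i \<in> e i" by metis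
  have eM: "e i \<in> M" if "i < R" for i using ex fM that by blast
  have gen: "\<exists>b\<in>B (Suc p). d (Suc p) b = card W"
    if "resolves ?V (mon_ideal ?V ?G) B d D r" for B d r and D :: "nat \<Rightarrow> nat \<Rightarrow> nat \<Rightarrow> ('a, 'k) mpoly"
  proof (rule resolution_generator[OF finite_hverts[OF H] WV _ _ _ _ that])
    show "c y < Suc p" for y by (simp add: c_def)
    show "x i \<in> W \<and> c (x i) = i" if "i < Suc p" for i
    proof -
      have iR: "i < R" using that pR by simp
      then have "l (x i) = i" using l ex by blast
      moreover have "x i \<in> W" using ex eM iR by (auto simp: W_def)
      ultimately show ?thesis using that by (simp add: c_def)
    qed
    show "\<exists>i<Suc p. {y \<in> W. c y = i} \<subseteq> g" if g: "g \<in> ?G" "g \<subseteq> W" for g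
    proof (rule ccontr)
      assume no: "\<not> ?thesis"
      obtain N where N: "g = \<Union>N" "matching H N" "card N = k" using g(1) by blast
      \<comment> \<open>The parts with a vertex missed by \<open>N\<close>. If \<open>g\<close>
        contains no full class, every class includes such a part, so there are at least
        \<open>p + 1\<close> of them.\<close>
      define Bad where "Bad = {i \<in> {..<R}. \<not> \<Union>(f i) \<subseteq> \<Union>N}"
      have bad: "\<exists>y\<in>W. c y = i \<and> l y \<in> Bad" if i: "i < Suc p" for i
      proof -
        obtain y where y: "y \<in> W" "c y = i" "y \<notin> g" using no i by blast
        obtain i' where i': "i' < R" "y \<in> \<Union>(f i')" using l_ex[OF y(1)] by blast
        then have "l y = i'" by (rule l)
        then have "l y \<in> Bad" using i' y(3) N(1) by (auto simp: Bad_def)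
        then show ?thesis using y by blast
      qed
      have "{..<Suc p} \<subseteq> (\<lambda>i. min i p) ` Bad"
      proof
        fix i assume "i \<in> {..<Suc p}"
        then obtain y where "c y = i" "l y \<in> Bad" using bad by blast
        then show "i \<in> (\<lambda>i. min i p) ` Bad" unfolding c_def by blast
      qed
      moreover have finBad: "finite Bad" by (simp add: Bad_def)
      ultimately have "Suc p \<le> card Bad" using surj_card_le[of Bad "{..<Suc p}"] by simp
      define Ni where "Ni i = {e \<in> N. e \<subseteq> \<Union>(f i)}" for i
      \<comment> \<open>Condition (1) enters: no edge of \<open>H\<close> inside \<open>W\<close>
        crosses between parts, so \<open>N\<close> can be counted part by part.\<close>
      have "N \<subseteq> (\<Union>i<R. Ni i)"
      proof
        fix e' assume e': "e' \<in> N"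
        then have "e' \<in> hedges (induced H (\<Union>M))"
          using N g(2) by (auto simp: induced_def matching_def W_def)
        then obtain Q where "Q \<in> P" "e' \<subseteq> \<Union>Q" using edges by (auto simp: induced_def)
        moreover from this obtain i where "i < R" "f i = Q" using f by (auto simp: bij_betw_def)
        ultimately show "e' \<in> (\<Union>i<R. Ni i)" using e' by (auto simp: Ni_def)
      qed
      moreover have "finite (\<Union>i<R. Ni i)" using matching_finite[OF N(2)] by (simp add: Ni_def)
      ultimately have "k \<le> card (\<Union>i<R. Ni i)" using N(3) card_mono by metis
      also have "\<dots> \<le> (\<Sum>i<R. card (Ni i))" by (rule card_UN_le) simp
      finally have kN: "k \<le> (\<Sum>i<R. card (Ni i))" .
      \<comment> \<open>A bad part hosts at least one edge of \<open>N\<close> fewer than it has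
        edges of \<open>M\<close>. Summed over the parts this gives
        \<open>k + card Bad \<le> card M\<close>, against \<open>card M = k + p\<close>.\<close>
      have "k + card Bad \<le> (\<Sum>i<R. card (Ni i)) + (\<Sum>i<R. if \<Union>(f i) \<subseteq> \<Union>N then 0 else 1)"
      proof -
        have "card Bad = (\<Sum>i<R. if \<Union>(f i) \<subseteq> \<Union>N then 0 else 1)"
          unfolding Bad_def by (subst card_eq_sum, subst sum.inter_filter) (auto intro!: sum.cong)
        then show ?thesis using kN by simp
      qed
      also have "\<dots> = (\<Sum>i<R. card (Ni i) + (if \<Union>(f i) \<subseteq> \<Union>N then 0 else 1))"
        by (simp add: sum.distrib)
      also have "\<dots> \<le> (\<Sum>i<R. card (f i))"
      proof (rule sum_mono)
        fix i assume "i \<in> {..<R}"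
        then have i: "i < R" by simp
        show "card (Ni i) + (if \<Union>(f i) \<subseteq> \<Union>N then 0 else 1) \<le> card (f i)"
          unfolding Ni_def
          by (rule card_restricted_matching[OF matching_subset[OF M fM(1)[OF i]] fM(2)[OF i] perfect[OF fP[OF i]] N(2)])
      qed
      also have "\<dots> = (\<Sum>Q\<in>P. card Q)" by (rule sum.reindex_bij_betw[OF f])
      also have "\<dots> = card M"
        using card_Union_disjoint[of P] partition_onD1[OF P] partition_onD2[OF P] finM
        by (metis Union_upper finite_subset)
      finally show False using \<open>Suc p \<le> card Bad\<close> card k by (simp add: p_def)
    qed
    show "\<exists>g\<in>?G. g \<subseteq> W - x ` ({..<Suc p} - {j})" if j: "j < Suc p" for j
    proof -
      let ?K = "{..<Suc p} - {j}"
      \<comment> \<open>Removing the \<open>p\<close> edges through the other chosen vertices leaves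
        \<open>k\<close> edges, which avoid those vertices because \<open>M\<close> is a
        matching.\<close>
      define N where "N = M - e ` ?K"
      have "inj_on e ?K"
        using ex f_eq pR by (intro inj_onI) (metis DiffD1 lessThan_iff order_less_le_trans)
      then have "card (e ` ?K) = p" using j by (simp add: card_image)
      moreover have "e ` ?K \<subseteq> M" using eM pR by auto
      ultimately have "card N = k" unfolding N_def using finM card
        by (subst card_Diff_subset) (auto simp: p_def)
      moreover have "matching H N" using matching_subset[OF M] by (simp add: N_def)
      moreover have "\<Union>N \<subseteq> W - x ` ?K"
      proof
        fix y assume "y \<in> \<Union>N"
        then obtain e' where e': "e' \<in> M" "e' \<notin> e ` ?K" "y \<in> e'" by (auto simp: N_def)
        have "y \<noteq> x i" if "i \<in> ?K" for i
        proof
          assume "y = x i"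
          moreover have "i < R" using that pR by auto
          ultimately have "e' = e i" using matching_inter[OF M e'(1) eM e'(3)] ex by blast
          then show False using e'(2) that by blast
        qed
        then show "y \<in> W - x ` ?K" using e' by (auto simp: W_def)
      qed
      ultimately show ?thesis by blast
    qed
  qed
  have ex: "\<exists>s A. minimal_graded_free_resolution ?V J s A"
  proof -
    have "g \<subseteq> ?V" if "g \<in> ?G" for g using that matching_Union_subset by blast
    from ex_min_resolution[OF finite_hverts[OF H] this]
    obtain B d r and D :: "nat \<Rightarrow> 'a set set \<Rightarrow> 'a set set \<Rightarrow> ('a, 'k) mpoly"
      where "resolves ?V (mon_ideal ?V ?G) B d D r" "min_entries B D" by blast
    then show ?thesis unfolding J by (rule ex_minimal_graded_free_resolution)
  qed
  have "J \<noteq> {0}"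
  proof -
    obtain N where N: "N \<subseteq> M" "card N = k" using obtain_subset_with_card_n[OF card(1)] by blast
    have NH: "matching H N" by (rule matching_subset[OF M N(1)])
    have "finite (\<Union>N)" "\<Union>N \<subseteq> ?V"
      using matching_Union_subset[OF NH] finite_hverts[OF H] by (auto intro: finite_subset)
    then have "Poly_Mapping.single (ind (\<Union>N)) 1 \<in> J"
      unfolding J mon_ideal_def using NH N(2) by (auto simp: mem_PR)
    moreover have "Poly_Mapping.single (ind (\<Union>N)) (1 :: 'k) \<noteq> 0"
      by (metis lookup_single_eq lookup_zero zero_neq_one)
    ultimately show ?thesis by blast
  qed
  moreover have "card W \<in> set (s p)" if "minimal_graded_free_resolution ?V J s A" for s A
  proof -
    \<comment> \<open>\<open>shifted s (Suc p)\<close> is \<open>s p\<close>: position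
      \<open>p + 1\<close> with the ring prepended is homological degree \<open>p\<close> of the
      ideal.\<close>
    have "\<exists>b\<in>{..<length (shifted s (Suc p))}. shifted s (Suc p) ! b = card W"
      using gen[OF resolves_of_minimal[OF that[unfolded J]]] .
    then show ?thesis by (auto simp: in_set_conv_nth)
  qed
  ultimately have "regularity ?V J \<ge> int (card W) - int p" using ex by (intro regularity_ge)
  then show ?thesis using card by (simp add: J_def W_def p_def of_nat_diff)
qed

lemma finite_matchings: "finite {M. matching H M}"
  by (rule finite_subset[of _ "Pow (hedges H)"]) (auto simp: matching_def finite_hedges[OF H])

text \<open>A \<open>k\<close>-matching with the fewest covered vertices is generalized \<open>k\<close>-admissible with a single
  part.\<close>

lemma ex_gen_admissible:
  assumes k: "1 \<le> k" "k \<le> matching_number H"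
  shows "\<exists>M. gen_admissible_matching H k M"
proof -
  have "{} \<in> {M. matching H M}" by (simp add: matching_def)
  then have "matching_number H \<in> card ` {M. matching H M}"
    unfolding matching_number_def using finite_matchings by (intro Max_in) auto
  then obtain M0 where "matching H M0" "k \<le> card M0" using k by auto
  then obtain M1 where "matching H M1 \<and> card M1 = k"
    using obtain_subset_with_card_n matching_subset by metis
  from ex_has_least_nat[of "\<lambda>M. matching H M \<and> card M = k", OF this, of "\<lambda>M. card (\<Union>M)"]
  obtain M where M: "matching H M" "card M = k"
    and least: "\<And>N. matching H N \<Longrightarrow> card N = k \<Longrightarrow> card (\<Union>M) \<le> card (\<Union>N)" by blast
  have "M \<noteq> {}" using M(2) k(1) by auto
  have fin: "finite (\<Union>M)" using matching_Union_subset[OF M(1)] finite_hverts[OF H] finite_subset by blast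
  have "\<Union>N' = \<Union>M" if N': "matching (induced H (\<Union>M)) N'" "card N' = card M" for N'
  proof -
    have "matching H N'" "\<Union>N' \<subseteq> \<Union>M" using N'(1) by (auto simp: matching_def induced_def)
    \<comment> \<open>\<open>N'\<close> is itself a \<open>k\<close>-matching, so it covers at least
      as many vertices as \<open>M\<close>, all of them among those of \<open>M\<close>.\<close>
    then show ?thesis using least[of N'] N'(2) M(2) fin by (simp add: card_seteq)
  qed
  then have "gen_admissible_matching H k M"
    unfolding gen_admissible_matching_def
    using k M \<open>M \<noteq> {}\<close> by (intro conjI exI[of _ "{M}"]) (auto simp: partition_on_def)
  then show ?thesis ..
qed

end

theorem theorem3p11:
  fixes H :: "'a hypergraph" and k :: nat
  assumes "simple_hypergraph H" and "1 \<le> k" and "k \<le> matching_number H"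
  shows "(\<forall>M. gen_admissible_matching H k M \<longrightarrow>
            regularity (hverts H)
                (squarefree_power (hverts H) (edge_ideal H :: ('a, 'k::field) mpoly set) k)
              \<ge> int (card (\<Union>M)) - int (card M) + int k) \<and>
         regularity (hverts H)
             (squarefree_power (hverts H) (edge_ideal H :: ('a, 'k) mpoly set) k)
           \<ge> Max {int (card (\<Union>M)) - int (card M) | M. gen_admissible_matching H k M} + int k"
proof -
  let ?reg = "regularity (hverts H) (squarefree_power (hverts H) (edge_ideal H :: ('a, 'k) mpoly set) k)"
  let ?X = "{int (card (\<Union>M)) - int (card M) | M. gen_admissible_matching H k M}"
  have bound: "?reg \<ge> int (card (\<Union>M)) - int (card M) + int k" if "gen_admissible_matching H k M" for M
    by (rule regularity_admissible[OF assms(1) that])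
  have "?X = (\<lambda>M. int (card (\<Union>M)) - int (card M)) ` {M. gen_admissible_matching H k M}" by blast
  moreover have "finite {M. gen_admissible_matching H k M}"
    by (rule finite_subset[OF _ finite_matchings[OF assms(1)]]) (auto simp: gen_admissible_matching_def)
  ultimately have "finite ?X" by simp
  \<comment> \<open>\<open>Max\<close> is attained only on a nonempty set;
    \<open>k \<le> matching_number H\<close> provides the \<open>k\<close>-matching from which an
    admissible one is made.\<close>
  moreover have "?X \<noteq> {}" using ex_gen_admissible[OF assms] by blast
  ultimately have "Max ?X \<in> ?X" by (rule Max_in)
  then obtain M where "Max ?X = int (card (\<Union>M)) - int (card M)" "gen_admissible_matching H k M" by blast
  then have "?reg \<ge> Max ?X + int k" using bound by metis
  with bound show ?thesis by blast
qed

end
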